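(* The composition of bicharacters is associative: for quantum groups $C,A,B,D$ and bicharacters $V^{C\to A}$, $V^{A\to B}$, $V^{B\to D}$ one has $V^{B\to D}*(V^{A\to B}*V^{C\to A})=(V^{B\to D}*V^{A\to B})*V^{C\to A}$; and the (reduced bicharacter of the) multiplicative unitary $\mathrm W^C\in\mathcal U\mathcal M(\hat C\otimes C)$ is an identity on $C$ for this composition. Thus bicharacters with this composition and locally compact quantum groups are the arrows and objects of a category (called the bicharacter category).
   Context: Tensor products of $C^*$-algebras are spatial; $\mathcal M(A)$ is the multiplier algebra, $\mathcal U\mathcal M(A)$ its unitary group; leg numbering notation is used. A unitary $\mathbb W$ on $\mathcal H\otimes\mathcal H$ is multiplicative if $\mathbb W_{23}\mathbb W_{12}=\mathbb W_{12}\mathbb W_{13}\mathbb W_{23}$. It is modular if there are positive self-adjoint operators $\hat Q,Q$ on $\mathcal H$ with trivial kernels and a unitary $\widetilde{\mathbb W}$ on $\overline{\mathcal H}\otimes\mathcal H$ ($\overline{\mathcal H}$ the complex-conjugate Hilbert space) such that $\mathbb W^*(\hat Q\otimes Q)\mathbb W=\hat Q\otimes Q$ and $(x\otimes y\mid\mathbb W\mid z\otimes u)=(\overline z\otimes Qy\mid\widetilde{\mathbb W}\mid\overline x\otimes Q^{-1}u)$ for all $x,z\in\mathcal H$, $y\in\mathrm{dom}(Q)$, $u\in\mathrm{dom}(Q^{-1})$, where $(x\mid T\mid y):=(x\mid Ty)$. A (locally compact) quantum group is a pair $(C,\Delta_C)$ obtained from some modular multiplicative unitary $\mathbb W^C$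 on $\mathcal H_C\otimes\mathcal H_C$: $C\subseteq\mathbb B(\mathcal H_C)$ is the norm closure of $\{(\omega\otimes\mathrm{id})(\mathbb W^C):\omega\in\mathbb B(\mathcal H_C)_*\}$ and $\Delta_C(x)=\mathbb W^C(x\otimes1)(\mathbb W^C)^*$; its dual is $(\hat C,\Delta_{\hat C})$, where $\hat C\subseteq\mathbb B(\mathcal H_C)$ is the norm closure of $\{(\mathrm{id}\otimes\omega)((\mathbb W^C)^* ):\omega\in\mathbb B(\mathcal H_C)_*\}$ and $\Delta_{\hat C}(y)=\Sigma(\mathbb W^C)^*(1\otimes y)\mathbb W^C\Sigma$ with $\Sigma$ the coordinate flip. It is known that $C,\hat C$ are nondegenerate $C^*$-algebras, that $\Delta_C,\Delta_{\hat C}$ are comultiplications, and that $\mathbb W^C$ is the image of a unitary $\mathrm W^C\in\mathcal U\mathcal M(\hat C\otimes C)$, the reduced bicharacter, which depends only on $(C,\Delta_C)$. A generating modular multiplicative unitary is fixed for each quantum group. A bicharacter from $C$ to $A$ is a unitary $V\in\mathcal U\mathcal M(\hat C\otimes A)$ with $(\Delta_{\hat C}\otimes\mathrm{id}_A)V=V_{23}V_{13}$ and $(\mathrm{id}_{\hat C}\otimes\Delta_A)V=V_{12}V_{13}$; its image in $\mathcal U(\mathcal H_C\otimes\mathcal H_A)$ is denoted $\mathbb V$. The composition $V^{C\to B}=V^{A\to B}*V^{C\to A}$ of bicharacters from $C$ to $A$ and from $A$ to $B$ is the unique bicharacter in $\mathcal U\mathcal M(\hat C\otimes B)$ with $\mathbb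 V^{A\to B}_{23}\mathbb V^{C\to A}_{12}=\mathbb V^{C\to A}_{12}\mathbb V^{C\to B}_{13}\mathbb V^{A\to B}_{23}$ on $\mathcal H_C\otimes\mathcal H_A\otimes\mathcal H_B$. *)

theory Defs
  imports "HOL-Analysis.Analysis" "HOL-Library.FuncSet"
begin

section \<open>Complex Hilbert spaces\<close>

text \<open>The inner product is linear in the second variable.\<close>

class chilbert = real_inner + complete_space +
  fixes scaleC :: "complex \<Rightarrow> 'a \<Rightarrow> 'a"  (infixr "*\<^sub>C" 75)
    and cinner :: "'a \<Rightarrow> 'a \<Rightarrow> complex"
  assumes scaleC_of_real: "scaleC (complex_of_real r) x = r *\<^sub>R x"
    and scaleC_scaleC: "scaleC a (scaleC b x) = scaleC (a * b) x"
    and scaleC_add_left: "scaleC (a + b) x = scaleC a x + scaleC b x"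
    and scaleC_add_right: "scaleC a (x + y) = scaleC a x + scaleC a y"
    and cinner_commute: "cinner x y = cnj (cinner y x)"
    and cinner_add_right: "cinner x (y + z) = cinner x y + cinner x z"
    and cinner_scaleC_right: "cinner x (scaleC c y) = c * cinner x y"
    and Re_cinner: "Re (cinner x y) = inner x y"
begin

lemma cinner_add_left: "cinner (x + y) z = cinner x z + cinner y z"
  by (metis cinner_add_right cinner_commute complex_cnj_add)

lemma cinner_scaleC_left: "cinner (scaleC c x) y = cnj c * cinner x y"
  by (metis cinner_commute cinner_scaleC_right complex_cnj_mult)

lemma cinner_scaleR_right: "cinner x (r *\<^sub>R y) = of_real r * cinner x y"
  by (metis cinner_scaleC_right scaleC_of_real)

lemma cinner_scaleR_left: "cinner (r *\<^sub>R x) y = of_real r * cinner x y"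
  by (metis cinner_scaleC_left scaleC_of_real complex_cnj_complex_of_real)

lemma cinner_self: "cinner x x = of_real ((norm x)\<^sup>2)"
proof -
  have "Im (cinner x x) = - Im (cinner x x)"
    by (subst (1) cinner_commute) simp
  then have "Im (cinner x x) = 0" by simp
  moreover have "Re (cinner x x) = (norm x)\<^sup>2"
    by (simp add: Re_cinner norm_eq_sqrt_inner)
  ultimately show ?thesis by (simp add: complex_eq_iff)
qed

end

lemma scaleC_zero_left [simp]: "0 *\<^sub>C (x::'a::chilbert) = 0"
  using scaleC_of_real[of 0 x] by simp

lemma scaleC_one [simp]: "1 *\<^sub>C (x::'a::chilbert) = x"
  using scaleC_of_real[of 1 x] by simp

lemma scaleC_zero_right [simp]: "a *\<^sub>C (0::'a::chilbert) = 0"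
  using scaleC_add_right[of a "0::'a" 0] by simp

lemma cinner_zero_right [simp]: "cinner (x::'a::chilbert) 0 = 0"
  using cinner_add_right[of x 0 0] by simp

lemma cinner_zero_left [simp]: "cinner 0 (x::'a::chilbert) = 0"
  using cinner_add_left[of 0 0 x] by simp

lemma cinner_minus_right: "cinner (x::'a::chilbert) (- y) = - cinner x y"
  using cinner_scaleR_right[of x "-1" y] by simp

lemma cinner_diff_right: "cinner (x::'a::chilbert) (y - z) = cinner x y - cinner x z"
  using cinner_add_right[of x y "- z"] by (simp add: cinner_minus_right)

lemma cinner_diff_left: "cinner ((x::'a::chilbert) - y) z = cinner x z - cinner y z"
  by (metis cinner_commute cinner_diff_right complex_cnj_diff)

lemma norm_scaleC: "norm (a *\<^sub>C (x::'a::chilbert)) = cmod a * norm x"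
proof -
  have "complex_of_real ((norm (a *\<^sub>C x))\<^sup>2) = (a * cnj a) * of_real ((norm x)\<^sup>2)"
    by (simp only: cinner_self[symmetric] cinner_scaleC_left cinner_scaleC_right)
      (simp add: mult_ac)
  also have "\<dots> = of_real ((cmod a * norm x)\<^sup>2)"
    by (simp only: complex_norm_square[symmetric] power_mult_distrib of_real_mult of_real_power)
  finally have "complex_of_real ((norm (a *\<^sub>C x))\<^sup>2) = of_real ((cmod a * norm x)\<^sup>2)" .
  then have "(norm (a *\<^sub>C x))\<^sup>2 = (cmod a * norm x)\<^sup>2"
    using of_real_eq_iff by blast
  then show ?thesis
    by (simp add: power2_eq_iff_nonneg)
qed

lemma cmod_cinner_le: "cmod (cinner (x::'a::chilbert) y) \<le> norm x * norm y"
proof (cases "cinner x y = 0")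
  case False
  define c where "c = cnj (cinner x y) / cmod (cinner x y)"
  have c: "cmod c = 1" using False by (simp add: c_def norm_divide)
  have "cinner x (c *\<^sub>C y) = of_real (cmod (cinner x y))"
    using False
    by (simp add: cinner_scaleC_right c_def complex_norm_square[symmetric] power2_eq_square
        mult.commute[of "cnj _"])
  then have "cmod (cinner x y) = inner x (c *\<^sub>C y)"
    by (metis Re_cinner Re_complex_of_real)
  also have "\<dots> \<le> norm x * norm (c *\<^sub>C y)" by (rule norm_cauchy_schwarz)
  finally show ?thesis using c by (simp add: norm_scaleC)
qed auto

lemma bounded_linear_cinner_right: "bounded_linear (cinner (x::'a::chilbert))"
  by (rule bounded_linear_intro[where K="norm x"])
    (auto simp: cinner_add_right cinner_scaleR_right scaleR_conv_of_real cmod_cinner_le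
      mult.commute[of "norm x"] intro: order_trans[OF cmod_cinner_le])

lemma bounded_linear_cinner_left: "bounded_linear (\<lambda>x. cinner x (y::'a::chilbert))"
  by (rule bounded_linear_intro[where K="norm y"])
    (auto simp: cinner_add_left cinner_scaleR_left scaleR_conv_of_real cmod_cinner_le)

definition csubspace :: "'a::chilbert set \<Rightarrow> bool" where
  "csubspace S \<longleftrightarrow> 0 \<in> S \<and> (\<forall>x\<in>S. \<forall>y\<in>S. x + y \<in> S) \<and> (\<forall>c. \<forall>x\<in>S. c *\<^sub>C x \<in> S)"

definition cspan :: "'a::chilbert set \<Rightarrow> 'a set" where
  "cspan S = span {c *\<^sub>C x | c x. x \<in> S}"

subsection \<open>The complex conjugate Hilbert space\<close>

typedef (overloaded) 'a conj_space = "UNIV :: 'a::chilbert set"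
  morphisms unbar bar by simp

setup_lifting type_definition_conj_space

instantiation conj_space :: (chilbert) real_inner
begin
lift_definition zero_conj_space :: "'a conj_space" is 0 .
lift_definition plus_conj_space :: "'a conj_space \<Rightarrow> 'a conj_space \<Rightarrow> 'a conj_space" is plus .
lift_definition minus_conj_space :: "'a conj_space \<Rightarrow> 'a conj_space \<Rightarrow> 'a conj_space" is minus .
lift_definition uminus_conj_space :: "'a conj_space \<Rightarrow> 'a conj_space" is uminus .
lift_definition scaleR_conj_space :: "real \<Rightarrow> 'a conj_space \<Rightarrow> 'a conj_space" is scaleR .
lift_definition inner_conj_space :: "'a conj_space \<Rightarrow> 'a conj_space \<Rightarrow> real" is inner .
lift_definition norm_conj_space :: "'a conj_space \<Rightarrow> real" is norm .
lift_definition dist_conj_space :: "'a conj_space \<Rightarrow> 'a conj_space \<Rightarrow> real" is dist .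
lift_definition sgn_conj_space :: "'a conj_space \<Rightarrow> 'a conj_space" is sgn .
definition uniformity_conj_space :: "('a conj_space \<times> 'a conj_space) filter" where
  "uniformity_conj_space = (INF e\<in>{0<..}. principal {(x, y). dist x y < e})"
definition open_conj_space :: "'a conj_space set \<Rightarrow> bool" where
  "open_conj_space U \<longleftrightarrow> (\<forall>x\<in>U. eventually (\<lambda>(x', y). x' = x \<longrightarrow> y \<in> U) uniformity)"
instance
proof
  fix x y z :: "'a conj_space" and r s :: real and U :: "'a conj_space set"
  show "x + y + z = x + (y + z)" by transfer (simp add: add.assoc)
  show "x + y = y + x" by transfer (simp add: add.commute)
  show "0 + x = x" by transfer simp
  show "- x + x = 0" by transfer simp
  show "x - y = x + - y" by transfer simp
  show "r *\<^sub>R (x + y) = r *\<^sub>R x + r *\<^sub>R y" by transfer (simp add: scaleR_add_right)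
  show "(r + s) *\<^sub>R x = r *\<^sub>R x + s *\<^sub>R x" by transfer (simp add: scaleR_add_left)
  show "r *\<^sub>R s *\<^sub>R x = (r * s) *\<^sub>R x" by transfer simp
  show "1 *\<^sub>R x = x" by transfer simp
  show "sgn x = inverse (norm x) *\<^sub>R x" by transfer (simp add: sgn_div_norm)
  show "dist x y = norm (x - y)" by transfer (simp add: dist_norm)
  show "inner x y = inner y x" by transfer (simp add: inner_commute)
  show "inner (x + y) z = inner x z + inner y z" by transfer (simp add: inner_add_left)
  show "inner (r *\<^sub>R x) y = r * inner x y" by transfer simp
  show "0 \<le> inner x x" by transfer simp
  show "inner x x = 0 \<longleftrightarrow> x = 0" by transfer simp
  show "norm x = sqrt (inner x x)" by transfer (simp add: norm_eq_sqrt_inner)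
qed (simp_all add: uniformity_conj_space_def open_conj_space_def)
end

instantiation conj_space :: (chilbert) chilbert
begin
lift_definition scaleC_conj_space :: "complex \<Rightarrow> 'a conj_space \<Rightarrow> 'a conj_space"
  is "\<lambda>c. scaleC (cnj c)" .
lift_definition cinner_conj_space :: "'a conj_space \<Rightarrow> 'a conj_space \<Rightarrow> complex"
  is "\<lambda>x y. cinner y x" .
instance
proof
  fix x y z :: "'a conj_space" and r :: real and a b :: complex
  show "complex_of_real r *\<^sub>C x = r *\<^sub>R x" by transfer (simp add: scaleC_of_real)
  show "a *\<^sub>C b *\<^sub>C x = (a * b) *\<^sub>C x" by transfer (simp add: scaleC_scaleC)
  show "(a + b) *\<^sub>C x = a *\<^sub>C x + b *\<^sub>C x" by transfer (simp add: scaleC_add_left)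
  show "a *\<^sub>C (x + y) = a *\<^sub>C x + a *\<^sub>C y" by transfer (simp add: scaleC_add_right)
  show "cinner x y = cnj (cinner y x)" by transfer (rule cinner_commute)
  show "cinner x (y + z) = cinner x y + cinner x z" by transfer (rule cinner_add_left)
  show "cinner x (a *\<^sub>C y) = a * cinner x y" by transfer (simp add: cinner_scaleC_left)
  show "Re (cinner x y) = inner x y" by transfer (simp add: Re_cinner inner_commute)
next
  fix X :: "nat \<Rightarrow> 'a conj_space"
  assume "Cauchy X"
  moreover have d: "dist x y = dist (unbar x) (unbar y)" for x y :: "'a conj_space"
    by transfer simp
  ultimately have "Cauchy (\<lambda>n. unbar (X n))"
    by (simp add: Cauchy_def)
  then obtain l where "(\<lambda>n. unbar (X n)) \<longlonglongrightarrow> l"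
    using Cauchy_convergent convergent_def by blast
  then have "X \<longlonglongrightarrow> bar l"
    by (simp add: tendsto_iff d bar_inverse)
  then show "convergent X" by (auto simp: convergent_def)
qed
end

subsection \<open>Orthonormal bases\<close>

lemma subspace_closure:
  fixes S :: "'a::real_normed_vector set"
  assumes "subspace S"
  shows "subspace (closure S)"
  unfolding subspace_def
proof (intro conjI ballI allI)
  show "0 \<in> closure S" using assms subspace_0 closure_subset by blast
  fix x y assume "x \<in> closure S" "y \<in> closure S"
  then obtain f g where fg: "\<And>n. f n \<in> S" "f \<longlonglongrightarrow> x" "\<And>n. g n \<in> S" "g \<longlonglongrightarrow> y"
    by (metis closure_sequential)
  have "\<And>n. f n + g n \<in> S" using assms fg by (simp add: subspace_add)
  then show "x + y \<in> closure S" using tendsto_add[OF fg(2,4)] by (metis closure_sequential)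
next
  fix c x assume "x \<in> closure S"
  then obtain f where f: "\<And>n. f n \<in> S" "f \<longlonglongrightarrow> x" by (metis closure_sequential)
  have "\<And>n. c *\<^sub>R f n \<in> S" using assms f by (simp add: subspace_scale)
  then show "c *\<^sub>R x \<in> closure S"
    using tendsto_scaleR[OF tendsto_const f(2)] by (metis closure_sequential)
qed

lemma closed_subspace_orthogonal:
  fixes S :: "'a::{real_inner, complete_space} set"
  assumes S: "subspace S" "closed S" and x: "x \<notin> S"
  shows "\<exists>z. z \<noteq> 0 \<and> (\<forall>s\<in>S. inner z s = 0)"
proof -
  define d where "d = infdist x S"
  have ne: "S \<noteq> {}" using S(1) subspace_0 by blast
  have le: "d \<le> norm (x - s)" if "s \<in> S" for s
    using infdist_le[OF that, of x] by (simp add: d_def dist_norm)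
  have d0: "0 \<le> d" by (simp add: d_def infdist_nonneg)
  have "\<exists>s\<in>S. norm (x - s) < d + 1 / Suc n" for n
  proof -
    have "infdist x S < d + 1 / Suc n" by (simp add: d_def)
    then show ?thesis
      using ne cINF_less_iff[OF ne bdd_below_image_dist, of x "d + 1 / Suc n"]
      by (simp add: infdist_notempty dist_norm)
  qed
  then obtain s where s: "\<And>n. s n \<in> S" "\<And>n. norm (x - s n) < d + 1 / Suc n" by metis
  have lim: "(\<lambda>n. norm (x - s n)) \<longlonglongrightarrow> d"
  proof (rule tendsto_sandwich[OF _ _ tendsto_const])
    show "\<forall>\<^sub>F n in sequentially. d \<le> norm (x - s n)" using le s(1) by simp
    show "\<forall>\<^sub>F n in sequentially. norm (x - s n) \<le> d + 1 / Suc n" using s(2) by (intro always_eventually allI less_imp_le)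
    show "(\<lambda>n. d + 1 / Suc n) \<longlonglongrightarrow> d"
      using tendsto_add[OF tendsto_const[of d] LIMSEQ_inverse_real_of_nat]
      by (simp add: inverse_eq_divide)
  qed
  have par: "(norm (u - v))\<^sup>2 \<le> 2 * (norm (x - u))\<^sup>2 + 2 * (norm (x - v))\<^sup>2 - 4 * d\<^sup>2"
    if "u \<in> S" "v \<in> S" for u v
  proof -
    have "(1/2) *\<^sub>R (u + v) \<in> S" using S(1) that by (simp add: subspace_add subspace_scale)
    then have "d \<le> norm (x - (1/2) *\<^sub>R (u + v))" by (rule le)
    then have "d\<^sup>2 \<le> (norm (x - (1/2) *\<^sub>R (u + v)))\<^sup>2" using d0 by (simp add: power_mono)
    moreover have "(norm (u - v))\<^sup>2 + 4 * (norm (x - (1/2) *\<^sub>R (u + v)))\<^sup>2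
        = 2 * (norm (x - u))\<^sup>2 + 2 * (norm (x - v))\<^sup>2"
      by (simp add: power2_norm_eq_inner inner_diff_left inner_diff_right inner_add_left
          inner_add_right inner_commute algebra_simps)
    ultimately show ?thesis by linarith
  qed
  have "Cauchy s"
  proof (rule metric_CauchyI)
    fix e :: real assume e: "0 < e"
    have "(\<lambda>n. 4 * ((norm (x - s n))\<^sup>2 - d\<^sup>2)) \<longlonglongrightarrow> 4 * (d\<^sup>2 - d\<^sup>2)"
      by (intro tendsto_intros lim)
    then have "\<forall>\<^sub>F n in sequentially. 4 * ((norm (x - s n))\<^sup>2 - d\<^sup>2) < e\<^sup>2"
      using e order_tendstoD(2) by fastforce
    then obtain N where N: "\<And>n. n \<ge> N \<Longrightarrow> 4 * ((norm (x - s n))\<^sup>2 - d\<^sup>2) < e\<^sup>2"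
      by (auto simp: eventually_sequentially)
    have "dist (s m) (s n) < e" if "m \<ge> N" "n \<ge> N" for m n
    proof -
      have "(norm (s m - s n))\<^sup>2 < e\<^sup>2"
        using par[OF s(1)[of m] s(1)[of n]] N[OF that(1)] N[OF that(2)]
        unfolding right_diff_distrib by argo
      then show ?thesis using e power_less_imp_less_base by (fastforce simp: dist_norm)
    qed
    then show "\<exists>N. \<forall>m\<ge>N. \<forall>n\<ge>N. dist (s m) (s n) < e" by blast
  qed
  then obtain l where l: "s \<longlonglongrightarrow> l" using Cauchy_convergent convergent_def by blast
  have lS: "l \<in> S" using S(2) s(1) l closed_sequentially by blast
  have "(\<lambda>n. norm (x - s n)) \<longlonglongrightarrow> norm (x - l)" by (intro tendsto_intros l)
  then have nd: "norm (x - l) = d" using lim LIMSEQ_unique by blast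
  have "inner (x - l) t = 0" if t: "t \<in> S" for t
  proof (cases "t = 0")
    case False
    define r where "r = inner (x - l) t / (norm t)\<^sup>2"
    have "l + r *\<^sub>R t \<in> S" using S(1) lS t by (simp add: subspace_add subspace_scale)
    then have "d\<^sup>2 \<le> (norm (x - (l + r *\<^sub>R t)))\<^sup>2" using le d0 by (simp add: power_mono)
    also have "\<dots> = (norm (x - l))\<^sup>2 - 2 * r * inner (x - l) t + r\<^sup>2 * (norm t)\<^sup>2"
      unfolding power2_norm_eq_inner diff_diff_eq[symmetric]
      by (simp add: inner_diff_left inner_diff_right inner_commute power2_eq_square algebra_simps)
    also have "\<dots> = d\<^sup>2 - (inner (x - l) t)\<^sup>2 / (norm t)\<^sup>2"
      using False nd by (simp add: r_def power2_eq_square field_simps)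
    finally have "(inner (x - l) t)\<^sup>2 / (norm t)\<^sup>2 \<le> 0" by simp
    then show ?thesis using False by (simp add: divide_le_0_iff)
  qed auto
  moreover have "x - l \<noteq> 0" using lS x by auto
  ultimately show ?thesis by blast
qed

definition orthonormal :: "'a::chilbert set \<Rightarrow> bool" where
  "orthonormal B \<longleftrightarrow> (\<forall>x\<in>B. \<forall>y\<in>B. cinner x y = (if x = y then 1 else 0))"

definition onb :: "'a::chilbert set" where
  "onb = (SOME B. orthonormal B \<and> closure (cspan B) = UNIV)"

lemma onb: "orthonormal (onb :: 'a::chilbert set)" "closure (cspan (onb :: 'a set)) = UNIV"
proof -
  have "\<exists>B::'a set. orthonormal B \<and> closure (cspan B) = UNIV"
  proof -
    have "\<exists>M\<in>{B::'a set. orthonormal B}. \<forall>X\<in>{B. orthonormal B}. M \<subseteq> X \<longrightarrow> X = M"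
    proof (rule subset_Zorn_nonempty)
      show "{B::'a set. orthonormal B} \<noteq> {}" by (auto simp: orthonormal_def)
      fix \<C> :: "'a set set" assume "\<C> \<noteq> {}" and c: "subset.chain {B. orthonormal B} \<C>"
      have "cinner x y = (if x = y then 1 else 0)" if xy: "x \<in> \<Union>\<C>" "y \<in> \<Union>\<C>" for x y
      proof -
        obtain X Y where XY: "X \<in> \<C>" "Y \<in> \<C>" "x \<in> X" "y \<in> Y" using xy by blast
        then have "X \<subseteq> Y \<or> Y \<subseteq> X" using c by (auto simp: subset_chain_def)
        then obtain Z where "Z \<in> \<C>" "x \<in> Z" "y \<in> Z" using XY by (metis subsetD)
        moreover have "orthonormal Z" using c \<open>Z \<in> \<C>\<close> by (auto simp: subset_chain_def)
        ultimately show ?thesis by (simp add: orthonormal_def)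
      qed
      then show "\<Union>\<C> \<in> {B. orthonormal B}" by (simp add: orthonormal_def)
    qed
    then obtain M :: "'a set" where M: "orthonormal M"
      and mx: "\<And>X. orthonormal X \<Longrightarrow> M \<subseteq> X \<Longrightarrow> X = M" by auto
    have "closure (cspan M) = UNIV"
    proof (rule ccontr)
      assume "closure (cspan M) \<noteq> UNIV"
      then obtain x where "x \<notin> closure (cspan M)" by blast
      moreover have "subspace (closure (cspan M))"
        by (simp add: cspan_def subspace_closure)
      ultimately obtain z where z: "z \<noteq> 0" "\<And>s. s \<in> closure (cspan M) \<Longrightarrow> inner z s = 0"
        using closed_subspace_orthogonal[OF _ closed_closure] by meson
      have zc: "cinner z m = 0" if "m \<in> M" for m
      proof -
        have "inner z (c *\<^sub>C m) = 0" for c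
          by (rule z(2), rule subsetD[OF closure_subset]) (use that in \<open>auto simp: cspan_def intro!: span_base\<close>)
        from this[of 1] this[of "- \<i>"] have "Re (cinner z m) = 0" "Im (cinner z m) = 0"
          by (auto simp: Re_cinner[symmetric] cinner_scaleC_right)
        then show ?thesis by (simp add: complex_eq_iff)
      qed
      define w where "w = (1 / norm z) *\<^sub>R z"
      have ww: "cinner w w = 1" using z(1) by (simp add: cinner_self w_def)
      have wm: "cinner w m = 0" "cinner m w = 0" if "m \<in> M" for m
        using zc[OF that] cinner_commute[of m w] by (auto simp: w_def cinner_scaleR_left)
      have "orthonormal (insert w M)"
        using M ww wm by (auto simp: orthonormal_def)
      then have "w \<in> M" using mx[of "insert w M"] by blast
      then show False using wm ww by force
    qed
    then show ?thesis using M by blast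
  qed
  from someI_ex[OF this, folded onb_def]
  show "orthonormal (onb :: 'a set)" "closure (cspan (onb :: 'a set)) = UNIV" by auto
qed

lemma onb_expansion: "((\<lambda>e. cinner e y *\<^sub>C e) has_sum (y::'a::chilbert)) onb"
proof -
  define p where "p F y = (\<Sum>e\<in>F. cinner e y *\<^sub>C e)" for F and y :: 'a
  have p_add: "p F (u + v) = p F u + p F v" for F u v
    by (simp add: p_def cinner_add_right scaleC_add_left sum.distrib)
  have p_diff: "p F (u - v) = p F u - p F v" for F u v
    using p_add[of F "u - v" v] by simp
  have on: "cinner e e = 1" "f \<noteq> e \<Longrightarrow> cinner f e = 0" if "F \<subseteq> onb" "e \<in> F" "f \<in> F" for F and e f :: 'a
    using onb(1)[where 'a='a] subsetD[OF that(1) that(2)] subsetD[OF that(1) that(3)]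
    by (auto simp: orthonormal_def)
  have p_e: "p F (c *\<^sub>C e) = c *\<^sub>C e" if "finite F" "F \<subseteq> onb" "e \<in> F" for F c e
  proof -
    have "p F (c *\<^sub>C e) = (\<Sum>f\<in>F. if f = e then c *\<^sub>C e else 0)"
      unfolding p_def using on[OF that(2,3)]
      by (intro sum.cong) (auto simp: cinner_scaleC_right)
    then show ?thesis using that by simp
  qed
  have cs: "cinner (p F y) e = cinner y e" if "finite F" "F \<subseteq> onb" "e \<in> F" for F y e
  proof -
    interpret bounded_linear "\<lambda>x. cinner x e" by (rule bounded_linear_cinner_left)
    have "cinner (p F y) e = (\<Sum>f\<in>F. if f = e then cnj (cinner e y) else 0)"
      unfolding p_def sum using on[OF that(2,3)]
      by (intro sum.cong) (auto simp: cinner_scaleC_left)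
    then show ?thesis using that by (simp add: cinner_commute[symmetric])
  qed
  have nle: "norm (y - p F y) \<le> norm y" if "finite F" "F \<subseteq> onb" for F y
  proof -
    interpret bounded_linear "cinner (y - p F y)" by (rule bounded_linear_cinner_right)
    have "cinner (y - p F y) (p F y) = 0"
      by (subst (2) p_def, subst sum) (simp add: cinner_scaleC_right cinner_diff_left cs[OF that])
    then have "inner (y - p F y) (p F y) = 0" using Re_cinner by (metis zero_complex.simps(1))
    then have "(norm y)\<^sup>2 = (norm (y - p F y))\<^sup>2 + (norm (p F y))\<^sup>2"
      using norm_add_Pythagorean[of "y - p F y" "p F y"] by (simp add: orthogonal_def)
    then have "(norm (y - p F y))\<^sup>2 \<le> (norm y)\<^sup>2" by simp
    then show ?thesis by (rule power2_le_imp_le) simp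
  qed
  have fx: "\<exists>F0. finite F0 \<and> F0 \<subseteq> onb \<and> (\<forall>F. finite F \<and> F0 \<subseteq> F \<and> F \<subseteq> onb \<longrightarrow> p F s = s)"
    if "s \<in> cspan onb" for s
    using that unfolding cspan_def
  proof (induction rule: span_induct_alt)
    case base
    show ?case by (rule exI[of _ "{}"]) (simp add: p_def)
  next
    case (step r x s)
    from step(1) obtain c e where x: "x = c *\<^sub>C e" "e \<in> onb" by auto
    from step(2) obtain F0 where F0: "finite F0" "F0 \<subseteq> onb"
      "\<And>F. finite F \<Longrightarrow> F0 \<subseteq> F \<Longrightarrow> F \<subseteq> onb \<Longrightarrow> p F s = s" by metis
    have "r *\<^sub>R x = (of_real r * c) *\<^sub>C e" by (simp add: x scaleC_scaleC[symmetric] scaleC_of_real)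
    then show ?case
      using F0 x by (intro exI[of _ "insert e F0"]) (auto simp: p_add p_e)
  qed
  show ?thesis
    unfolding has_sum_def p_def[symmetric]
  proof (rule tendstoI)
    fix e :: real assume "0 < e"
    moreover have "y \<in> closure (cspan onb)" using onb(2) by auto
    ultimately obtain s where s: "s \<in> cspan onb" "dist s y < e"
      by (auto simp: closure_approachable)
    then obtain F0 where F0: "finite F0" "F0 \<subseteq> onb"
      "\<And>F. finite F \<Longrightarrow> F0 \<subseteq> F \<Longrightarrow> F \<subseteq> onb \<Longrightarrow> p F s = s" using fx[OF s(1)] by metis
    have "dist (p F y) y < e" if "finite F" "F0 \<subseteq> F" "F \<subseteq> onb" for F
    proof -
      have "y - p F y = (y - s) - p F (y - s)" using F0(3)[OF that] by (simp add: p_diff)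
      then have "norm (y - p F y) \<le> norm (y - s)" using nle[OF that(1,3), of "y - s"] by metis
      then show ?thesis using s(2) by (simp only: dist_norm norm_minus_commute[of _ y])
    qed
    then show "\<forall>\<^sub>F F in finite_subsets_at_top onb. dist (p F y) y < e"
      unfolding eventually_finite_subsets_at_top using F0 by blast
  qed
qed

lemma onb_parseval: "((\<lambda>e. cinner x e * cinner e y) has_sum cinner x (y::'a::chilbert)) onb"
  using has_sum_bounded_linear[OF bounded_linear_cinner_right onb_expansion, of x y]
  by (simp add: o_def cinner_scaleC_right mult.commute)

subsection \<open>The Hilbert tensor product\<close>

text \<open>
  A vector of the Hilbert tensor product is represented by its square-summable family of
  coefficients with respect to a fixed orthonormal basis of the left factor; the coefficient
  of the simple tensor of x and y at e is (e | x) y.  The lemmas cinner_tensor and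
  tensor_dense below show that this is a Hilbert tensor product; nothing after them
  refers to the basis.
\<close>

typedef (overloaded) ('a, 'b) htensor =
  "{f :: 'a::chilbert \<Rightarrow> 'b::chilbert.
      (\<forall>e. e \<notin> onb \<longrightarrow> f e = 0) \<and> (\<lambda>e. (norm (f e))\<^sup>2) summable_on UNIV}"
  by (rule exI[of _ "\<lambda>_. 0"]) simp

setup_lifting type_definition_htensor

lemma l2_add:
  assumes "(\<lambda>e. (norm (f e :: 'b::real_inner))\<^sup>2) summable_on UNIV"
    and "(\<lambda>e. (norm (g e))\<^sup>2) summable_on UNIV"
  shows "(\<lambda>e. (norm (f e + g e))\<^sup>2) summable_on UNIV"
proof (rule summable_on_comparison_test)
  show "(\<lambda>e. 2 * (norm (f e))\<^sup>2 + 2 * (norm (g e))\<^sup>2) summable_on UNIV"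
    using assms by (intro summable_on_add summable_on_cmult_right)
  fix e
  have "(norm (f e + g e))\<^sup>2 \<le> (norm (f e) + norm (g e))\<^sup>2"
    by (simp add: norm_triangle_ineq power_mono)
  also have "\<dots> \<le> 2 * (norm (f e))\<^sup>2 + 2 * (norm (g e))\<^sup>2"
    using sum_squares_bound[of "norm (f e)" "norm (g e)"] by (simp add: power2_sum)
  finally show "(norm (f e + g e))\<^sup>2 \<le> 2 * (norm (f e))\<^sup>2 + 2 * (norm (g e))\<^sup>2" .
qed simp

lemma l2_cinner:
  fixes f g :: "'a \<Rightarrow> 'b::chilbert"
  assumes "(\<lambda>e. (norm (f e))\<^sup>2) summable_on UNIV" "(\<lambda>e. (norm (g e))\<^sup>2) summable_on UNIV"
  shows "(\<lambda>e. cinner (f e) (g e)) summable_on UNIV"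
proof (rule abs_summable_summable, rule summable_on_comparison_test)
  show "(\<lambda>e. (norm (f e))\<^sup>2 + (norm (g e))\<^sup>2) summable_on UNIV"
    using assms by (intro summable_on_add)
  fix e
  have "norm (cinner (f e) (g e)) \<le> norm (f e) * norm (g e)" by (rule cmod_cinner_le)
  also have "\<dots> \<le> (norm (f e))\<^sup>2 + (norm (g e))\<^sup>2"
    using sum_squares_bound[of "norm (f e)" "norm (g e)"]
      mult_nonneg_nonneg[OF norm_ge_zero[of "f e"] norm_ge_zero[of "g e"]] by linarith
  finally show "norm (cinner (f e) (g e)) \<le> (norm (f e))\<^sup>2 + (norm (g e))\<^sup>2" .
qed simp

instantiation htensor :: (chilbert, chilbert) real_vector
begin
lift_definition zero_htensor :: "('a, 'b) htensor" is "\<lambda>_. 0" by simp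
lift_definition plus_htensor :: "('a, 'b) htensor \<Rightarrow> ('a, 'b) htensor \<Rightarrow> ('a, 'b) htensor"
  is "\<lambda>f g e. f e + g e" by (simp add: l2_add)
lift_definition uminus_htensor :: "('a, 'b) htensor \<Rightarrow> ('a, 'b) htensor"
  is "\<lambda>f e. - f e" by simp
lift_definition minus_htensor :: "('a, 'b) htensor \<Rightarrow> ('a, 'b) htensor \<Rightarrow> ('a, 'b) htensor"
  is "\<lambda>f g e. f e - g e"
  subgoal for f g using l2_add[of f "\<lambda>e. - g e"] by simp
  done
lift_definition scaleR_htensor :: "real \<Rightarrow> ('a, 'b) htensor \<Rightarrow> ('a, 'b) htensor"
  is "\<lambda>r f e. r *\<^sub>R f e" by (auto simp: power_mult_distrib summable_on_cmult_right)
instance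
  by (standard; transfer) (auto simp: add.assoc add.commute scaleR_add_left scaleR_add_right)
end

lift_definition htensor_cinner :: "('a::chilbert, 'b::chilbert) htensor \<Rightarrow> ('a, 'b) htensor \<Rightarrow> complex"
  is "\<lambda>f g. \<Sum>\<^sub>\<infinity>e. cinner (f e) (g e)" .

lift_definition htensor_scaleC :: "complex \<Rightarrow> ('a::chilbert, 'b::chilbert) htensor \<Rightarrow> ('a, 'b) htensor"
  is "\<lambda>c f e. c *\<^sub>C f e" by (auto simp: norm_scaleC power_mult_distrib summable_on_cmult_right)

lemma htensor_cinner_add_right:
  "htensor_cinner x (y + z) = htensor_cinner x y + htensor_cinner x z"
  by transfer (simp add: cinner_add_right infsum_add l2_cinner)

lemma htensor_cinner_commute: "htensor_cinner x y = cnj (htensor_cinner y x)"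
  by transfer (simp flip: infsum_cnj add: cinner_commute[symmetric])

lemma htensor_cinner_scaleC_right:
  "htensor_cinner x (htensor_scaleC c y) = c * htensor_cinner x y"
  by transfer (simp add: cinner_scaleC_right infsum_cmult_right l2_cinner)

lemma htensor_scaleR: "r *\<^sub>R x = htensor_scaleC (of_real r) x"
  by transfer (simp add: scaleC_of_real)

lemma summable_Rep_htensor: "(\<lambda>e. (norm (Rep_htensor x e))\<^sup>2) summable_on UNIV"
  using Rep_htensor[of x] by simp

lemma htensor_cinner_self:
  "htensor_cinner x x = of_real (\<Sum>\<^sub>\<infinity>e. (norm (Rep_htensor x e))\<^sup>2)"
  unfolding htensor_cinner.rep_eq cinner_self
  by (intro infsumI has_sum_of_real has_sum_infsum summable_Rep_htensor)

instantiation htensor :: (chilbert, chilbert) real_inner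
begin
definition inner_htensor :: "('a, 'b) htensor \<Rightarrow> ('a, 'b) htensor \<Rightarrow> real" where
  "inner_htensor x y = Re (htensor_cinner x y)"
definition norm_htensor :: "('a, 'b) htensor \<Rightarrow> real" where
  "norm_htensor x = sqrt (inner x x)"
definition dist_htensor :: "('a, 'b) htensor \<Rightarrow> ('a, 'b) htensor \<Rightarrow> real" where
  "dist_htensor x y = norm (x - y)"
definition sgn_htensor :: "('a, 'b) htensor \<Rightarrow> ('a, 'b) htensor" where
  "sgn_htensor x = inverse (norm x) *\<^sub>R x"
definition uniformity_htensor :: "(('a, 'b) htensor \<times> ('a, 'b) htensor) filter" where
  "uniformity_htensor = (INF e\<in>{0<..}. principal {(x, y). dist x y < e})"
definition open_htensor :: "('a, 'b) htensor set \<Rightarrow> bool" where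
  "open_htensor U \<longleftrightarrow> (\<forall>x\<in>U. eventually (\<lambda>(x', y). x' = x \<longrightarrow> y \<in> U) uniformity)"
instance
proof
  fix x y z :: "('a, 'b) htensor" and r :: real
  show "inner x y = inner y x"
    using htensor_cinner_commute[of x y] by (simp add: inner_htensor_def)
  show "inner (x + y) z = inner x z + inner y z"
    unfolding inner_htensor_def htensor_cinner_commute[of _ z]
    by (simp add: htensor_cinner_add_right)
  show "inner (r *\<^sub>R x) y = r * inner x y"
    unfolding inner_htensor_def htensor_cinner_commute[of _ y]
    by (simp add: htensor_scaleR htensor_cinner_scaleC_right)
  show "0 \<le> inner x x"
    by (simp add: inner_htensor_def htensor_cinner_self infsum_nonneg)
  show "inner x x = 0 \<longleftrightarrow> x = 0"
  proof
    assume "inner x x = 0"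
    then have s: "(\<Sum>\<^sub>\<infinity>e. (norm (Rep_htensor x e))\<^sup>2) = 0"
      by (simp add: inner_htensor_def htensor_cinner_self)
    have "(norm (Rep_htensor x e))\<^sup>2 = 0" for e
      using summable_Rep_htensor[of x]
      by (intro nonneg_infsum_le_0D[where A=UNIV, OF eq_refl[OF s]]) auto
    then show "x = 0" by transfer auto
  qed (simp add: inner_htensor_def htensor_cinner.rep_eq zero_htensor.rep_eq)
qed (simp_all add: norm_htensor_def dist_htensor_def sgn_htensor_def uniformity_htensor_def
    open_htensor_def)
end

lemma norm_htensor: "(norm x)\<^sup>2 = (\<Sum>\<^sub>\<infinity>e. (norm (Rep_htensor x e))\<^sup>2)"
  unfolding norm_htensor_def
  by (subst real_sqrt_pow2) (simp_all add: inner_htensor_def htensor_cinner_self infsum_nonneg)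

lemma htensor_complete:
  fixes X :: "nat \<Rightarrow> ('a::chilbert, 'b::chilbert) htensor"
  assumes X: "Cauchy X"
  shows "convergent X"
proof -
  have part: "(\<Sum>e\<in>F. (norm (Rep_htensor x e))\<^sup>2) \<le> (norm x)\<^sup>2"
    if "finite F" for F and x :: "('a, 'b) htensor"
    unfolding norm_htensor using that summable_Rep_htensor[of x]
    by (intro finite_sum_le_infsum) auto
  have le: "norm (Rep_htensor x e) \<le> norm x" for x :: "('a, 'b) htensor" and e
    using part[of "{e}" x] by (intro power2_le_imp_le[of "norm (Rep_htensor x e)" "norm x"]) simp_all
  have R: "Rep_htensor (x - y) e = Rep_htensor x e - Rep_htensor y e"
    for x y :: "('a, 'b) htensor" and e by transfer simp
  have "Cauchy (\<lambda>n. Rep_htensor (X n) e)" for e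
  proof (rule metric_CauchyI)
    fix r :: real assume "0 < r"
    then obtain N where "\<forall>m\<ge>N. \<forall>n\<ge>N. dist (X m) (X n) < r"
      using X by (auto simp: Cauchy_def)
    moreover have "dist (Rep_htensor (X m) e) (Rep_htensor (X n) e) \<le> dist (X m) (X n)" for m n
      using le[of "X m - X n" e] by (simp add: dist_norm R)
    ultimately show "\<exists>N. \<forall>m\<ge>N. \<forall>n\<ge>N. dist (Rep_htensor (X m) e) (Rep_htensor (X n) e) < r"
      by (meson le_less_trans)
  qed
  then have "\<exists>l. (\<lambda>n. Rep_htensor (X n) e) \<longlonglongrightarrow> l" for e
    using Cauchy_convergent convergent_def by blast
  then obtain g where g: "\<And>e. (\<lambda>n. Rep_htensor (X n) e) \<longlonglongrightarrow> g e" by metis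
  have bd: "\<exists>N. \<forall>n\<ge>N. \<forall>F. finite F \<longrightarrow> (\<Sum>e\<in>F. (norm (Rep_htensor (X n) e - g e))\<^sup>2) \<le> r\<^sup>2"
    if r: "0 < r" for r
  proof -
    obtain N where N: "\<forall>m\<ge>N. \<forall>n\<ge>N. dist (X m) (X n) < r"
      using X r unfolding Cauchy_def by blast
    have "(\<Sum>e\<in>F. (norm (Rep_htensor (X n) e - g e))\<^sup>2) \<le> r\<^sup>2" if n: "n \<ge> N" and F: "finite F" for n F
    proof (rule LIMSEQ_le_const2)
      show "(\<lambda>m. \<Sum>e\<in>F. (norm (Rep_htensor (X n) e - Rep_htensor (X m) e))\<^sup>2)
          \<longlonglongrightarrow> (\<Sum>e\<in>F. (norm (Rep_htensor (X n) e - g e))\<^sup>2)"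
        by (intro tendsto_intros g)
      have "(\<Sum>e\<in>F. (norm (Rep_htensor (X n) e - Rep_htensor (X m) e))\<^sup>2) \<le> r\<^sup>2" if "m \<ge> N" for m
      proof -
        have "(\<Sum>e\<in>F. (norm (Rep_htensor (X n) e - Rep_htensor (X m) e))\<^sup>2) \<le> (norm (X n - X m))\<^sup>2"
          using part[OF F, of "X n - X m"] by (simp add: R)
        also have "\<dots> \<le> r\<^sup>2"
          using N n that by (intro power_mono) (auto simp: dist_norm less_imp_le)
        finally show ?thesis .
      qed
      then show "\<exists>N. \<forall>m\<ge>N. (\<Sum>e\<in>F. (norm (Rep_htensor (X n) e - Rep_htensor (X m) e))\<^sup>2) \<le> r\<^sup>2"
        by blast
    qed
    then show ?thesis by blast
  qed
  have g0: "g e = 0" if "e \<notin> onb" for e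
  proof -
    have "Rep_htensor (X n) e = 0" for n using Rep_htensor[of "X n"] that by blast
    then have "(\<lambda>n. Rep_htensor (X n) e) = (\<lambda>_. 0)" by blast
    then have "(\<lambda>_. 0) \<longlonglongrightarrow> g e" using g[of e] by argo
    then show ?thesis by (metis LIMSEQ_const_iff)
  qed
  have sd: "(\<lambda>e. (norm (Rep_htensor (X n) e - g e))\<^sup>2) summable_on UNIV"
    if "\<forall>F. finite F \<longrightarrow> (\<Sum>e\<in>F. (norm (Rep_htensor (X n) e - g e))\<^sup>2) \<le> r\<^sup>2" for n r
    using that by (intro nonneg_bdd_above_summable_on) (auto simp: bdd_above_def)
  obtain n0 where n0: "\<forall>F. finite F \<longrightarrow> (\<Sum>e\<in>F. (norm (Rep_htensor (X n0) e - g e))\<^sup>2) \<le> 1\<^sup>2"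
    using bd[of 1] by auto
  have "(\<lambda>e. (norm (Rep_htensor (X n0) e + - (Rep_htensor (X n0) e - g e)))\<^sup>2) summable_on UNIV"
    using sd[OF n0] summable_Rep_htensor[of "X n0"]
    by (intro l2_add) (simp_all only: norm_minus_cancel)
  then have gs: "(\<lambda>e. (norm (g e))\<^sup>2) summable_on UNIV" by simp
  define l where "l = Abs_htensor g"
  have Rl: "Rep_htensor l = g" using g0 gs by (simp add: l_def Abs_htensor_inverse)
  have "X \<longlonglongrightarrow> l"
  proof (rule metric_LIMSEQ_I)
    fix r :: real assume r: "0 < r"
    then obtain N where N: "\<forall>n\<ge>N. \<forall>F. finite F \<longrightarrow> (\<Sum>e\<in>F. (norm (Rep_htensor (X n) e - g e))\<^sup>2) \<le> (r/2)\<^sup>2"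
      using bd[of "r/2"] by auto
    have "dist (X n) l < r" if "n \<ge> N" for n
    proof -
      have F: "\<forall>F. finite F \<longrightarrow> (\<Sum>e\<in>F. (norm (Rep_htensor (X n) e - g e))\<^sup>2) \<le> (r/2)\<^sup>2"
        using N that by blast
      have "(norm (X n - l))\<^sup>2 \<le> (r/2)\<^sup>2"
        unfolding norm_htensor R Rl
        using F by (intro infsum_le_finite_sums sd[OF F]) auto
      then have "norm (X n - l) \<le> r/2" by (rule power2_le_imp_le) (use r in simp)
      then show ?thesis using r by (simp add: dist_norm)
    qed
    then show "\<exists>N. \<forall>n\<ge>N. dist (X n) l < r" by blast
  qed
  then show ?thesis by (auto simp: convergent_def)
qed

instantiation htensor :: (chilbert, chilbert) chilbert
begin
definition scaleC_htensor :: "complex \<Rightarrow> ('a, 'b) htensor \<Rightarrow> ('a, 'b) htensor" where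
  "scaleC_htensor = htensor_scaleC"
definition cinner_htensor :: "('a, 'b) htensor \<Rightarrow> ('a, 'b) htensor \<Rightarrow> complex" where
  "cinner_htensor = htensor_cinner"
instance
proof
  fix x y z :: "('a, 'b) htensor" and r :: real and a b :: complex
  show "complex_of_real r *\<^sub>C x = r *\<^sub>R x"
    by (simp add: scaleC_htensor_def htensor_scaleR)
  show "a *\<^sub>C b *\<^sub>C x = (a * b) *\<^sub>C x"
    unfolding scaleC_htensor_def by transfer (simp add: scaleC_scaleC)
  show "(a + b) *\<^sub>C x = a *\<^sub>C x + b *\<^sub>C x"
    unfolding scaleC_htensor_def by transfer (simp add: scaleC_add_left)
  show "a *\<^sub>C (x + y) = a *\<^sub>C x + a *\<^sub>C y"
    unfolding scaleC_htensor_def by transfer (simp add: scaleC_add_right)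
  show "cinner x y = cnj (cinner y x)"
    unfolding cinner_htensor_def by (rule htensor_cinner_commute)
  show "cinner x (y + z) = cinner x y + cinner x z"
    unfolding cinner_htensor_def by (rule htensor_cinner_add_right)
  show "cinner x (a *\<^sub>C y) = a * cinner x y"
    unfolding cinner_htensor_def scaleC_htensor_def by (rule htensor_cinner_scaleC_right)
  show "Re (cinner x y) = inner x y"
    by (simp add: cinner_htensor_def inner_htensor_def)
qed (rule htensor_complete)
end

lift_definition tensor :: "'a::chilbert \<Rightarrow> 'b::chilbert \<Rightarrow> ('a, 'b) htensor"  (infixr "\<otimes>\<^sub>v" 70)
  is "\<lambda>x y e. if e \<in> onb then cinner e x *\<^sub>C y else 0"
proof (intro conjI allI impI)
  fix x :: 'a and y :: 'b
  have "((\<lambda>e. cinner x e * cinner e x) has_sum cinner x x) onb" by (rule onb_parseval)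
  also have "(\<lambda>e. cinner x e * cinner e x) = (\<lambda>e. of_real ((cmod (cinner e x))\<^sup>2))"
    by (subst cinner_commute, subst complex_norm_square) (simp add: mult.commute)
  finally have "(\<lambda>e. (cmod (cinner e x))\<^sup>2) summable_on onb"
    using summable_on_Re[OF has_sum_imp_summable] by fastforce
  then have "(\<lambda>e. (cmod (cinner e x))\<^sup>2 * (norm y)\<^sup>2) summable_on onb"
    by (rule summable_on_cmult_left)
  then show "(\<lambda>e. (norm (if e \<in> onb then cinner e x *\<^sub>C y else 0))\<^sup>2) summable_on UNIV"
    by (subst summable_on_cong_neutral[where T=onb and g="\<lambda>e. (cmod (cinner e x))\<^sup>2 * (norm y)\<^sup>2"])
      (auto simp: norm_scaleC power_mult_distrib)
qed auto

lemma cinner_tensor: "cinner (x \<otimes>\<^sub>v y) (x' \<otimes>\<^sub>v y') = cinner x x' * cinner y y'"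
proof -
  have "cinner (x \<otimes>\<^sub>v y) (x' \<otimes>\<^sub>v y') = (\<Sum>\<^sub>\<infinity>e\<in>onb. (cinner x e * cinner e x') * cinner y y')"
    unfolding cinner_htensor_def htensor_cinner.rep_eq tensor.rep_eq
    by (rule infsum_cong_neutral)
      (auto simp: cinner_scaleC_left cinner_scaleC_right cinner_commute[symmetric])
  also have "\<dots> = cinner x x' * cinner y y'"
    by (rule infsumI, rule has_sum_cmult_left, rule onb_parseval)
  finally show ?thesis .
qed

lemma tensor_add_left: "(x + x') \<otimes>\<^sub>v y = x \<otimes>\<^sub>v y + x' \<otimes>\<^sub>v y"
  by transfer (auto simp: cinner_add_right scaleC_add_left)

lemma tensor_add_right: "x \<otimes>\<^sub>v (y + y') = x \<otimes>\<^sub>v y + x \<otimes>\<^sub>v y'"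
  by transfer (auto simp: scaleC_add_right)

lemma tensor_scaleC_left: "(c *\<^sub>C x) \<otimes>\<^sub>v y = c *\<^sub>C (x \<otimes>\<^sub>v y)"
  unfolding scaleC_htensor_def by transfer (auto simp: cinner_scaleC_right scaleC_scaleC)

lemma tensor_scaleC_right: "x \<otimes>\<^sub>v (c *\<^sub>C y) = c *\<^sub>C (x \<otimes>\<^sub>v y)"
  unfolding scaleC_htensor_def by transfer (auto simp: scaleC_scaleC mult.commute)

lemma tensor_dense:
  "closure (cspan {x \<otimes>\<^sub>v y | x y. True}) = (UNIV :: ('a::chilbert, 'b::chilbert) htensor set)"
proof (rule ccontr)
  let ?S = "closure (cspan {x \<otimes>\<^sub>v y | x y. True}) :: ('a, 'b) htensor set"
  assume "?S \<noteq> UNIV"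
  then obtain t where "t \<notin> ?S" by blast
  moreover have "subspace ?S" by (simp add: cspan_def subspace_closure)
  ultimately obtain z :: "('a, 'b) htensor" where z: "z \<noteq> 0" "\<And>s. s \<in> ?S \<Longrightarrow> inner z s = 0"
    using closed_subspace_orthogonal[OF _ closed_closure] by meson
  have z0: "Rep_htensor z e = 0" for e
  proof (cases "e \<in> onb")
    case True
    let ?y = "Rep_htensor z e"
    have "1 *\<^sub>C (e \<otimes>\<^sub>v ?y) \<in> ?S"
      by (rule subsetD[OF closure_subset], unfold cspan_def, rule span_base) blast
    then have "inner z (e \<otimes>\<^sub>v ?y) = 0" using z(2) by simp
    moreover have "cinner z (e \<otimes>\<^sub>v ?y) = (\<Sum>\<^sub>\<infinity>f\<in>{e}. cinner ?y ?y)"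
      unfolding cinner_htensor_def htensor_cinner.rep_eq tensor.rep_eq
      using onb(1)[where 'a='a] True
      by (intro infsum_cong_neutral) (auto simp: orthonormal_def)
    ultimately have "norm ?y = 0"
      by (simp add: Re_cinner[symmetric] cinner_self)
    then show ?thesis by simp
  next
    case False
    then show ?thesis using Rep_htensor[of z] by simp
  qed
  then have "z = 0" by (metis Rep_htensor_inject ext zero_htensor.rep_eq)
  then show False using z(1) by simp
qed

definition flip :: "('a::chilbert, 'b::chilbert) htensor \<Rightarrow>\<^sub>L ('b, 'a) htensor" where
  "flip = (THE S. \<forall>x y. blinfun_apply S (x \<otimes>\<^sub>v y) = y \<otimes>\<^sub>v x)"

definition assoc ::
  "(('a::chilbert, 'b::chilbert) htensor, 'c::chilbert) htensor \<Rightarrow>\<^sub>L ('a, ('b, 'c) htensor) htensor"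
  where "assoc = (THE S. \<forall>x y z. blinfun_apply S ((x \<otimes>\<^sub>v y) \<otimes>\<^sub>v z) = x \<otimes>\<^sub>v (y \<otimes>\<^sub>v z))"

definition assoc_inv ::
  "('a::chilbert, ('b::chilbert, 'c::chilbert) htensor) htensor \<Rightarrow>\<^sub>L (('a, 'b) htensor, 'c) htensor"
  where "assoc_inv = (THE S. \<forall>x y z. blinfun_apply S (x \<otimes>\<^sub>v (y \<otimes>\<^sub>v z)) = (x \<otimes>\<^sub>v y) \<otimes>\<^sub>v z)"


section \<open>Hilbert spaces inside an ambient Hilbert space, and their operators\<close>

text \<open>
  The objects of the category live on Hilbert spaces of different sizes, while the set of all
  objects needs one type.  Hilbert spaces are therefore the closed complex subspaces of an
  arbitrary ambient Hilbert space, with the inherited structure.  A bounded operator on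
  such a subspace H is represented by its extension to the ambient space by zero on the
  orthogonal complement of H; this preserves sums, products, adjoints and norms, and the unit
  of B(H) becomes the orthogonal projection onto H.
\<close>

type_synonym 'a bop = "'a \<Rightarrow>\<^sub>L 'a"

definition hilbert_space :: "'a::chilbert set \<Rightarrow> bool" where
  "hilbert_space H \<longleftrightarrow> csubspace H \<and> closed H"

definition tensor_space :: "'a::chilbert set \<Rightarrow> 'b::chilbert set \<Rightarrow> ('a, 'b) htensor set"
    (infixr "\<otimes>\<^sub>s" 70) where
  "H \<otimes>\<^sub>s K = closure (cspan {x \<otimes>\<^sub>v y | x y. x \<in> H \<and> y \<in> K})"

definition bounded_ops :: "'a::chilbert set \<Rightarrow> 'a bop set" where
  "bounded_ops H = {T :: 'a bop. (\<forall>c x. T (c *\<^sub>C x) = c *\<^sub>C T x) \<and> (\<forall>x. T x \<in> H) \<and>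
     (\<forall>x. (\<forall>h\<in>H. cinner h x = 0) \<longrightarrow> T x = 0)}"

definition id_on :: "'a::chilbert set \<Rightarrow> 'a bop" where
  "id_on H = (THE P. P \<in> bounded_ops H \<and> (\<forall>x\<in>H. blinfun_apply P x = x))"

definition adj :: "'a::chilbert bop \<Rightarrow> 'a bop" where
  "adj T = (THE S. \<forall>x y. cinner (T x) y = cinner x (blinfun_apply S y))"

definition unitary_on :: "'a::chilbert set \<Rightarrow> 'a bop \<Rightarrow> bool" where
  "unitary_on H U \<longleftrightarrow>
     U \<in> bounded_ops H \<and> adj U o\<^sub>L U = id_on H \<and> U o\<^sub>L adj U = id_on H"

definition tensor_op :: "'a::chilbert bop \<Rightarrow> 'b::chilbert bop \<Rightarrow> ('a, 'b) htensor bop"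
    (infixr "\<otimes>\<^sub>o" 70) where
  "S \<otimes>\<^sub>o T = (THE R. \<forall>x y. blinfun_apply R (x \<otimes>\<^sub>v y) = S x \<otimes>\<^sub>v T y)"

text \<open>
  Leg numbering on triple tensor products, which are bracketed to the left.  The set argument is
  the Hilbert space of the leg on which the operator acts trivially.
\<close>

definition leg12 ::
  "('a, 'b) htensor bop \<Rightarrow> 'c set \<Rightarrow> (('a::chilbert, 'b::chilbert) htensor, 'c::chilbert) htensor bop"
  where "leg12 X L = X \<otimes>\<^sub>o id_on L"

definition leg23 ::
  "'a set \<Rightarrow> ('b, 'c) htensor bop \<Rightarrow> (('a::chilbert, 'b::chilbert) htensor, 'c::chilbert) htensor bop"
  where "leg23 H X = assoc_inv o\<^sub>L (id_on H \<otimes>\<^sub>o X) o\<^sub>L assoc"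

definition leg13 ::
  "'b set \<Rightarrow> ('a, 'c) htensor bop \<Rightarrow> (('a::chilbert, 'b::chilbert) htensor, 'c::chilbert) htensor bop"
  where "leg13 K X =
    (THE R. \<forall>x y z x' y' z'. cinner ((x \<otimes>\<^sub>v y) \<otimes>\<^sub>v z) (blinfun_apply R ((x' \<otimes>\<^sub>v y') \<otimes>\<^sub>v z')) =
       cinner y (id_on K y') * cinner (x \<otimes>\<^sub>v z) (X (x' \<otimes>\<^sub>v z')))"


section \<open>Modular multiplicative unitaries\<close>

text \<open>Unbounded operators are given by their graphs; the inverse is the converse relation.\<close>

definition adj_graph :: "'a::chilbert set \<Rightarrow> ('a \<times> 'a) set \<Rightarrow> ('a \<times> 'a) set" where
  "adj_graph H Q = {(y, z) \<in> H \<times> H. \<forall>(x, w)\<in>Q. cinner w y = cinner x z}"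

definition positive_selfadjoint :: "'a::chilbert set \<Rightarrow> ('a \<times> 'a) set \<Rightarrow> bool" where
  "positive_selfadjoint H Q \<longleftrightarrow>
     Q \<subseteq> H \<times> H \<and> H \<subseteq> closure (Domain Q) \<and> adj_graph H Q = Q \<and>
     (\<forall>(x, w)\<in>Q. cinner x w \<in> \<real> \<and> 0 \<le> Re (cinner x w))"

definition trivial_kernel :: "('a::chilbert \<times> 'a) set \<Rightarrow> bool" where
  "trivial_kernel Q \<longleftrightarrow> (\<forall>x. (x, 0) \<in> Q \<longrightarrow> x = 0)"

text \<open>
  The tensor product of two self-adjoint operators is the closure of the algebraic one.  The real
  span is already a complex subspace, because domains are.
\<close>

definition tensor_graph ::
  "('a::chilbert \<times> 'a) set \<Rightarrow> ('b::chilbert \<times> 'b) set \<Rightarrow> (('a, 'b) htensor \<times> ('a, 'b) htensor) set"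
  where "tensor_graph P Q =
    closure (span {(x \<otimes>\<^sub>v y, x' \<otimes>\<^sub>v y') | x x' y y'. (x, x') \<in> P \<and> (y, y') \<in> Q})"

definition multiplicative_unitary :: "'a::chilbert set \<Rightarrow> ('a, 'a) htensor bop \<Rightarrow> bool" where
  "multiplicative_unitary H W \<longleftrightarrow>
     unitary_on (H \<otimes>\<^sub>s H) W \<and>
     leg23 H W o\<^sub>L leg12 W H = leg12 W H o\<^sub>L leg13 H W o\<^sub>L leg23 H W"

definition modular :: "'a::chilbert set \<Rightarrow> ('a, 'a) htensor bop \<Rightarrow> bool" where
  "modular H W \<longleftrightarrow>
     (\<exists>Qh Q (W' :: ('a conj_space, 'a) htensor bop).
        positive_selfadjoint H Qh \<and> trivial_kernel Qh \<and>
        positive_selfadjoint H Q \<and> trivial_kernel Q \<and>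
        unitary_on ((bar ` H) \<otimes>\<^sub>s H) W' \<and>
        {(s, adj W t) | s t. s \<in> H \<otimes>\<^sub>s H \<and> (W s, t) \<in> tensor_graph Qh Q} = tensor_graph Qh Q \<and>
        (\<forall>x\<in>H. \<forall>z\<in>H. \<forall>(y, Qy)\<in>Q. \<forall>(u, Qinv_u)\<in>Q\<inverse>.
           cinner (x \<otimes>\<^sub>v y) (W (z \<otimes>\<^sub>v u)) =
           cinner (bar z \<otimes>\<^sub>v Qy) (W' (bar x \<otimes>\<^sub>v Qinv_u))))"

text \<open>
  As usual, the Hilbert space of a multiplicative unitary is not zero.  (Over the zero space, the
  equation that characterises compositions of bicharacters would be void.)
\<close>

definition modular_multiplicative_unitary :: "'a::chilbert set \<Rightarrow> ('a, 'a) htensor bop \<Rightarrow> bool" where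
  "modular_multiplicative_unitary H W \<longleftrightarrow>
     hilbert_space H \<and> H \<noteq> {0} \<and> multiplicative_unitary H W \<and> modular H W"


section \<open>Quantum groups\<close>

text \<open>Normal functionals on B(H) and slice maps.\<close>

definition predual :: "'a::chilbert set \<Rightarrow> ('a bop \<Rightarrow> complex) set" where
  "predual H = {\<lambda>T :: 'a bop. \<Sum>n. cinner (x n) (T (y n)) | (x :: nat \<Rightarrow> 'a) (y :: nat \<Rightarrow> 'a).
     range x \<subseteq> H \<and> range y \<subseteq> H \<and>
     summable (\<lambda>n. (norm (x n))\<^sup>2) \<and> summable (\<lambda>n. (norm (y n))\<^sup>2)}"

definition vector_slice_left ::
  "'a \<Rightarrow> 'a \<Rightarrow> ('a::chilbert, 'b::chilbert) htensor bop \<Rightarrow> 'b bop" where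
  "vector_slice_left x z X =
     (THE S. \<forall>y u. cinner y (blinfun_apply S u) = cinner (x \<otimes>\<^sub>v y) (X (z \<otimes>\<^sub>v u)))"

definition vector_slice_right ::
  "'b \<Rightarrow> 'b \<Rightarrow> ('a::chilbert, 'b::chilbert) htensor bop \<Rightarrow> 'a bop" where
  "vector_slice_right y u X =
     (THE S. \<forall>x z. cinner x (blinfun_apply S z) = cinner (x \<otimes>\<^sub>v y) (X (z \<otimes>\<^sub>v u)))"

definition slice_left ::
  "('a bop \<Rightarrow> complex) \<Rightarrow> ('a::chilbert, 'b::chilbert) htensor bop \<Rightarrow> 'b bop" where
  "slice_left \<omega> X = (THE T. \<forall>y u. cinner y (blinfun_apply T u) = \<omega> (vector_slice_right y u X))"

definition slice_right ::
  "('b bop \<Rightarrow> complex) \<Rightarrow> ('a::chilbert, 'b::chilbert) htensor bop \<Rightarrow> 'a bop" where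
  "slice_right \<omega> X = (THE T. \<forall>x z. cinner x (blinfun_apply T z) = \<omega> (vector_slice_left x z X))"

text \<open>
  Comultiplications take the value undefined outside the algebra, so that equality of records is
  equality of pairs (C, Delta) on the same Hilbert space.
\<close>

record (overloaded) ('h::chilbert) bialgebra =
  hspace :: "'h set"
  alg :: "'h bop set"
  comult :: "'h bop \<Rightarrow> ('h, 'h) htensor bop"

definition qgroup_of :: "'h::chilbert set \<Rightarrow> ('h, 'h) htensor bop \<Rightarrow> 'h bialgebra" where
  "qgroup_of H W =
     (let C = closure {slice_left \<omega> W | \<omega>. \<omega> \<in> predual H}
      in \<lparr>hspace = H, alg = C, comult = (\<lambda>x\<in>C. W o\<^sub>L (x \<otimes>\<^sub>o id_on H) o\<^sub>L adj W)\<rparr>)"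

definition dual_qgroup_of :: "'h::chilbert set \<Rightarrow> ('h, 'h) htensor bop \<Rightarrow> 'h bialgebra" where
  "dual_qgroup_of H W =
     (let C = closure {slice_right \<omega> (adj W) | \<omega>. \<omega> \<in> predual H}
      in \<lparr>hspace = H, alg = C,
          comult = (\<lambda>y\<in>C. flip o\<^sub>L adj W o\<^sub>L (id_on H \<otimes>\<^sub>o y) o\<^sub>L W o\<^sub>L flip)\<rparr>)"

definition generates :: "('h::chilbert, 'h) htensor bop \<Rightarrow> 'h bialgebra \<Rightarrow> bool" where
  "generates W G \<longleftrightarrow>
     modular_multiplicative_unitary (hspace G) W \<and> G = qgroup_of (hspace G) W"

definition quantum_group :: "'h::chilbert bialgebra \<Rightarrow> bool" where
  "quantum_group G \<longleftrightarrow> (\<exists>W. generates W G)"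

text \<open>A choice of a generating modular multiplicative unitary for each quantum group.\<close>

type_synonym 'h mu_choice = "'h bialgebra \<Rightarrow> ('h, 'h) htensor bop"

definition generating_choice :: "'h::chilbert mu_choice \<Rightarrow> bool" where
  "generating_choice \<W> \<longleftrightarrow> (\<forall>G. quantum_group G \<longrightarrow> generates (\<W> G) G)"

definition dual :: "'h::chilbert mu_choice \<Rightarrow> 'h bialgebra \<Rightarrow> 'h bialgebra" where
  "dual \<W> G = dual_qgroup_of (hspace G) (\<W> G)"


section \<open>Spatial tensor products, multipliers and extensions of morphisms\<close>

text \<open>The real span is a complex subspace whenever one of the factors is.\<close>

definition tensor_alg ::
  "'a::chilbert bop set \<Rightarrow> 'b::chilbert bop set \<Rightarrow> ('a, 'b) htensor bop set"
    (infixr "\<otimes>\<^sub>a" 70) where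
  "A \<otimes>\<^sub>a B = closure (span {a \<otimes>\<^sub>o b | a b. a \<in> A \<and> b \<in> B})"

text \<open>
  The multiplier algebra of a nondegenerate algebra of operators on H, identified with its image
  in B(H).
\<close>

definition multipliers :: "'a::chilbert set \<Rightarrow> 'a bop set \<Rightarrow> 'a bop set" where
  "multipliers H A = {T \<in> bounded_ops H. \<forall>a\<in>A. T o\<^sub>L a \<in> A \<and> a o\<^sub>L T \<in> A}"

definition unitary_multipliers :: "'a::chilbert set \<Rightarrow> 'a bop set \<Rightarrow> 'a bop set" where
  "unitary_multipliers H A = {U \<in> multipliers H A. unitary_on H U}"

text \<open>
  tensor_map A B f g is the continuous linear map on the spatial tensor product of A and B
  that sends simple tensors of a and b to simple tensors of f a and g b.
\<close>

definition tensor_map ::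
  "'a::chilbert bop set \<Rightarrow> 'b::chilbert bop set \<Rightarrow> ('a bop \<Rightarrow> 'c::chilbert bop) \<Rightarrow>
   ('b bop \<Rightarrow> 'd::chilbert bop) \<Rightarrow> ('a, 'b) htensor bop \<Rightarrow> ('c, 'd) htensor bop" where
  "tensor_map A B f g =
     (THE F. F \<in> extensional (A \<otimes>\<^sub>a B) \<and> continuous_on (A \<otimes>\<^sub>a B) F \<and>
        (\<forall>s\<in>A \<otimes>\<^sub>a B. \<forall>t\<in>A \<otimes>\<^sub>a B. F (s + t) = F s + F t) \<and>
        (\<forall>r. \<forall>t\<in>A \<otimes>\<^sub>a B. F (r *\<^sub>R t) = r *\<^sub>R F t) \<and>
        (\<forall>a\<in>A. \<forall>b\<in>B. F (a \<otimes>\<^sub>o b) = f a \<otimes>\<^sub>o g b))"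

text \<open>
  The value at a multiplier m of A of the extension of a nondegenerate homomorphism f from A to
  operators on K: the unique operator T on K with T (f a) = f (m a) for all a in A.
\<close>

definition extend :: "'b::chilbert set \<Rightarrow> 'a::chilbert bop set \<Rightarrow> ('a bop \<Rightarrow> 'b bop) \<Rightarrow> 'a bop \<Rightarrow> 'b bop"
  where "extend K A f m =
    (THE T. T \<in> bounded_ops K \<and> (\<forall>a\<in>A. T o\<^sub>L f a = f (m o\<^sub>L a)))"

definition comult_id ::
  "'h::chilbert bialgebra \<Rightarrow> 'h bialgebra \<Rightarrow> ('h, 'h) htensor bop \<Rightarrow> (('h, 'h) htensor, 'h) htensor bop"
  where "comult_id G A V =
    extend ((hspace G \<otimes>\<^sub>s hspace G) \<otimes>\<^sub>s hspace A) (alg G \<otimes>\<^sub>a alg A)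
      (tensor_map (alg G) (alg A) (comult G) (\<lambda>a. a)) V"

definition id_comult ::
  "'h::chilbert bialgebra \<Rightarrow> 'h bialgebra \<Rightarrow> ('h, 'h) htensor bop \<Rightarrow> (('h, 'h) htensor, 'h) htensor bop"
  where "id_comult G A V =
    assoc_inv o\<^sub>L
      extend (hspace G \<otimes>\<^sub>s (hspace A \<otimes>\<^sub>s hspace A)) (alg G \<otimes>\<^sub>a alg A)
        (tensor_map (alg G) (alg A) (\<lambda>a. a) (comult A)) V
    o\<^sub>L assoc"


section \<open>Bicharacters\<close>

text \<open>Bicharacters from C to A, identified with their images on the tensor product of the
  Hilbert spaces of C and A.\<close>

definition bicharacters ::
  "'h::chilbert mu_choice \<Rightarrow> 'h bialgebra \<Rightarrow> 'h bialgebra \<Rightarrow> ('h, 'h) htensor bop set" where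
  "bicharacters \<W> C A =
     {V \<in> unitary_multipliers (hspace C \<otimes>\<^sub>s hspace A) (alg (dual \<W> C) \<otimes>\<^sub>a alg A).
        comult_id (dual \<W> C) A V = leg23 (hspace C) V o\<^sub>L leg13 (hspace C) V \<and>
        id_comult (dual \<W> C) A V = leg12 V (hspace A) o\<^sub>L leg13 (hspace A) V}"

text \<open>
  The reduced bicharacter of C is the unitary multiplier whose image in the operators on the tensor
  square of the Hilbert space of C is the chosen multiplicative unitary; multipliers are identified
  with their images.
\<close>

definition reduced_bicharacter ::
  "'h::chilbert mu_choice \<Rightarrow> 'h bialgebra \<Rightarrow> ('h, 'h) htensor bop \<Rightarrow> bool" where
  "reduced_bicharacter \<W> C w \<longleftrightarrow>
     w \<in> unitary_multipliers (hspace C \<otimes>\<^sub>s hspace C) (alg (dual \<W> C) \<otimes>\<^sub>a alg C) \<and> w = \<W> C"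

text \<open>
  X is the composition of V (from C to A) and U (from A to B), that is, the unique bicharacter X
  from C to B with the stated property.
\<close>

definition is_composition ::
  "'h::chilbert mu_choice \<Rightarrow> 'h bialgebra \<Rightarrow> 'h bialgebra \<Rightarrow> 'h bialgebra \<Rightarrow>
   ('h, 'h) htensor bop \<Rightarrow> ('h, 'h) htensor bop \<Rightarrow> ('h, 'h) htensor bop \<Rightarrow> bool" where
  "is_composition \<W> C A B U V X \<longleftrightarrow>
     (let P = (\<lambda>Y. Y \<in> bicharacters \<W> C B \<and>
                leg23 (hspace C) U o\<^sub>L leg12 V (hspace B) =
                leg12 V (hspace B) o\<^sub>L leg13 (hspace A) Y o\<^sub>L leg23 (hspace C) U)
      in P X \<and> (\<forall>Y. P Y \<longrightarrow> Y = X))"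

type_synonym 'h composition_op =
  "'h bialgebra \<Rightarrow> 'h bialgebra \<Rightarrow> 'h bialgebra \<Rightarrow>
   ('h, 'h) htensor bop \<Rightarrow> ('h, 'h) htensor bop \<Rightarrow> ('h, 'h) htensor bop"

definition bicharacter_composition :: "'h::chilbert mu_choice \<Rightarrow> 'h composition_op \<Rightarrow> bool" where
  "bicharacter_composition \<W> cmp \<longleftrightarrow>
     (\<forall>C A B. quantum_group C \<longrightarrow> quantum_group A \<longrightarrow> quantum_group B \<longrightarrow>
        (\<forall>V\<in>bicharacters \<W> C A. \<forall>U\<in>bicharacters \<W> A B.
           is_composition \<W> C A B U V (cmp C A B U V)))"


section \<open>Categories\<close>

text \<open>cmp A B C g f is the composite of f from A to B and g from B to C.\<close>

definition category ::
  "'o set \<Rightarrow> ('o \<Rightarrow> 'o \<Rightarrow> 'm set) \<Rightarrow> ('o \<Rightarrow> 'o \<Rightarrow> 'o \<Rightarrow> 'm \<Rightarrow> 'm \<Rightarrow> 'm) \<Rightarrow> ('o \<Rightarrow> 'm) \<Rightarrow> bool" where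
  "category Ob Hom cmp ident \<longleftrightarrow>
     (\<forall>A\<in>Ob. ident A \<in> Hom A A) \<and>
     (\<forall>A\<in>Ob. \<forall>B\<in>Ob. \<forall>C\<in>Ob. \<forall>f\<in>Hom A B. \<forall>g\<in>Hom B C. cmp A B C g f \<in> Hom A C) \<and>
     (\<forall>A\<in>Ob. \<forall>B\<in>Ob. \<forall>f\<in>Hom A B. cmp A A B f (ident A) = f \<and> cmp A B B (ident B) f = f) \<and>
     (\<forall>A\<in>Ob. \<forall>B\<in>Ob. \<forall>C\<in>Ob. \<forall>D\<in>Ob. \<forall>f\<in>Hom A B. \<forall>g\<in>Hom B C. \<forall>h\<in>Hom C D.
        cmp A C D h (cmp A B C g f) = cmp A B D (cmp B C D h g) f)"

end

theory Submission
  imports Defs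
begin

text \<open>
  Both comultiplications are implemented by the multiplicative unitaries, so the two bicharacter
  equations for V are the relations V23 W12 = W12 V13 V23 (for W of the source) and
  W23 V12 = V12 V13 W23 (for W of the target).  For V = W both are the pentagon equation; for general
  V they say that composing V with W gives V, by uniqueness of the composition.
  For associativity let X, Y, Z be the compositions of U and V, of T and U, and of Y and V.  On four
  legs, X13 = V12* U23 V12 U23*.  Since T34 commutes with V12, and U23 with Z14, the three
  defining relations give T34 X13 = X13 Z14 T34.  The second leg, which is not zero, can be
  dropped, and Z is the composition of T and X.
\<close>

text \<open>Most objects here are definite descriptions (\<open>adj\<close>, \<open>id_on\<close>,
  \<open>\<otimes>\<^sub>o\<close>, \<open>leg13\<close>, the slices, \<open>tensor_map\<close>,
  \<open>extend\<close>), so nothing can be computed before existence and uniqueness are settled.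
  Existence comes from bounded sesquilinear forms, from isometries given on simple tensors, or from
  acting on coefficients; uniqueness mostly from density of simple tensors. The type
  \<open>\<Rightarrow>\<^sub>L\<close> records real linearity only, while (c x) \<otimes> y = x
  \<otimes> (c y) rules out tensoring merely real-linear maps; hence \<open>cblinear\<close>
  accompanies the operators. The unit of B(H) is a projection of the ambient space, so a unitary
  times its adjoint is a projection, which must be absorbed by operators supported on the same legs.
  The extension of a comultiplication to a multiplier is characterised by its products with values
  on the algebra; its uniqueness rests on nondegeneracy of C and of its dual, which follows from
  unitarity of W by slicing with vector functionals.\<close>

section \<open>Complex linearity, the Riesz theorem and adjoints\<close>

definition cblinear :: "('a::chilbert \<Rightarrow>\<^sub>L 'b::chilbert) \<Rightarrow> bool" where
  "cblinear T \<longleftrightarrow> (\<forall>c x. T (c *\<^sub>C x) = c *\<^sub>C T x)"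

lemma cblinearD: "cblinear T \<Longrightarrow> T (c *\<^sub>C x) = c *\<^sub>C T x"
  by (simp add: cblinear_def)

lemma cblinear_id [simp]: "cblinear id_blinfun"
  by (simp add: cblinear_def)

lemma cblinear_compose [simp]: "cblinear S \<Longrightarrow> cblinear T \<Longrightarrow> cblinear (S o\<^sub>L T)"
  by (simp add: cblinear_def)

lemma cinner_eqI:
  fixes a b :: "'a::chilbert"
  assumes "\<And>x. cinner x a = cinner x b"
  shows "a = b"
proof -
  have "cinner (a - b) (a - b) = 0" using assms by (simp add: cinner_diff_right)
  then show ?thesis by (simp add: cinner_self)
qed

text \<open>A nonzero \<open>f\<close> has a closed proper kernel. A vector z orthogonal to it
  represents \<open>f\<close> up to a scalar, because x - (f x / f z) z lies in the kernel for every
  x.\<close>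

lemma riesz:
  fixes f :: "'a::chilbert \<Rightarrow> complex"
  assumes f: "bounded_linear f" and c: "\<And>c x. f (c *\<^sub>C x) = c * f x"
  shows "\<exists>y. \<forall>x. f x = cinner y x"
proof (cases "\<forall>x. f x = 0")
  case True
  then show ?thesis by (intro exI[of _ 0]) simp
next
  case False
  interpret f: bounded_linear f by (rule f)
  obtain x0 where x0: "f x0 \<noteq> 0" using False by blast
  let ?N = "{x. f x = 0}"
  have "closed ?N"
    using continuous_closed_vimage[of "{0}" f] f.isCont[OF continuous_ident]
    by (simp add: vimage_def)
  moreover have "subspace ?N"
    by (simp add: subspace_def f.add f.scaleR)
  ultimately obtain z where z: "z \<noteq> 0" "\<And>s. f s = 0 \<Longrightarrow> inner z s = 0"
    using closed_subspace_orthogonal[of ?N x0] x0 by auto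
  \<comment> \<open>So far z is orthogonal for the real inner product only. The kernel is stable
    under complex multiples, and the multiples by 1 and -i recover the real and imaginary
    parts.\<close>
  have zc: "cinner z s = 0" if "f s = 0" for s
  proof -
    have "inner z (k *\<^sub>C s) = 0" for k using z(2)[of "k *\<^sub>C s"] that by (simp add: c)
    from this[of 1] this[of "- \<i>"] have "Re (cinner z s) = 0" "Im (cinner z s) = 0"
      by (auto simp: Re_cinner[symmetric] cinner_scaleC_right)
    then show ?thesis by (simp add: complex_eq_iff)
  qed
  have fz: "f z \<noteq> 0" using z by fastforce
  have nz: "cinner z z \<noteq> 0" using z(1) by (simp add: cinner_self)
  have "f x = cinner (cnj (f z / cinner z z) *\<^sub>C z) x" for x
  proof -
    have "f (x - (f x / f z) *\<^sub>C z) = 0" using fz by (simp add: f.diff c)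
    then have "cinner z (x - (f x / f z) *\<^sub>C z) = 0" by (rule zc)
    then have "cinner z x = (f x / f z) * cinner z z"
      by (simp add: cinner_diff_right cinner_scaleC_right)
    then show ?thesis using fz nz by (simp add: cinner_scaleC_left)
  qed
  then show ?thesis by blast
qed

text \<open>Riesz is applied to x \<mapsto> cnj (B x y) for each y; the conjugate is taken because
  \<open>B\<close> is conjugate-linear in its first argument. Adjoints, vector slices and general
  slices are all obtained from this lemma.\<close>

lemma sesquilinear_operator:
  fixes B :: "'a::chilbert \<Rightarrow> 'b::chilbert \<Rightarrow> complex"
  assumes addl: "\<And>x x' y. B (x + x') y = B x y + B x' y"
    and addr: "\<And>x y y'. B x (y + y') = B x y + B x y'"
    and scl: "\<And>c x y. B (c *\<^sub>C x) y = cnj c * B x y"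
    and scr: "\<And>c x y. B x (c *\<^sub>C y) = c * B x y"
    and bd: "\<And>x y. cmod (B x y) \<le> norm x * norm y * K" and K: "0 \<le> K"
  shows "\<exists>T :: 'b \<Rightarrow>\<^sub>L 'a. cblinear T \<and> (\<forall>x y. cinner x (T y) = B x y)"
proof -
  have "\<exists>t. \<forall>x. B x y = cinner x t" for y
  proof -
    have "bounded_linear (\<lambda>x. cnj (B x y))"
    proof (rule bounded_linear_intro)
      fix r x
      show "cnj (B (r *\<^sub>R x) y) = r *\<^sub>R cnj (B x y)"
        using scl[of "of_real r" x y] by (simp add: scaleC_of_real scaleR_conv_of_real)
      show "norm (cnj (B x y)) \<le> norm x * (norm y * K)"
        using bd[of x y] by (simp add: mult_ac)
    qed (simp add: addl)
    then obtain t where "\<forall>x. cnj (B x y) = cinner t x" using riesz scl by fastforce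
    then show ?thesis by (metis cinner_commute complex_cnj_cnj)
  qed
  then obtain t where t: "\<And>x y. B x y = cinner x (t y)" by metis
  have "t (y + y') = t y + t y'" for y y'
    by (rule cinner_eqI) (simp add: t[symmetric] addr cinner_add_right)
  moreover have sc: "t (c *\<^sub>C y) = c *\<^sub>C t y" for c y
    by (rule cinner_eqI) (simp add: t[symmetric] scr cinner_scaleC_right)
  moreover have "norm (t y) \<le> norm y * K" for y
  proof (cases "t y = 0")
    case True
    then show ?thesis using K by simp
  next
    case False
    \<comment> \<open>The form is tested at x = t y; one factor norm (t y) then cancels.\<close>
    have "(norm (t y))\<^sup>2 = cmod (B (t y) y)" by (simp add: t cinner_self norm_power)
    also have "\<dots> \<le> norm (t y) * (norm y * K)" using bd[of "t y" y] by (simp add: mult_ac)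
    finally show ?thesis using False by (simp add: power2_eq_square)
  qed
  ultimately have "bounded_linear t"
    by (intro bounded_linear_intro[of t K]) (auto simp: scaleC_of_real[symmetric])
  then have "cblinear (Blinfun t) \<and> (\<forall>x y. cinner x (blinfun_apply (Blinfun t) y) = B x y)"
    by (simp add: cblinear_def bounded_linear_Blinfun_apply sc t)
  then show ?thesis by blast
qed

lemma adj:
  fixes T :: "'a::chilbert bop"
  assumes T: "cblinear T"
  shows cblinear_adj: "cblinear (adj T)" and cinner_adj: "cinner (T x) y = cinner x (adj T y)"
proof -
  have "cmod (cinner (T x) y) \<le> norm x * norm y * norm T" for x y
    using cmod_cinner_le[of "T x" y] mult_right_mono[OF norm_blinfun[of T x], of "norm y"]
    by (simp add: mult_ac)
  then obtain S :: "'a bop" where S: "cblinear S" "\<And>x y. cinner x (S y) = cinner (T x) y"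
    using sesquilinear_operator[of "\<lambda>x y. cinner (T x) y" "norm T"] T
    by (auto simp: blinfun.add_right cblinear_def cinner_add_left cinner_add_right
        cinner_scaleC_left cinner_scaleC_right)
  have "adj T = S"
    unfolding adj_def
  proof (rule the_equality)
    fix R :: "'a bop" assume "\<forall>x y. cinner (T x) y = cinner x (R y)"
    then show "R = S" by (intro blinfun_eqI cinner_eqI) (simp add: S(2))
  qed (simp add: S(2))
  then show "cblinear (adj T)" "cinner (T x) y = cinner x (adj T y)" using S by auto
qed

subsection \<open>Orthogonal projections\<close>

text \<open>The sums of vectors of \<open>H\<close> and of its orthogonal complement form a
  subspace, closed because by Pythagoras the \<open>H\<close>-components of a convergent sequence
  are Cauchy. A vector orthogonal to this subspace lies in the complement, hence in the subspace
  itself, so it is zero.\<close>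

lemma orthogonal_decomposition:
  fixes H :: "'a::chilbert set"
  assumes H: "hilbert_space H"
  shows "\<exists>p\<in>H. \<forall>h\<in>H. cinner h (x - p) = 0"
proof -
  have cs: "csubspace H" and cl: "closed H" using H by (auto simp: hilbert_space_def)
  define N where "N = {x. \<forall>h\<in>H. cinner h x = 0}"
  define M where "M = {x. \<exists>p\<in>H. x - p \<in> N}"
  have H_sub: "subspace H"
    using cs unfolding subspace_def csubspace_def by (metis scaleC_of_real)
  have N_sub: "subspace N"
    by (auto simp: subspace_def N_def cinner_add_right cinner_scaleR_right)
  have "subspace M"
    unfolding subspace_def
  proof (intro conjI ballI allI)
    show "0 \<in> M" unfolding M_def using H_sub N_sub by (auto intro!: bexI[of _ 0] simp: subspace_0)
    fix x y assume "x \<in> M" "y \<in> M"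
    then obtain p q where "p \<in> H" "x - p \<in> N" "q \<in> H" "y - q \<in> N" by (auto simp: M_def)
    then have "p + q \<in> H" "(x + y) - (p + q) \<in> N"
      using subspace_add[OF H_sub] subspace_add[OF N_sub, of "x - p" "y - q"]
      by (auto simp: algebra_simps)
    then show "x + y \<in> M" by (auto simp: M_def)
  next
    fix c x assume "x \<in> M"
    then obtain p where "p \<in> H" "x - p \<in> N" by (auto simp: M_def)
    then have "c *\<^sub>R p \<in> H" "c *\<^sub>R x - c *\<^sub>R p \<in> N"
      using subspace_scale[OF H_sub] subspace_scale[OF N_sub, of "x - p" c]
      by (auto simp: scaleR_diff_right)
    then show "c *\<^sub>R x \<in> M" by (auto simp: M_def)
  qed
  moreover have "closed M"
    unfolding closed_sequential_limits
  proof (intro allI impI)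
    fix s l assume "(\<forall>n. s n \<in> M) \<and> s \<longlonglongrightarrow> l"
    then obtain p where p: "\<And>n. p n \<in> H" "\<And>n. s n - p n \<in> N" and s: "s \<longlonglongrightarrow> l"
      by (auto simp: M_def) metis
    have le: "norm (p m - p n) \<le> norm (s m - s n)" for m n
    proof -
      have "p m - p n \<in> H" using p(1) subspace_diff[OF H_sub] by blast
      moreover have "(s m - s n) - (p m - p n) \<in> N"
        using subspace_diff[OF N_sub p(2)[of m] p(2)[of n]] by (simp add: algebra_simps)
      ultimately have "cinner (p m - p n) ((s m - s n) - (p m - p n)) = 0" by (auto simp: N_def)
      then have "inner (p m - p n) ((s m - s n) - (p m - p n)) = 0"
        using Re_cinner by (metis zero_complex.simps(1))
      then have "(norm (s m - s n))\<^sup>2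
          = (norm (p m - p n))\<^sup>2 + (norm ((s m - s n) - (p m - p n)))\<^sup>2"
        using norm_add_Pythagorean[of "p m - p n" "(s m - s n) - (p m - p n)"]
        by (simp add: orthogonal_def)
      then have "(norm (p m - p n))\<^sup>2 \<le> (norm (s m - s n))\<^sup>2" by simp
      then show ?thesis by (rule power2_le_imp_le) simp
    qed
    have "Cauchy s" using s LIMSEQ_imp_Cauchy by blast
    then have "Cauchy p"
      unfolding Cauchy_def dist_norm using le by (meson le_less_trans)
    then obtain q where q: "p \<longlonglongrightarrow> q" using Cauchy_convergent convergent_def by blast
    have "q \<in> H" using cl p(1) q closed_sequentially by blast
    moreover have "l - q \<in> N"
      unfolding N_def
    proof safe
      fix h assume "h \<in> H"
      interpret h: bounded_linear "cinner h" by (rule bounded_linear_cinner_right)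
      have "(\<lambda>n. cinner h (s n - p n)) \<longlonglongrightarrow> cinner h (l - q)"
        by (intro h.tendsto tendsto_diff s q)
      moreover have "(\<lambda>n. cinner h (s n - p n)) = (\<lambda>_. 0)" using p(2) \<open>h \<in> H\<close> by (auto simp: N_def)
      ultimately show "cinner h (l - q) = 0" by (metis LIMSEQ_const_iff)
    qed
    ultimately show "l \<in> M" by (auto simp: M_def)
  qed
  ultimately have "x \<in> M"
  proof (rule_tac ccontr)
    assume "subspace M" "closed M" "x \<notin> M"
    then obtain z where z: "z \<noteq> 0" "\<And>s. s \<in> M \<Longrightarrow> inner z s = 0"
      using closed_subspace_orthogonal by blast
    have HM: "h \<in> M" if "h \<in> H" for h
      using that subspace_0[OF N_sub] by (auto simp: M_def intro!: bexI[of _ h])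
    have "cinner h z = 0" if "h \<in> H" for h
    proof -
      have "inner z (c *\<^sub>C h) = 0" for c
        using cs that by (auto simp: csubspace_def intro!: z(2) HM)
      from this[of 1] this[of "- \<i>"] have "Re (cinner z h) = 0" "Im (cinner z h) = 0"
        by (auto simp: Re_cinner[symmetric] cinner_scaleC_right)
      then have "cinner z h = 0" by (simp add: complex_eq_iff)
      then show ?thesis by (metis cinner_commute complex_cnj_zero)
    qed
    then have "z \<in> M" using subspace_0[OF H_sub] by (auto simp: M_def N_def intro!: bexI[of _ 0])
    then show False using z by force
  qed
  then show ?thesis by (auto simp: M_def N_def)
qed

text \<open>The components chosen by \<open>orthogonal_decomposition\<close> give a map p with no
  linearity known in advance. Symmetry (p x | y) = (x | p y) is proved first; additivity and
  homogeneity follow by moving p to the other argument.\<close>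

lemma id_on:
  fixes H :: "'a::chilbert set"
  assumes H: "hilbert_space H"
  shows id_on_bounded_ops: "id_on H \<in> bounded_ops H"
    and id_on_apply: "x \<in> H \<Longrightarrow> id_on H x = x"
    and id_on_cinner: "cinner (id_on H x) y = cinner x (id_on H y)"
    and id_on_unique: "\<lbrakk>P \<in> bounded_ops H; \<And>x. x \<in> H \<Longrightarrow> P x = x\<rbrakk> \<Longrightarrow> id_on H = P"
proof -
  have cs: "csubspace H" using H by (auto simp: hilbert_space_def)
  obtain p where p: "\<And>x. p x \<in> H" "\<And>x h. h \<in> H \<Longrightarrow> cinner h (x - p x) = 0"
    using orthogonal_decomposition[OF H] by metis
  have sym: "cinner (p x) y = cinner x (p y)" for x y
  proof -
    have "cinner (p x) y = cinner (p x) (p y)" using p(2)[OF p(1)[of x], of y] by (simp add: cinner_diff_right)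
    also have "\<dots> = cinner x (p y)" using p(2)[OF p(1)[of y], of x]
      by (metis cinner_commute cinner_diff_right right_minus_eq)
    finally show ?thesis .
  qed
  have id: "p x = x" if "x \<in> H" for x
    by (rule cinner_eqI) (metis cinner_commute cinner_diff_left p(2) right_minus_eq sym that complex_cnj_zero)
  have "p (x + y) = p x + p y" for x y
    by (rule cinner_eqI) (simp add: sym[symmetric] cinner_add_right)
  moreover have sc: "p (c *\<^sub>C y) = c *\<^sub>C p y" for c y
    by (rule cinner_eqI) (simp add: sym[symmetric] cinner_scaleC_right)
  moreover have "norm (p x) \<le> norm x * 1" for x
  proof (cases "p x = 0")
    case False
    have "cinner (p x) (p x) = cinner (p x) x" by (metis sym id p(1))
    then have "(norm (p x))\<^sup>2 = cmod (cinner (p x) x)"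
      by (metis cinner_self norm_of_real abs_power2)
    also have "\<dots> \<le> norm (p x) * norm x" by (rule cmod_cinner_le)
    finally show ?thesis using False by (simp add: power2_eq_square)
  qed simp
  ultimately have "bounded_linear p"
    by (intro bounded_linear_intro[of p 1]) (auto simp: scaleC_of_real[symmetric])
  then have bp: "blinfun_apply (Blinfun p) = p" by (rule bounded_linear_Blinfun_apply)
  have z: "p x = 0" if "\<forall>h\<in>H. cinner h x = 0" for x
    by (rule cinner_eqI) (metis sym that p(1) cinner_zero_right)
  have bop: "Blinfun p \<in> bounded_ops H" by (simp add: bounded_ops_def bp sc p(1) z)
  have uniq: "P = Blinfun p" if P: "P \<in> bounded_ops H" "\<And>x. x \<in> H \<Longrightarrow> P x = x" for P
  proof (rule blinfun_eqI)
    fix x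
    have "P (x - p x) = 0" using P(1) p(2) by (auto simp: bounded_ops_def)
    then show "P x = Blinfun p x" using P(2)[OF p(1)[of x]] by (simp add: bp blinfun.diff_right)
  qed
  have eq: "id_on H = Blinfun p"
    unfolding id_on_def by (rule the_equality) (auto simp: bop bp id uniq)
  show "id_on H \<in> bounded_ops H" "x \<in> H \<Longrightarrow> id_on H x = x"
    "cinner (id_on H x) y = cinner x (id_on H y)"
    by (auto simp: eq bop bp id sym)
  show "\<lbrakk>P \<in> bounded_ops H; \<And>x. x \<in> H \<Longrightarrow> P x = x\<rbrakk> \<Longrightarrow> id_on H = P"
    using uniq eq by metis
qed

lemma cblinear_bounded_ops: "T \<in> bounded_ops H \<Longrightarrow> cblinear T"
  by (simp add: bounded_ops_def cblinear_def)

lemma cblinear_id_on [simp]: "hilbert_space H \<Longrightarrow> cblinear (id_on H)"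
  by (rule cblinear_bounded_ops[OF id_on_bounded_ops])

text \<open>Since x - \<open>id_on H\<close> x is orthogonal to \<open>H\<close>, the range and
  kernel conditions become absorption identities with the projection. The later bookkeeping of
  supports uses these identities.\<close>

lemma bounded_ops_iff:
  assumes H: "hilbert_space H"
  shows "T \<in> bounded_ops H \<longleftrightarrow> cblinear T \<and> id_on H o\<^sub>L T = T \<and> T o\<^sub>L id_on H = T"
proof
  assume T: "T \<in> bounded_ops H"
  then have 1: "id_on H o\<^sub>L T = T"
    by (intro blinfun_eqI) (auto simp: bounded_ops_def id_on_apply[OF H])
  have "T (x - id_on H x) = 0" for x
  proof -
    have "cinner h (x - id_on H x) = 0" if "h \<in> H" for h
      using id_on_cinner[OF H, of h x] id_on_apply[OF H that] by (simp add: cinner_diff_right)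
    then show ?thesis using T by (auto simp: bounded_ops_def)
  qed
  then have "T o\<^sub>L id_on H = T" by (intro blinfun_eqI) (simp add: blinfun.diff_right)
  then show "cblinear T \<and> id_on H o\<^sub>L T = T \<and> T o\<^sub>L id_on H = T"
    using 1 cblinear_bounded_ops[OF T] by simp
next
  assume T: "cblinear T \<and> id_on H o\<^sub>L T = T \<and> T o\<^sub>L id_on H = T"
  have "T x \<in> H" for x
  proof -
    have "id_on H (T x) \<in> H" using id_on_bounded_ops[OF H] by (simp add: bounded_ops_def)
    then show ?thesis using T by (metis blinfun_apply_blinfun_compose)
  qed
  moreover have "T x = 0" if "\<forall>h\<in>H. cinner h x = 0" for x
  proof -
    have "id_on H x = 0" using id_on_bounded_ops[OF H] that by (auto simp: bounded_ops_def)
    then show ?thesis using T by (metis blinfun_apply_blinfun_compose blinfun.zero_right)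
  qed
  ultimately show "T \<in> bounded_ops H" using T by (auto simp: bounded_ops_def cblinear_def)
qed

lemma id_on_idem: "hilbert_space H \<Longrightarrow> id_on H o\<^sub>L id_on H = id_on H"
  using bounded_ops_iff id_on_bounded_ops by blast

lemma adj_bounded_ops:
  assumes H: "hilbert_space H" and T: "T \<in> bounded_ops H"
  shows "adj T \<in> bounded_ops H"
proof -
  have c: "cblinear T" "id_on H o\<^sub>L T = T" "T o\<^sub>L id_on H = T" using assms bounded_ops_iff by blast+
  have "id_on H o\<^sub>L adj T = adj T"
    by (intro blinfun_eqI cinner_eqI)
      (metis blinfun_apply_blinfun_compose c cinner_adj id_on_cinner[OF H])
  moreover have "adj T o\<^sub>L id_on H = adj T"
    by (intro blinfun_eqI cinner_eqI)
      (metis blinfun_apply_blinfun_compose c cinner_adj id_on_cinner[OF H])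
  ultimately show ?thesis using cblinear_adj[OF c(1)] bounded_ops_iff[OF H] by blast
qed

subsection \<open>Operators between Hilbert tensor products\<close>

lemma norm_tensor: "norm (x \<otimes>\<^sub>v y) = norm x * norm y"
proof -
  have "complex_of_real ((norm (x \<otimes>\<^sub>v y))\<^sup>2) = complex_of_real ((norm x * norm y)\<^sup>2)"
    unfolding cinner_self[symmetric] cinner_tensor by (simp add: cinner_self power_mult_distrib)
  then have "(norm (x \<otimes>\<^sub>v y))\<^sup>2 = (norm x * norm y)\<^sup>2" using of_real_eq_iff by blast
  then show ?thesis by (simp add: power2_eq_iff_nonneg)
qed

lemma bounded_bilinear_tensor: "bounded_bilinear (\<otimes>\<^sub>v)"
proof
  fix r :: real and x :: "'a::chilbert" and y :: "'b::chilbert"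
  show "(r *\<^sub>R x) \<otimes>\<^sub>v y = r *\<^sub>R (x \<otimes>\<^sub>v y)"
    by (metis scaleC_of_real tensor_scaleC_left)
  show "x \<otimes>\<^sub>v (r *\<^sub>R y) = r *\<^sub>R (x \<otimes>\<^sub>v y)"
    by (metis scaleC_of_real tensor_scaleC_right)
qed (auto simp: tensor_add_left tensor_add_right norm_tensor intro!: exI[of _ 1])

lemmas bounded_linear_tensor_left = bounded_bilinear.bounded_linear_left[OF bounded_bilinear_tensor]
lemmas bounded_linear_tensor_right = bounded_bilinear.bounded_linear_right[OF bounded_bilinear_tensor]
lemmas tensor_bounded_linear =
  bounded_linear_compose[OF bounded_linear_tensor_left]
  bounded_linear_compose[OF bounded_linear_tensor_right]
  bounded_linear_compose[OF blinfun.bounded_linear_right]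
  bounded_linear_compose[OF bounded_linear_cinner_right]
  bounded_linear_ident

section \<open>Density of simple tensors and the resulting equality criteria\<close>

text \<open>A complex multiple of a simple tensor is again a simple tensor, so the real span is
  already the complex span of \<open>tensor_dense\<close>.\<close>

lemma span_tensor_dense:
  "closure (span (range (\<lambda>(x, y). x \<otimes>\<^sub>v y))) = (UNIV :: ('a::chilbert, 'b::chilbert) htensor set)"
proof -
  have "c *\<^sub>C (x \<otimes>\<^sub>v y) \<in> range (\<lambda>(x, y). x \<otimes>\<^sub>v y)" for c and x :: 'a and y :: 'b
    by (auto simp flip: tensor_scaleC_left)
  then have "{c *\<^sub>C z | c z. z \<in> {x \<otimes>\<^sub>v y | x y. True}} \<subseteq> range (\<lambda>(x :: 'a, y :: 'b). x \<otimes>\<^sub>v y)"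
    by blast
  from closure_mono[OF span_mono[OF this]] show ?thesis
    using tensor_dense[where 'a='a and 'b='b] by (simp add: cspan_def top_unique)
qed

lemma closure_span_induct:
  fixes S :: "'a::real_normed_vector set"
  assumes "t \<in> closure (span S)" and "subspace M" and "closed M" and "S \<subseteq> M"
  shows "t \<in> M"
  using assms closure_minimal span_minimal by blast

lemma tensor_subspace_UNIV:
  fixes M :: "('a::chilbert, 'b::chilbert) htensor set"
  assumes "subspace M" "closed M" "\<And>x y. x \<otimes>\<^sub>v y \<in> M"
  shows "t \<in> M"
  by (rule closure_span_induct[of t "range (\<lambda>(x, y). x \<otimes>\<^sub>v y)"])
    (use assms in \<open>auto simp: span_tensor_dense\<close>)

lemma bounded_linear_agree:
  assumes "bounded_linear f" "bounded_linear g"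
  shows "subspace {t. f t = g t}" "closed {t. f t = g t}"
proof -
  interpret f: bounded_linear f by fact
  interpret g: bounded_linear g by fact
  show "subspace {t. f t = g t}" by (simp add: subspace_def f.add g.add f.scaleR g.scaleR)
  show "closed {t. f t = g t}"
    by (intro closed_Collect_eq linear_continuous_on assms)
qed

text \<open>Two bounded real-linear maps agree on a closed real subspace. Uniqueness of the flip,
  the associators and tensor products of operators rests on this and on its variants for several
  legs.\<close>

lemma tensor_eqI:
  fixes t :: "('a::chilbert, 'b::chilbert) htensor"
  assumes "bounded_linear f" "bounded_linear g" "\<And>x y. f (x \<otimes>\<^sub>v y) = g (x \<otimes>\<^sub>v y)"
  shows "f t = g t"
  using tensor_subspace_UNIV[OF bounded_linear_agree[OF assms(1,2)]] assms(3) by auto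

lemma tensor_blinfun_eqI:
  assumes "\<And>x y. blinfun_apply S (x \<otimes>\<^sub>v y) = blinfun_apply T (x \<otimes>\<^sub>v y)"
  shows "S = T"
  using tensor_eqI[OF blinfun.bounded_linear_right blinfun.bounded_linear_right] assms
  by (intro blinfun_eqI) blast

lemma tensor3_blinfun_eqI:
  assumes "\<And>x y z. blinfun_apply S ((x \<otimes>\<^sub>v y) \<otimes>\<^sub>v z) = blinfun_apply T ((x \<otimes>\<^sub>v y) \<otimes>\<^sub>v z)"
  shows "S = T"
proof (rule tensor_blinfun_eqI)
  fix t z
  show "blinfun_apply S (t \<otimes>\<^sub>v z) = blinfun_apply T (t \<otimes>\<^sub>v z)"
    by (rule tensor_eqI[where t=t]) (intro tensor_bounded_linear assms)+
qed

lemma tensor3'_blinfun_eqI: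
  assumes "\<And>x y z. blinfun_apply S (x \<otimes>\<^sub>v (y \<otimes>\<^sub>v z)) = blinfun_apply T (x \<otimes>\<^sub>v (y \<otimes>\<^sub>v z))"
  shows "S = T"
proof (rule tensor_blinfun_eqI)
  fix x t
  show "blinfun_apply S (x \<otimes>\<^sub>v t) = blinfun_apply T (x \<otimes>\<^sub>v t)"
    by (rule tensor_eqI[where t=t]) (intro tensor_bounded_linear assms)+
qed

lemma tensor4_blinfun_eqI:
  assumes "\<And>x y z w. blinfun_apply S (((x \<otimes>\<^sub>v y) \<otimes>\<^sub>v z) \<otimes>\<^sub>v w)
      = blinfun_apply T (((x \<otimes>\<^sub>v y) \<otimes>\<^sub>v z) \<otimes>\<^sub>v w)"
  shows "S = T"
proof (rule tensor3_blinfun_eqI)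
  fix t z w
  show "blinfun_apply S ((t \<otimes>\<^sub>v z) \<otimes>\<^sub>v w) = blinfun_apply T ((t \<otimes>\<^sub>v z) \<otimes>\<^sub>v w)"
    by (rule tensor_eqI[where t=t]) (intro tensor_bounded_linear assms)+
qed

text \<open>The inner product is conjugate-linear in its left argument, hence still real-linear
  there, so the density argument also applies to the testing vector.\<close>

lemma tensor_cinner_eqI:
  assumes "\<And>x y. cinner (x \<otimes>\<^sub>v y) a = cinner (x \<otimes>\<^sub>v y) b"
  shows "a = b"
proof (rule cinner_eqI)
  fix t
  have "t \<in> {t. cinner t a = cinner t b}"
    by (rule tensor_subspace_UNIV)
      (use assms in \<open>auto intro!: bounded_linear_agree bounded_linear_cinner_left\<close>)
  then show "cinner t a = cinner t b" by simp
qed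

lemma tensor3_cinner_eqI:
  assumes "\<And>x y z. cinner ((x \<otimes>\<^sub>v y) \<otimes>\<^sub>v z) a = cinner ((x \<otimes>\<^sub>v y) \<otimes>\<^sub>v z) b"
  shows "a = b"
proof (rule tensor_cinner_eqI)
  fix t z
  have "t \<in> {t. cinner (t \<otimes>\<^sub>v z) a = cinner (t \<otimes>\<^sub>v z) b}"
    by (rule tensor_subspace_UNIV)
      (use assms in \<open>auto intro!: bounded_linear_agree
        bounded_linear_compose[OF bounded_linear_cinner_left bounded_linear_tensor_left]\<close>)
  then show "cinner (t \<otimes>\<^sub>v z) a = cinner (t \<otimes>\<^sub>v z) b" by simp
qed

lemma bounded_linear_scaleC: "bounded_linear (\<lambda>x::'a::chilbert. c *\<^sub>C x)"
  by (rule bounded_linear_intro[where K="cmod c"])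
    (auto simp: scaleC_add_right norm_scaleC scaleC_of_real[symmetric] scaleC_scaleC mult.commute)

lemma cblinear_tensorI:
  fixes T :: "('a::chilbert, 'b::chilbert) htensor \<Rightarrow>\<^sub>L 'c::chilbert"
  assumes "\<And>c x y. T ((c *\<^sub>C x) \<otimes>\<^sub>v y) = c *\<^sub>C T (x \<otimes>\<^sub>v y)"
  shows "cblinear T"
  unfolding cblinear_def
proof (intro allI)
  fix c t
  show "T (c *\<^sub>C t) = c *\<^sub>C T t"
    by (rule tensor_eqI[where t=t])
      (auto simp: tensor_scaleC_left[symmetric] assms
        intro!: bounded_linear_compose[OF blinfun.bounded_linear_right bounded_linear_scaleC]
          bounded_linear_compose[OF bounded_linear_scaleC blinfun.bounded_linear_right])
qed

text \<open>The graph of the extension is the closed span of G: there the norms of both components agree.\<close>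

lemma isometric_extension:
  fixes G :: "('a::real_inner \<times> 'b::{real_inner, complete_space}) set"
  assumes iso: "\<And>u v u' v'. \<lbrakk>(u, v) \<in> G; (u', v') \<in> G\<rbrakk> \<Longrightarrow> inner v v' = inner u u'"
    and dense: "closure (span (fst ` G)) = UNIV"
  shows "\<exists>S :: 'a \<Rightarrow>\<^sub>L 'b. \<forall>(u, v)\<in>G. S u = v"
proof -
  \<comment> \<open>Equality of inner products passes from \<open>G\<close> to its span in one
    argument at a time.\<close>
  have 1: "inner (snd p) (snd q) = inner (fst p) (fst q)" if "p \<in> span G" "q \<in> G" for p q
    using that(1)
    by (induction rule: span_induct_alt) (use that(2) iso in \<open>auto simp: inner_add_left\<close>)
  have 2: "inner (snd p) (snd q) = inner (fst p) (fst q)" if "p \<in> span G" "q \<in> span G" for p q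
    using that(2)
    by (induction rule: span_induct_alt) (use 1[OF that(1)] in \<open>auto simp: inner_add_right\<close>)
  then have nspan: "norm (snd p) = norm (fst p)" if "p \<in> span G" for p
    using that by (simp add: norm_eq_sqrt_inner)
  define \<Gamma> where "\<Gamma> = closure (span G)"
  have sub: "subspace \<Gamma>" by (simp add: \<Gamma>_def subspace_closure)
  have "closed {p :: 'a \<times> 'b. norm (snd p) = norm (fst p)}"
    by (intro closed_Collect_eq continuous_intros)
  then have "\<Gamma> \<subseteq> {p. norm (snd p) = norm (fst p)}"
    unfolding \<Gamma>_def using nspan by (intro closure_minimal) auto
  then have n\<Gamma>: "norm v = norm u" if "(u, v) \<in> \<Gamma>" for u v using that by auto
  have ex: "\<exists>v. (u, v) \<in> \<Gamma>" for u
  proof -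
    have "u \<in> closure (span (fst ` G))" using dense by simp
    then obtain f where f: "\<And>n. f n \<in> span (fst ` G)" "f \<longlonglongrightarrow> u" by (metis closure_sequential)
    have "span (fst ` G) = fst ` span G" using linear_span_image[OF linear_fst] by blast
    then have "\<exists>v. (f n, v) \<in> span G" for n using f(1)[of n] by force
    then obtain g where g: "\<And>n. (f n, g n) \<in> span G" by metis
    have "norm (g m - g n) = norm (f m - f n)" for m n
      using nspan[OF span_diff[OF g[of m] g[of n]]] by simp
    then have "Cauchy g" using LIMSEQ_imp_Cauchy[OF f(2)] by (simp add: Cauchy_def dist_norm)
    then obtain v where "g \<longlonglongrightarrow> v" using Cauchy_convergent convergent_def by blast
    then have "(\<lambda>n. (f n, g n)) \<longlonglongrightarrow> (u, v)" using f(2) by (intro tendsto_Pair)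
    then have "(u, v) \<in> \<Gamma>" unfolding \<Gamma>_def closure_sequential using g
      by (intro exI[of _ "\<lambda>n. (f n, g n)"]) simp
    then show ?thesis by blast
  qed
  then obtain S where S: "\<And>u. (u, S u) \<in> \<Gamma>" by metis
  \<comment> \<open>Two points of the graph over the same u differ by a point over 0, whose second
    component has norm 0.\<close>
  have uniq: "v = S u" if "(u, v) \<in> \<Gamma>" for u v
    using n\<Gamma>[of 0 "v - S u"] subspace_diff[OF sub that S[of u]] by simp
  have "bounded_linear S"
  proof (rule bounded_linear_intro[where K=1])
    fix x y :: 'a and r :: real
    show "S (x + y) = S x + S y" using subspace_add[OF sub S S, of x y] uniq by simp
    show "S (r *\<^sub>R x) = r *\<^sub>R S x" using subspace_scale[OF sub S, of r x] uniq by simp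
    show "norm (S x) \<le> norm x * 1" using n\<Gamma>[OF S] by simp
  qed
  moreover have "(u, v) \<in> \<Gamma>" if "(u, v) \<in> G" for u v
    using that span_base closure_subset by (auto simp: \<Gamma>_def)
  ultimately show ?thesis
    using uniq by (intro exI[of _ "Blinfun S"]) (auto simp: bounded_linear_Blinfun_apply)
qed

section \<open>Existence of maps on tensor products\<close>

lemma tensor_isometric_extension:
  fixes \<phi> :: "'a::chilbert \<Rightarrow> 'b::chilbert \<Rightarrow> 'c::chilbert"
  assumes "\<And>x y x' y'. cinner (\<phi> x y) (\<phi> x' y') = cinner x x' * cinner y y'"
  shows "\<exists>S. \<forall>x y. blinfun_apply S (x \<otimes>\<^sub>v y) = \<phi> x y"
proof -
  let ?G = "range (\<lambda>(x, y). (x \<otimes>\<^sub>v y, \<phi> x y))"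
  have "fst ` ?G = range (\<lambda>(x, y). x \<otimes>\<^sub>v y)" by force
  then have "closure (span (fst ` ?G)) = UNIV" by (simp only: span_tensor_dense)
  moreover have "inner (\<phi> x y) (\<phi> x' y') = inner (x \<otimes>\<^sub>v y) (x' \<otimes>\<^sub>v y')" for x y x' y'
    by (simp add: Re_cinner[symmetric] assms cinner_tensor)
  then have "inner v v' = inner u u'" if "(u, v) \<in> ?G" "(u', v') \<in> ?G" for u v u' v'
    using that by auto
  ultimately obtain S :: "('a, 'b) htensor \<Rightarrow>\<^sub>L 'c" where S: "\<forall>(u, v)\<in>?G. S u = v"
    using isometric_extension[of ?G] by blast
  then have "\<forall>x y. S (x \<otimes>\<^sub>v y) = \<phi> x y" by auto
  then show ?thesis by blast
qed

lemma flip_tensor [simp]: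
  fixes x :: "'a::chilbert" and y :: "'b::chilbert"
  shows "flip (x \<otimes>\<^sub>v y) = y \<otimes>\<^sub>v x"
proof -
  obtain S where S: "\<forall>(x::'a) (y::'b). blinfun_apply S (x \<otimes>\<^sub>v y) = y \<otimes>\<^sub>v x"
    using tensor_isometric_extension[of "\<lambda>x y. y \<otimes>\<^sub>v x"] by (auto simp: cinner_tensor mult.commute)
  then have "flip = S"
    unfolding flip_def by (intro the_equality) (auto intro: tensor_blinfun_eqI)
  with S show ?thesis by simp
qed

lemma cblinear_flip [simp]: "cblinear flip"
  by (rule cblinear_tensorI) (simp only: flip_tensor tensor_scaleC_right)

lemma flip_flip [simp]: "flip (flip t) = t"
  using tensor_blinfun_eqI[of "flip o\<^sub>L flip" id_blinfun] by (metis blinfun_apply_blinfun_compose blinfun_apply_id_blinfun flip_tensor id_apply)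

text \<open>\<open>T\<close> is applied to each coefficient of a vector of the tensor product. The
  coefficient of x \<otimes> y at e is (e | x) y, and \<open>cblinear T\<close> is what brings the
  scalar out in front.\<close>

lemma tensor_id_operator:
  fixes T :: "'b::chilbert \<Rightarrow>\<^sub>L 'd::chilbert"
  assumes T: "cblinear T"
  shows "\<exists>R. (\<forall>x y. blinfun_apply R (x \<otimes>\<^sub>v y) = (x::'a::chilbert) \<otimes>\<^sub>v T y) \<and> norm R \<le> norm T"
proof -
  define F where "F t = Abs_htensor (\<lambda>e. T (Rep_htensor t e))" for t :: "('a, 'b) htensor"
  have le: "(norm (T y))\<^sup>2 \<le> (norm T)\<^sup>2 * (norm y)\<^sup>2" for y
    using power_mono[OF norm_blinfun[of T y], of 2] by (simp add: power_mult_distrib)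
  have Rep: "Rep_htensor (F t) = (\<lambda>e. T (Rep_htensor t e))" for t
    unfolding F_def
  proof (rule Abs_htensor_inverse, safe)
    show "T (Rep_htensor t e) = 0" if "e \<notin> onb" for e using Rep_htensor[of t] that by simp
    show "(\<lambda>e. (norm (T (Rep_htensor t e)))\<^sup>2) summable_on UNIV"
      by (rule summable_on_comparison_test[OF summable_on_cmult_right[OF summable_Rep_htensor[of t]]])
        (use le in auto)
  qed
  have nF: "norm (F t) \<le> norm t * norm T" for t
  proof (rule power2_le_imp_le)
    have "(\<Sum>\<^sub>\<infinity>e. (norm (T (Rep_htensor t e)))\<^sup>2) \<le> (\<Sum>\<^sub>\<infinity>e. (norm T)\<^sup>2 * (norm (Rep_htensor t e))\<^sup>2)"
      using summable_Rep_htensor[of "F t"] le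
      by (intro infsum_mono summable_on_cmult_right summable_Rep_htensor) (auto simp: Rep)
    then show "(norm (F t))\<^sup>2 \<le> (norm t * norm T)\<^sup>2"
      by (simp add: norm_htensor Rep infsum_cmult_right summable_Rep_htensor power_mult_distrib mult.commute)
  qed simp
  have "bounded_linear F"
    by (rule bounded_linear_intro[where K="norm T"])
      (auto simp: Rep_htensor_inject[symmetric] Rep plus_htensor.rep_eq scaleR_htensor.rep_eq
        blinfun.add_right blinfun.scaleR_right nF)
  moreover have "F (x \<otimes>\<^sub>v y) = x \<otimes>\<^sub>v T y" for x y
    using T by (auto simp: Rep_htensor_inject[symmetric] Rep tensor.rep_eq cblinear_def)
  ultimately show ?thesis
    using nF by (intro exI[of _ "Blinfun F"])
      (auto simp: bounded_linear_Blinfun_apply mult.commute intro!: norm_blinfun_bound)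
qed

text \<open>Unlike tensor_op, this also covers associators and flips on one leg, which change the space.\<close>

definition tensor_map2 :: "('a::chilbert \<Rightarrow>\<^sub>L 'c::chilbert) \<Rightarrow> ('b::chilbert \<Rightarrow>\<^sub>L 'd::chilbert) \<Rightarrow>
    ('a, 'b) htensor \<Rightarrow>\<^sub>L ('c, 'd) htensor" (infixr "\<otimes>\<^sub>l" 70) where
  "S \<otimes>\<^sub>l T = (THE R. \<forall>x y. blinfun_apply R (x \<otimes>\<^sub>v y) = S x \<otimes>\<^sub>v T y)"

lemma tensor_op_eq: "S \<otimes>\<^sub>o T = S \<otimes>\<^sub>l T"
  by (simp add: tensor_op_def tensor_map2_def)

text \<open>\<open>tensor_id_operator\<close> acts on the right leg only; the left leg is reached by
  conjugating with flips. The norms of the flips stay in the bound as constants: later only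
  continuity of amplifications is at stake.\<close>

lemma
  fixes S :: "'a::chilbert \<Rightarrow>\<^sub>L 'c::chilbert" and T :: "'b::chilbert \<Rightarrow>\<^sub>L 'd::chilbert"
  assumes "cblinear S" "cblinear T"
  shows tensor_map2_tensor [simp]: "(S \<otimes>\<^sub>l T) (x \<otimes>\<^sub>v y) = S x \<otimes>\<^sub>v T y"
    and norm_tensor_map2:
      "norm (S \<otimes>\<^sub>l T) \<le> norm (flip :: ('d, 'c) htensor \<Rightarrow>\<^sub>L _) * norm S
        * norm (flip :: ('a, 'd) htensor \<Rightarrow>\<^sub>L _) * norm T"
proof -
  obtain R1 where R1: "\<forall>(x::'d) y. blinfun_apply R1 (x \<otimes>\<^sub>v y) = x \<otimes>\<^sub>v S y" "norm R1 \<le> norm S"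
    using tensor_id_operator[OF assms(1)] by blast
  obtain R2 where R2: "\<forall>(x::'a) y. blinfun_apply R2 (x \<otimes>\<^sub>v y) = x \<otimes>\<^sub>v T y" "norm R2 \<le> norm T"
    using tensor_id_operator[OF assms(2)] by blast
  let ?R = "flip o\<^sub>L R1 o\<^sub>L flip o\<^sub>L R2"
  have R: "?R (x \<otimes>\<^sub>v y) = S x \<otimes>\<^sub>v T y" for x y using R1 R2 by simp
  then have eq: "S \<otimes>\<^sub>l T = ?R"
    unfolding tensor_map2_def by (intro the_equality) (auto intro!: tensor_blinfun_eqI)
  with R show "(S \<otimes>\<^sub>l T) (x \<otimes>\<^sub>v y) = S x \<otimes>\<^sub>v T y" by simp
  show "norm (S \<otimes>\<^sub>l T) \<le> norm (flip :: ('d, 'c) htensor \<Rightarrow>\<^sub>L _) * norm S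
      * norm (flip :: ('a, 'd) htensor \<Rightarrow>\<^sub>L _) * norm T"
    unfolding eq
    by (intro order_trans[OF norm_blinfun_compose] mult_mono mult_left_mono R1(2) R2(2)
        mult_nonneg_nonneg norm_ge_zero order_refl)
qed

lemma cblinear_tensor_map2 [simp]: "cblinear S \<Longrightarrow> cblinear T \<Longrightarrow> cblinear (S \<otimes>\<^sub>l T)"
  by (rule cblinear_tensorI) (simp add: cblinearD flip: tensor_scaleC_left)

lemma tensor_map2_compose:
  assumes "cblinear S" "cblinear T" "cblinear S'" "cblinear T'"
  shows "(S \<otimes>\<^sub>l T) o\<^sub>L (S' \<otimes>\<^sub>l T') = (S o\<^sub>L S') \<otimes>\<^sub>l (T o\<^sub>L T')"
  by (rule tensor_blinfun_eqI) (simp add: assms)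

text \<open>Inserting a fixed vector in one leg, as an operator, lets criteria about a single leg be
  used inside a tensor product.\<close>

definition tensor_left :: "'a::chilbert \<Rightarrow> 'b::chilbert \<Rightarrow>\<^sub>L ('a, 'b) htensor" where
  "tensor_left x = Blinfun (\<lambda>y. x \<otimes>\<^sub>v y)"

definition tensor_right :: "'b::chilbert \<Rightarrow> 'a::chilbert \<Rightarrow>\<^sub>L ('a, 'b) htensor" where
  "tensor_right y = Blinfun (\<lambda>x. x \<otimes>\<^sub>v y)"

lemma tensor_left_apply [simp]: "tensor_left x y = x \<otimes>\<^sub>v y"
  by (simp add: tensor_left_def bounded_linear_Blinfun_apply bounded_linear_tensor_right)

lemma tensor_right_apply [simp]: "tensor_right y x = x \<otimes>\<^sub>v y"
  by (simp add: tensor_right_def bounded_linear_Blinfun_apply bounded_linear_tensor_left)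

lemma cblinear_tensor_left [simp]: "cblinear (tensor_left x)"
  by (simp add: cblinear_def tensor_scaleC_right)

lemma cblinear_tensor_right [simp]: "cblinear (tensor_right y)"
  by (simp add: cblinear_def tensor_scaleC_left)

section \<open>Rebracketing and permuting legs\<close>

text \<open>For fixed z, tensoring the second leg with z gives an operator \<open>A z\<close> on the
  first two legs. The map (t, z) \<mapsto> \<open>A z t\<close> respects inner products, for simple
  t by inspection and for all t by density, so \<open>tensor_isometric_extension\<close> yields the
  associator.\<close>

lemma assoc_tensor [simp]:
  fixes x :: "'a::chilbert" and y :: "'b::chilbert" and z :: "'c::chilbert"
  shows "assoc ((x \<otimes>\<^sub>v y) \<otimes>\<^sub>v z) = x \<otimes>\<^sub>v (y \<otimes>\<^sub>v z)"
proof -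
  have "\<exists>S. \<forall>(x::'a) (y::'b). blinfun_apply S (x \<otimes>\<^sub>v y) = x \<otimes>\<^sub>v (y \<otimes>\<^sub>v z)" for z :: 'c
    using tensor_id_operator[where 'a='a, of "tensor_right z"] by auto
  then obtain A where A: "\<And>z x y. blinfun_apply (A z) (x \<otimes>\<^sub>v y) = (x::'a) \<otimes>\<^sub>v ((y::'b) \<otimes>\<^sub>v (z::'c))"
    by metis
  have c1: "cinner (A z (x \<otimes>\<^sub>v y)) (A z' t) = cinner (x \<otimes>\<^sub>v y) t * cinner z z'" for x y t z z'
    by (rule tensor_eqI[where t=t])
      (auto simp: A cinner_tensor
        intro!: tensor_bounded_linear bounded_linear_mult_const bounded_linear_cinner_right)
  have c2: "cinner (A z s) (A z' t) = cinner s t * cinner z z'" for s t z z'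
  proof -
    \<comment> \<open>Conjugation moves the remaining simple tensor into the linear slot, where
      density applies again.\<close>
    have "cinner (A z' t) (A z (x \<otimes>\<^sub>v y)) = cinner t (x \<otimes>\<^sub>v y) * cinner z' z" for x y
      using c1[of z x y z' t, THEN arg_cong[where f=cnj]] by (simp add: cinner_commute[symmetric])
    then have "cinner (A z' t) (A z s) = cinner t s * cinner z' z"
      by (rule tensor_eqI[where t=s, rotated 2])
        (intro tensor_bounded_linear bounded_linear_mult_const bounded_linear_cinner_right)+
    from this[THEN arg_cong[where f=cnj]] show ?thesis by (simp add: cinner_commute[symmetric])
  qed
  obtain S where S: "\<forall>t z. blinfun_apply S (t \<otimes>\<^sub>v z) = A z t"
    using tensor_isometric_extension[of "\<lambda>t z. A z t"] c2 by auto
  then have "assoc = S"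
    unfolding assoc_def by (intro the_equality) (auto simp: A intro: tensor3_blinfun_eqI)
  with S show ?thesis by (simp add: A)
qed

text \<open>\<open>cblinear_tensorI\<close> would ask for homogeneity with a general vector of the
  inner tensor product in the left leg. Treating multiplication by c as a real-linear operator
  reduces the claim to an equality on threefold simple tensors.\<close>

lemma cblinear_assoc [simp]: "cblinear assoc"
  unfolding cblinear_def
proof (intro allI)
  fix c and t :: "(('a, 'b) htensor, 'c) htensor"
  have "assoc o\<^sub>L Blinfun (\<lambda>z. c *\<^sub>C z) = Blinfun (\<lambda>z. c *\<^sub>C z) o\<^sub>L (assoc :: (('a, 'b) htensor, 'c) htensor \<Rightarrow>\<^sub>L _)"
    by (rule tensor3_blinfun_eqI)
      (simp add: bounded_linear_Blinfun_apply[OF bounded_linear_scaleC] flip: tensor_scaleC_left)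
  then have "blinfun_apply (assoc o\<^sub>L Blinfun (\<lambda>z. c *\<^sub>C z)) t = blinfun_apply (Blinfun (\<lambda>z. c *\<^sub>C z) o\<^sub>L assoc) t"
    by (rule arg_cong)
  then show "assoc (c *\<^sub>C t) = c *\<^sub>C assoc t"
    by (simp add: bounded_linear_Blinfun_apply[OF bounded_linear_scaleC])
qed

text \<open>The inverse is built from \<open>assoc\<close> itself: x(yz) becomes x(zy), (zy)x,
  z(yx), (yx)z and (xy)z in turn.\<close>

lemma assoc_inv_eq:
  "assoc_inv = (flip \<otimes>\<^sub>l id_blinfun) o\<^sub>L flip o\<^sub>L assoc o\<^sub>L flip o\<^sub>L (id_blinfun \<otimes>\<^sub>l flip)" (is "_ = ?R")
  unfolding assoc_inv_def
  by (rule the_equality) (auto intro!: tensor3'_blinfun_eqI)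

lemma assoc_inv_tensor [simp]: "assoc_inv (x \<otimes>\<^sub>v (y \<otimes>\<^sub>v z)) = (x \<otimes>\<^sub>v y) \<otimes>\<^sub>v z"
  by (simp add: assoc_inv_eq)

lemma cblinear_assoc_inv [simp]: "cblinear assoc_inv"
  by (simp add: assoc_inv_eq)

lemma assoc_compose [simp]:
  "assoc o\<^sub>L assoc_inv = id_blinfun" "assoc_inv o\<^sub>L assoc = id_blinfun"
  by (auto intro!: tensor3_blinfun_eqI tensor3'_blinfun_eqI)

text \<open>Conjugation by this map turns the amplification \<open>leg12\<close> into
  \<open>leg13\<close>, which makes multiplicativity of \<open>leg13\<close> accessible.\<close>

definition swap23 ::
  "(('a::chilbert, 'b::chilbert) htensor, 'c::chilbert) htensor \<Rightarrow>\<^sub>L (('a, 'c) htensor, 'b) htensor"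
  where "swap23 = assoc_inv o\<^sub>L (id_blinfun \<otimes>\<^sub>l flip) o\<^sub>L assoc"

lemma swap23_tensor [simp]: "swap23 ((x \<otimes>\<^sub>v y) \<otimes>\<^sub>v z) = (x \<otimes>\<^sub>v z) \<otimes>\<^sub>v y"
  by (simp add: swap23_def)

lemma cblinear_swap23 [simp]: "cblinear swap23"
  by (simp add: swap23_def)

lemma swap23_swap23 [simp]: "swap23 o\<^sub>L swap23 = id_blinfun"
  by (rule tensor3_blinfun_eqI) simp

subsection \<open>Leg numbering\<close>

lemma adj_tensor:
  assumes "cblinear S" "cblinear T"
  shows "cinner ((S \<otimes>\<^sub>l T) s) t = cinner s ((adj S \<otimes>\<^sub>l adj T) t)"
proof -
  have "(adj (S \<otimes>\<^sub>l T)) = adj S \<otimes>\<^sub>l adj T"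
    by (intro tensor_blinfun_eqI tensor_cinner_eqI)
      (simp add: assms cblinear_adj cinner_adj[symmetric] cinner_tensor)
  then show ?thesis by (simp add: assms cinner_adj)
qed

lemma adj_id_on: "hilbert_space H \<Longrightarrow> adj (id_on H) = id_on H"
  by (intro blinfun_eqI cinner_eqI) (simp add: cinner_adj[symmetric] id_on_cinner)

lemma hilbert_space_closure_cspan: "hilbert_space (closure (cspan S))"
proof -
  have sub: "subspace (closure (cspan S))" by (simp add: cspan_def subspace_closure)
  have "c *\<^sub>C t \<in> closure (cspan S)" if t: "t \<in> closure (cspan S)" for c t
  proof -
    have "t \<in> {t. c *\<^sub>C t \<in> closure (cspan S)}"
    proof (rule closure_span_induct[OF t[unfolded cspan_def]])
      interpret bounded_linear "\<lambda>z::'a. c *\<^sub>C z" by (rule bounded_linear_scaleC)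
      show "subspace {t. c *\<^sub>C t \<in> closure (cspan S)}"
        using sub by (auto simp: subspace_def add scaleR)
      have "continuous_on UNIV (\<lambda>z::'a. c *\<^sub>C z)" by (rule linear_continuous_on[OF bounded_linear_scaleC])
      from continuous_closed_vimage[OF closed_closure, of "\<lambda>z. c *\<^sub>C z" "cspan S"] this
      show "closed {t. c *\<^sub>C t \<in> closure (cspan S)}"
        by (simp add: vimage_def continuous_on_eq_continuous_at)
      show "{c *\<^sub>C x |c x. x \<in> S} \<subseteq> {t. c *\<^sub>C t \<in> closure (cspan S)}"
        unfolding cspan_def
        by (auto simp: scaleC_scaleC intro!: subsetD[OF closure_subset] span_base) blast
    qed
    then show ?thesis by simp
  qed
  then show ?thesis
    using sub by (simp add: hilbert_space_def csubspace_def subspace_def)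
qed

lemma hilbert_space_tensor [simp]: "hilbert_space (H \<otimes>\<^sub>s K)"
  by (simp add: tensor_space_def hilbert_space_closure_cspan)

lemma tensor_in_tensor_space: "x \<in> H \<Longrightarrow> y \<in> K \<Longrightarrow> x \<otimes>\<^sub>v y \<in> H \<otimes>\<^sub>s K"
  unfolding tensor_space_def cspan_def
  by (rule subsetD[OF closure_subset], rule span_base, rule CollectI, rule exI[of _ 1]) auto

text \<open>By density the candidate has its range in the tensor space, by self-adjointness it
  vanishes on the complement, and it fixes the generators. The unit of a multiple tensor product can
  thus be split into its legs.\<close>

lemma id_on_tensor [simp]:
  assumes H: "hilbert_space H" and K: "hilbert_space K"
  shows "id_on (H \<otimes>\<^sub>s K) = id_on H \<otimes>\<^sub>l id_on K"
proof (rule id_on_unique[OF hilbert_space_tensor])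
  let ?P = "id_on H \<otimes>\<^sub>l id_on K"
  have cb: "cblinear ?P" using H K by simp
  have cs: "csubspace (H \<otimes>\<^sub>s K)" "closed (H \<otimes>\<^sub>s K)"
    using hilbert_space_tensor by (auto simp: hilbert_space_def)
  have sub: "subspace (H \<otimes>\<^sub>s K)" by (simp add: tensor_space_def cspan_def subspace_closure)
  have rng: "?P t \<in> H \<otimes>\<^sub>s K" for t
  proof -
    have "t \<in> {t. ?P t \<in> H \<otimes>\<^sub>s K}"
    proof (rule tensor_subspace_UNIV)
      show "subspace {t. ?P t \<in> H \<otimes>\<^sub>s K}"
        using sub by (auto simp: subspace_def blinfun.add_right blinfun.scaleR_right)
      show "closed {t. ?P t \<in> H \<otimes>\<^sub>s K}"
        using continuous_closed_vimage[OF cs(2), of "blinfun_apply ?P"]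
        by (simp add: vimage_def blinfun.isCont[OF continuous_const continuous_ident])
      have "id_on H x \<in> H" "id_on K y \<in> K" for x y
        using id_on_bounded_ops[OF H] id_on_bounded_ops[OF K] by (auto simp: bounded_ops_def)
      then show "x \<otimes>\<^sub>v y \<in> {t. ?P t \<in> H \<otimes>\<^sub>s K}" for x y
        using H K by (simp add: tensor_in_tensor_space)
    qed
    then show ?thesis by simp
  qed
  have "?P x = 0" if "\<forall>h\<in>H \<otimes>\<^sub>s K. cinner h x = 0" for x
  proof (rule cinner_eqI)
    fix y
    have "cinner y (?P x) = cinner (?P y) x"
      using H K by (simp add: adj_tensor adj_id_on)
    then show "cinner y (?P x) = cinner y 0" using that rng by simp
  qed
  then show "?P \<in> bounded_ops (H \<otimes>\<^sub>s K)"
    using cb rng by (simp add: bounded_ops_def cblinear_def)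
  fix x assume x: "x \<in> H \<otimes>\<^sub>s K"
  have "x \<in> {x. ?P x = x}"
  proof (rule closure_span_induct[OF x[unfolded tensor_space_def cspan_def]])
    show "subspace {x. ?P x = x}" "closed {x. ?P x = x}"
      by (intro bounded_linear_agree tensor_bounded_linear blinfun.bounded_linear_right)+
    show "{c *\<^sub>C z |c z. z \<in> {x \<otimes>\<^sub>v y |x y. x \<in> H \<and> y \<in> K}} \<subseteq> {x. ?P x = x}"
      using H K by (auto simp: cblinearD[OF cb] id_on_apply)
  qed
  then show "?P x = x" by simp
qed

lemma leg12_eq: "leg12 X L = X \<otimes>\<^sub>l id_on L"
  by (simp add: leg12_def tensor_op_eq)

lemma leg23_eq: "leg23 H X = assoc_inv o\<^sub>L (id_on H \<otimes>\<^sub>l X) o\<^sub>L assoc"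
  by (simp add: leg23_def tensor_op_eq)

text \<open>The matrix coefficients in the definition of \<open>leg13\<close> determine an operator
  because simple tensors are dense; the conjugated amplification has these coefficients.\<close>

lemma leg13_eq:
  fixes X :: "('a::chilbert, 'c::chilbert) htensor bop" and K :: "'b::chilbert set"
  assumes X: "cblinear X" and K: "hilbert_space K"
  shows "leg13 K X = swap23 o\<^sub>L (X \<otimes>\<^sub>l id_on K) o\<^sub>L swap23" (is "_ = ?R")
proof -
  have sw: "cinner ((x \<otimes>\<^sub>v y) \<otimes>\<^sub>v z) (swap23 (s \<otimes>\<^sub>v y')) = cinner y y' * cinner (x \<otimes>\<^sub>v z) s"
    for x :: 'a and y y' :: 'b and z :: 'c and s
    by (rule tensor_eqI[where t=s])
      (auto simp: cinner_tensor
        intro!: tensor_bounded_linear bounded_linear_const_mult bounded_linear_cinner_right)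
  have R: "cinner ((x \<otimes>\<^sub>v y) \<otimes>\<^sub>v z) (?R ((x' \<otimes>\<^sub>v y') \<otimes>\<^sub>v z'))
      = cinner y (id_on K y') * cinner (x \<otimes>\<^sub>v z) (X (x' \<otimes>\<^sub>v z'))" for x y z x' y' z'
    using X K by (simp add: sw)
  show ?thesis
    unfolding leg13_def
  proof (rule the_equality)
    fix R :: "(('a, 'b) htensor, 'c) htensor bop"
    assume R': "\<forall>x y z x' y' z'. cinner ((x \<otimes>\<^sub>v y) \<otimes>\<^sub>v z) (R ((x' \<otimes>\<^sub>v y') \<otimes>\<^sub>v z')) =
         cinner y (id_on K y') * cinner (x \<otimes>\<^sub>v z) (X (x' \<otimes>\<^sub>v z'))"
    show "R = ?R"
      by (intro tensor3_blinfun_eqI tensor3_cinner_eqI) (simp only: R R')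
  qed (use R in blast)
qed

subsection \<open>Slice maps\<close>

lemma norm_le_cinner:
  fixes a :: "'a::chilbert"
  assumes "\<And>x. cmod (cinner x a) \<le> norm x * k" and "0 \<le> k"
  shows "norm a \<le> k"
proof (cases "a = 0")
  case False
  have "(norm a)\<^sup>2 \<le> norm a * k"
    using assms(1)[of a] by (simp add: cinner_self norm_power)
  then show ?thesis using False by (simp add: power2_eq_square)
qed (use assms in simp)

text \<open>A normal functional is a sum of vector functionals, so it turns a bounded
  operator-valued sesquilinear form \<open>F\<close> into a bounded scalar one. The hypotheses on
  \<open>F\<close> are stated at each vector x, where complex multiples make sense.\<close>

lemma predual_slice:
  fixes F :: "'b::chilbert \<Rightarrow> 'b \<Rightarrow> 'a::chilbert bop"
  assumes \<omega>: "\<omega> \<in> predual H"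
    and addl: "\<And>y y' u x. F (y + y') u x = F y u x + F y' u x"
    and addr: "\<And>y u u' x. F y (u + u') x = F y u x + F y u' x"
    and scl: "\<And>c y u x. F (c *\<^sub>C y) u x = cnj c *\<^sub>C F y u x"
    and scr: "\<And>c y u x. F y (c *\<^sub>C u) x = c *\<^sub>C F y u x"
    and bd: "\<And>y u x. norm (F y u x) \<le> norm x * (norm y * norm u * K)" and K: "0 \<le> K"
  shows "\<exists>T :: 'b bop. cblinear T \<and> (\<forall>y u. cinner y (T u) = \<omega> (F y u))"
proof -
  obtain v w :: "nat \<Rightarrow> 'a" where \<omega>_def: "\<omega> = (\<lambda>T. \<Sum>n. cinner (v n) (T (w n)))"
    and v: "summable (\<lambda>n. (norm (v n))\<^sup>2)" and w: "summable (\<lambda>n. (norm (w n))\<^sup>2)"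
    using \<omega> unfolding predual_def by auto
  \<comment> \<open>Square summability enters here: \<open>c n\<close> dominates norm (v n) * norm
    (w n), and its sum gives the bound of the scalar form.\<close>
  define c where "c n = (norm (v n))\<^sup>2 + (norm (w n))\<^sup>2" for n
  have c: "summable c" unfolding c_def by (intro summable_add v w)
  have c0: "0 \<le> c n" for n by (simp add: c_def)
  have le: "cmod (cinner (v n) (F y u (w n))) \<le> c n * (norm y * norm u * K)" for n y u
  proof -
    have "cmod (cinner (v n) (F y u (w n))) \<le> norm (v n) * norm (F y u (w n))" by (rule cmod_cinner_le)
    also have "\<dots> \<le> norm (v n) * (norm (w n) * (norm y * norm u * K))"
      by (intro mult_left_mono bd) simp
    also have "\<dots> = (norm (v n) * norm (w n)) * (norm y * norm u * K)" by simp
    also have "norm (v n) * norm (w n) \<le> c n"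
      using sum_squares_bound[of "norm (v n)" "norm (w n)"]
        mult_nonneg_nonneg[OF norm_ge_zero[of "v n"] norm_ge_zero[of "w n"]]
      unfolding c_def by linarith
    then have "(norm (v n) * norm (w n)) * (norm y * norm u * K) \<le> c n * (norm y * norm u * K)"
      using K by (intro mult_right_mono) auto
    finally show ?thesis .
  qed
  have sc: "summable (\<lambda>n. c n * (norm y * norm u * K))" for y u :: 'b
    by (rule summable_mult2[OF c])
  have sn: "summable (\<lambda>n. cmod (cinner (v n) (F y u (w n))))" for y u
    by (rule summable_comparison_test'[OF sc[of y u]]) (use le in auto)
  have s: "summable (\<lambda>n. cinner (v n) (F y u (w n)))" for y u
    by (rule summable_norm_cancel[OF sn])
  have "cmod (\<omega> (F y u)) \<le> norm y * norm u * (suminf c * K)" for y u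
  proof -
    have "cmod (\<omega> (F y u)) \<le> (\<Sum>n. cmod (cinner (v n) (F y u (w n))))"
      unfolding \<omega>_def by (rule summable_norm[OF sn])
    also have "\<dots> \<le> (\<Sum>n. c n * (norm y * norm u * K))" by (intro suminf_le le sn sc)
    also have "\<dots> = suminf c * (norm y * norm u * K)" by (rule suminf_mult2[OF c, symmetric])
    finally show ?thesis by (simp add: mult_ac)
  qed
  then show ?thesis
    using K c c0
    by (rule_tac sesquilinear_operator[where K="suminf c * K"])
      (simp_all add: \<omega>_def addl addr scl scr cinner_add_right cinner_scaleC_right
        suminf_add[OF s s, symmetric] suminf_mult[OF s] suminf_nonneg)
qed

lemma norm_sesquilinear_tensor:
  fixes X :: "('a::chilbert, 'b::chilbert) htensor bop"
  shows "cmod (cinner (x \<otimes>\<^sub>v y) (X (z \<otimes>\<^sub>v u))) \<le> norm x * norm y * norm z * norm u * norm X"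
proof -
  have "cmod (cinner (x \<otimes>\<^sub>v y) (X (z \<otimes>\<^sub>v u))) \<le> norm (x \<otimes>\<^sub>v y) * norm (X (z \<otimes>\<^sub>v u))"
    by (rule cmod_cinner_le)
  also have "\<dots> \<le> norm (x \<otimes>\<^sub>v y) * (norm X * norm (z \<otimes>\<^sub>v u))"
    by (intro mult_left_mono norm_blinfun) simp
  finally show ?thesis by (simp add: norm_tensor mult_ac)
qed

lemmas tensor_sesquilinear_simps =
  tensor_add_left tensor_add_right tensor_scaleC_left tensor_scaleC_right blinfun.add_right
  cinner_add_left cinner_add_right cinner_scaleC_left cinner_scaleC_right

lemma vector_slice_right:
  assumes X: "cblinear X"
  shows "cinner x (vector_slice_right y u X z) = cinner (x \<otimes>\<^sub>v y) (X (z \<otimes>\<^sub>v u))"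
proof -
  have "\<exists>S. cblinear S \<and> (\<forall>x z. cinner x (S z) = cinner (x \<otimes>\<^sub>v y) (X (z \<otimes>\<^sub>v u)))"
  proof (rule sesquilinear_operator[where K="norm y * norm u * norm X"])
    fix p q
    show "cmod (cinner (p \<otimes>\<^sub>v y) (X (q \<otimes>\<^sub>v u))) \<le> norm p * norm q * (norm y * norm u * norm X)"
      using norm_sesquilinear_tensor[of p y X q u] by (simp add: mult_ac)
  qed (simp_all add: tensor_sesquilinear_simps cblinearD[OF X])
  then obtain S where S: "\<forall>x z. cinner x (blinfun_apply S z) = cinner (x \<otimes>\<^sub>v y) (X (z \<otimes>\<^sub>v u))"
    by blast
  have "vector_slice_right y u X = S"
    unfolding vector_slice_right_def
    by (rule the_equality, rule S) (intro blinfun_eqI, rule cinner_eqI, simp add: S)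
  with S show ?thesis by simp
qed

lemma vector_slice_left:
  assumes X: "cblinear X"
  shows "cinner y (vector_slice_left x z X u) = cinner (x \<otimes>\<^sub>v y) (X (z \<otimes>\<^sub>v u))"
proof -
  have "\<exists>S. cblinear S \<and> (\<forall>y u. cinner y (S u) = cinner (x \<otimes>\<^sub>v y) (X (z \<otimes>\<^sub>v u)))"
  proof (rule sesquilinear_operator[where K="norm x * norm z * norm X"])
    fix p q
    show "cmod (cinner (x \<otimes>\<^sub>v p) (X (z \<otimes>\<^sub>v q))) \<le> norm p * norm q * (norm x * norm z * norm X)"
      using norm_sesquilinear_tensor[of x p X z q] by (simp add: mult_ac)
  qed (simp_all add: tensor_sesquilinear_simps cblinearD[OF X])
  then obtain S where S: "\<forall>y u. cinner y (blinfun_apply S u) = cinner (x \<otimes>\<^sub>v y) (X (z \<otimes>\<^sub>v u))"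
    by blast
  have "vector_slice_left x z X = S"
    unfolding vector_slice_left_def
    by (rule the_equality, rule S) (intro blinfun_eqI, rule cinner_eqI, simp add: S)
  with S show ?thesis by simp
qed

lemma
  assumes \<omega>: "\<omega> \<in> predual H" and X: "cblinear X"
  shows cblinear_slice_left: "cblinear (slice_left \<omega> X)"
    and cinner_slice_left: "cinner y (slice_left \<omega> X u) = \<omega> (vector_slice_right y u X)"
proof -
  have "norm (vector_slice_right y u X x) \<le> norm x * (norm y * norm u * norm X)" for y u x
    by (rule norm_le_cinner)
      (use norm_sesquilinear_tensor[of _ y X x u] in \<open>simp_all add: vector_slice_right[OF X] mult_ac\<close>)
  then have "\<exists>T. cblinear T \<and> (\<forall>y u. cinner y (blinfun_apply T u) = \<omega> (vector_slice_right y u X))"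
    by (rule predual_slice[OF \<omega>, rotated 4])
      ((rule cinner_eqI)?, simp add: vector_slice_right[OF X] tensor_sesquilinear_simps cblinearD[OF X])+
  then obtain T where T: "cblinear T"
    "\<forall>y u. cinner y (blinfun_apply T u) = \<omega> (vector_slice_right y u X)" by blast
  have "slice_left \<omega> X = T"
    unfolding slice_left_def
    by (rule the_equality, rule T(2)) (intro blinfun_eqI, rule cinner_eqI, simp add: T)
  with T show "cblinear (slice_left \<omega> X)"
    "cinner y (slice_left \<omega> X u) = \<omega> (vector_slice_right y u X)" by auto
qed

lemma
  assumes \<omega>: "\<omega> \<in> predual H" and X: "cblinear X"
  shows cblinear_slice_right: "cblinear (slice_right \<omega> X)"
    and cinner_slice_right: "cinner x (slice_right \<omega> X z) = \<omega> (vector_slice_left x z X)"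
proof -
  have "norm (vector_slice_left x z X y) \<le> norm y * (norm x * norm z * norm X)" for x y z
    by (rule norm_le_cinner)
      (use norm_sesquilinear_tensor[of x _ X z y] in \<open>simp_all add: vector_slice_left[OF X] mult_ac\<close>)
  then have "\<exists>T. cblinear T \<and> (\<forall>x z. cinner x (blinfun_apply T z) = \<omega> (vector_slice_left x z X))"
    by (rule predual_slice[OF \<omega>, rotated 4])
      ((rule cinner_eqI)?, simp add: vector_slice_left[OF X] tensor_sesquilinear_simps cblinearD[OF X])+
  then obtain T where T: "cblinear T"
    "\<forall>x z. cinner x (blinfun_apply T z) = \<omega> (vector_slice_left x z X)" by blast
  have "slice_right \<omega> X = T"
    unfolding slice_right_def
    by (rule the_equality, rule T(2)) (intro blinfun_eqI, rule cinner_eqI, simp add: T)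
  with T show "cblinear (slice_right \<omega> X)"
    "cinner x (slice_right \<omega> X z) = \<omega> (vector_slice_left x z X)" by auto
qed

lemma vector_functional_predual:
  assumes "x \<in> H" "y \<in> H" "0 \<in> H"
  shows "(\<lambda>T. cinner x (blinfun_apply T y)) \<in> predual H"
proof -
  \<comment> \<open>A vector functional is a series with a single nonzero term, padded with zero
    vectors.\<close>
  let ?x = "\<lambda>n::nat. if n = 0 then x else 0" and ?y = "\<lambda>n::nat. if n = 0 then y else 0"
  have "cinner x (T y) = (\<Sum>n. cinner (?x n) (blinfun_apply T (?y n)))" for T :: "'a bop"
    by (subst suminf_finite[of "{0}"]) auto
  moreover have "summable (\<lambda>n. (norm (?x n))\<^sup>2)" "summable (\<lambda>n. (norm (?y n))\<^sup>2)"
    by (rule summable_finite[of "{0}"]; simp)+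
  moreover have "range ?x \<subseteq> H" "range ?y \<subseteq> H" using assms by auto
  ultimately show ?thesis
    unfolding predual_def by (intro CollectI exI[of _ ?x] exI[of _ ?y] conjI ext)
qed

text \<open>Both algebras are norm closures of slices; closedness carries complex linearity from the
  slices to all elements.\<close>

lemma closed_cblinear: "closed {T :: 'a::chilbert \<Rightarrow>\<^sub>L 'b::chilbert. cblinear T}"
proof -
  have "{T :: 'a \<Rightarrow>\<^sub>L 'b. cblinear T} = (\<Inter>c. \<Inter>x. {T :: 'a \<Rightarrow>\<^sub>L 'b. T (c *\<^sub>C x) = c *\<^sub>C T x})"
    by (auto simp: cblinear_def)
  also have "closed \<dots>"
    by (intro closed_INT ballI bounded_linear_agree(2) blinfun.bounded_linear_left
        bounded_linear_compose[OF bounded_linear_scaleC])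
  finally show ?thesis .
qed

lemma cblinear_qgroup_of:
  assumes W: "cblinear W" and a: "a \<in> alg (qgroup_of H W)"
  shows "cblinear a"
proof -
  have "closure {slice_left \<omega> W | \<omega>. \<omega> \<in> predual H} \<subseteq> {T. cblinear T}"
    by (rule closure_minimal[OF _ closed_cblinear]) (use W in \<open>auto intro: cblinear_slice_left\<close>)
  then show ?thesis using a by (auto simp: qgroup_of_def Let_def)
qed

lemma cblinear_dual_qgroup_of:
  assumes W: "cblinear W" and a: "a \<in> alg (dual_qgroup_of H W)"
  shows "cblinear a"
proof -
  have "closure {slice_right \<omega> (adj W) | \<omega>. \<omega> \<in> predual H} \<subseteq> {T. cblinear T}"
    by (rule closure_minimal[OF _ closed_cblinear]) (use W in \<open>auto intro: cblinear_slice_right cblinear_adj\<close>)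
  then show ?thesis using a by (auto simp: dual_qgroup_of_def Let_def)
qed

subsection \<open>Nondegenerate sets of operators\<close>

text \<open>This is the dual form of the span of all a u being dense in \<open>H\<close>, for
  operators on \<open>H\<close>. The vector y ranges over the ambient space, so only its component
  in \<open>H\<close> can be forced to vanish.\<close>

definition nondegenerate :: "'a::chilbert set \<Rightarrow> 'a bop set \<Rightarrow> bool" where
  "nondegenerate H A \<longleftrightarrow> (\<forall>y. (\<forall>a\<in>A. \<forall>u\<in>H. cinner y (a u) = 0) \<longrightarrow> id_on H y = 0)"

lemma id_on_mem: "hilbert_space H \<Longrightarrow> id_on H x \<in> H"
  using id_on_bounded_ops by (auto simp: bounded_ops_def)

lemma tensor_eq_0D: "x \<otimes>\<^sub>v y = 0 \<Longrightarrow> x = 0 \<or> y = 0"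
  using norm_tensor[of x y] by simp

lemma cinner_adj': "cblinear T \<Longrightarrow> cinner (adj T x) y = cinner x (T y)"
  by (metis cinner_adj cinner_commute)

lemma exists_nonzero: "hilbert_space H \<Longrightarrow> H \<noteq> {0} \<Longrightarrow> \<exists>x\<in>H. x \<noteq> 0"
  by (auto simp: hilbert_space_def csubspace_def)

text \<open>If y is orthogonal to all slices applied to \<open>H\<close>, then for a fixed x in
  \<open>H\<close> the vector x \<otimes> y is orthogonal to the range of \<open>W\<close>, so
  \<open>adj W\<close> kills it. Applying \<open>W\<close> gives x \<otimes> P y = 0, P being the
  projection onto \<open>H\<close>, and x can be taken nonzero.\<close>

lemma nondegenerate_qgroup_of:
  fixes H :: "'h::chilbert set"
  assumes H: "hilbert_space H" "H \<noteq> {0}" and W: "unitary_on (H \<otimes>\<^sub>s H) W"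
  shows "nondegenerate H (alg (qgroup_of H W))"
  unfolding nondegenerate_def
proof (intro allI impI)
  fix y assume y: "\<forall>a\<in>alg (qgroup_of H W). \<forall>u\<in>H. cinner y (a u) = 0"
  have WB: "W \<in> bounded_ops (H \<otimes>\<^sub>s H)" using W by (simp add: unitary_on_def)
  then have W1: "cblinear W" "W o\<^sub>L (id_on H \<otimes>\<^sub>l id_on H) = W"
    using bounded_ops_iff[OF hilbert_space_tensor[of H H], of W] H by simp_all
  have W2: "W (adj W t) = (id_on H \<otimes>\<^sub>l id_on H) t" for t
    using W H by (metis unitary_on_def blinfun_apply_blinfun_compose id_on_tensor)
  have 0: "0 \<in> H" using H by (simp add: hilbert_space_def csubspace_def)
  obtain x where x: "x \<in> H" "x \<noteq> 0" using exists_nonzero H by blast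
  have 1: "cinner (x \<otimes>\<^sub>v y) (W (z \<otimes>\<^sub>v u)) = 0" if "z \<in> H" "u \<in> H" for z u
  proof -
    let ?\<omega> = "\<lambda>T :: 'h bop. cinner x (T z)"
    have \<omega>: "?\<omega> \<in> predual H" using x that 0 by (intro vector_functional_predual)
    then have "slice_left ?\<omega> W \<in> alg (qgroup_of H W)"
      by (auto simp: qgroup_of_def Let_def intro!: subsetD[OF closure_subset])
    then have "cinner y (slice_left ?\<omega> W u) = 0" using y that by blast
    then show ?thesis using \<omega> W1 by (simp add: cinner_slice_left vector_slice_right)
  qed
  have "adj W (x \<otimes>\<^sub>v y) = 0"
  proof (rule tensor_cinner_eqI)
    fix z u
    \<comment> \<open>Orthogonality is known only for z and u in \<open>H\<close>; since
      \<open>W\<close> absorbs the projection, arbitrary vectors may be projected first.\<close>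
    have "W (z \<otimes>\<^sub>v u) = W (id_on H z \<otimes>\<^sub>v id_on H u)"
      using W1(2) H by (metis blinfun_apply_blinfun_compose tensor_map2_tensor cblinear_id_on)
    then have "cinner (adj W (x \<otimes>\<^sub>v y)) (z \<otimes>\<^sub>v u) = 0"
      using 1[of "id_on H z" "id_on H u"] H W1 by (simp add: cinner_adj' id_on_mem)
    then show "cinner (z \<otimes>\<^sub>v u) (adj W (x \<otimes>\<^sub>v y)) = cinner (z \<otimes>\<^sub>v u) 0"
      by (metis cinner_commute cinner_zero_right complex_cnj_zero)
  qed
  then have "x \<otimes>\<^sub>v id_on H y = 0" using W2[of "x \<otimes>\<^sub>v y"] H x by (simp add: id_on_apply)
  then show "id_on H y = 0" using x tensor_eq_0D by blast
qed

text \<open>Mirror image of the preceding argument: slicing \<open>adj W\<close> on its right leg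
  shows that \<open>W\<close> kills y \<otimes> x, and applying \<open>adj W\<close> isolates the
  component of y in \<open>H\<close>.\<close>

lemma nondegenerate_dual_qgroup_of:
  fixes H :: "'h::chilbert set"
  assumes H: "hilbert_space H" "H \<noteq> {0}" and W: "unitary_on (H \<otimes>\<^sub>s H) W"
  shows "nondegenerate H (alg (dual_qgroup_of H W))"
  unfolding nondegenerate_def
proof (intro allI impI)
  fix y assume y: "\<forall>a\<in>alg (dual_qgroup_of H W). \<forall>u\<in>H. cinner y (a u) = 0"
  have WB: "W \<in> bounded_ops (H \<otimes>\<^sub>s H)" using W by (simp add: unitary_on_def)
  then have W1: "cblinear W" "(id_on H \<otimes>\<^sub>l id_on H) o\<^sub>L W = W"
    using bounded_ops_iff[OF hilbert_space_tensor[of H H], of W] H by simp_all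
  have W2: "adj W (W t) = (id_on H \<otimes>\<^sub>l id_on H) t" for t
    using W H by (metis unitary_on_def blinfun_apply_blinfun_compose id_on_tensor)
  have 0: "0 \<in> H" using H by (simp add: hilbert_space_def csubspace_def)
  obtain x where x: "x \<in> H" "x \<noteq> 0" using exists_nonzero H by blast
  have 1: "cinner (W (y \<otimes>\<^sub>v x)) (z \<otimes>\<^sub>v u) = 0" if "z \<in> H" "u \<in> H" for z u
  proof -
    let ?\<omega> = "\<lambda>T :: 'h bop. cinner x (T u)"
    have \<omega>: "?\<omega> \<in> predual H" using x that 0 by (intro vector_functional_predual)
    then have "slice_right ?\<omega> (adj W) \<in> alg (dual_qgroup_of H W)"
      by (auto simp: dual_qgroup_of_def Let_def intro!: subsetD[OF closure_subset])
    then have "cinner y (slice_right ?\<omega> (adj W) z) = 0" using y that by blast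
    then show ?thesis
      using \<omega> W1 by (simp add: cinner_slice_right vector_slice_left cblinear_adj cinner_adj)
  qed
  have "W (y \<otimes>\<^sub>v x) = 0"
  proof (rule tensor_cinner_eqI)
    fix z u
    have "cinner (W (y \<otimes>\<^sub>v x)) (z \<otimes>\<^sub>v u)
        = cinner ((id_on H \<otimes>\<^sub>l id_on H) (W (y \<otimes>\<^sub>v x))) (z \<otimes>\<^sub>v u)"
      using W1(2) by (metis blinfun_apply_blinfun_compose)
    also have "\<dots> = cinner (W (y \<otimes>\<^sub>v x)) (id_on H z \<otimes>\<^sub>v id_on H u)"
      using H by (simp add: adj_tensor adj_id_on)
    also have "\<dots> = 0" using H by (simp add: 1 id_on_mem)
    finally show "cinner (z \<otimes>\<^sub>v u) (W (y \<otimes>\<^sub>v x)) = cinner (z \<otimes>\<^sub>v u) 0"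
      by (metis cinner_commute cinner_zero_right complex_cnj_zero)
  qed
  then have "id_on H y \<otimes>\<^sub>v x = 0" using W2[of "y \<otimes>\<^sub>v x"] H x by (simp add: id_on_apply)
  then show "id_on H y = 0" using x tensor_eq_0D by blast
qed

text \<open>Riesz writes x \<mapsto> (v | R x) as x \<mapsto> (y | x). This y is orthogonal to all a
  u, so its component in \<open>H\<close> is zero.\<close>

lemma nondegenerate_vanish:
  fixes R :: "'a::chilbert \<Rightarrow>\<^sub>L 'b::chilbert"
  assumes A: "nondegenerate H A" and H: "hilbert_space H" and R: "cblinear R"
    and z: "\<And>a u. a \<in> A \<Longrightarrow> u \<in> H \<Longrightarrow> R (a u) = 0"
  shows "R (id_on H x) = 0"
proof (rule cinner_eqI)
  fix v
  have "bounded_linear (\<lambda>x. cinner v (R x))"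
    by (intro bounded_linear_compose[OF bounded_linear_cinner_right] blinfun.bounded_linear_right)
  then obtain y where y: "\<And>x. cinner v (R x) = cinner y x"
    using riesz[of "\<lambda>x. cinner v (R x)"] by (auto simp: cblinearD[OF R] cinner_scaleC_right)
  have "cinner y (a u) = 0" if "a \<in> A" "u \<in> H" for a u
    using z[OF that] y[of "a u"] by simp
  then have "id_on H y = 0" using A by (auto simp: nondegenerate_def)
  then have "cinner y (id_on H x) = 0" using id_on_cinner[OF H, of y x] by simp
  then show "cinner v (R (id_on H x)) = cinner v 0" by (simp add: y)
qed

text \<open>One leg at a time: with b v fixed on the right, nondegeneracy of \<open>A\<close>
  applies; then the projected x is fixed on the left and that of \<open>B\<close> applies.\<close>

lemma nondegenerate_tensor_vanish:
  fixes R :: "('a::chilbert, 'b::chilbert) htensor \<Rightarrow>\<^sub>L 'c::chilbert"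
  assumes A: "nondegenerate H A" and B: "nondegenerate K B"
    and H: "hilbert_space H" and K: "hilbert_space K" and R: "cblinear R"
    and z: "\<And>a b u v. \<lbrakk>a \<in> A; b \<in> B; u \<in> H; v \<in> K\<rbrakk> \<Longrightarrow> R (a u \<otimes>\<^sub>v b v) = 0"
  shows "R (id_on H x \<otimes>\<^sub>v id_on K y) = 0"
proof -
  have "(R o\<^sub>L tensor_left (id_on H x)) (id_on K y) = 0"
  proof (rule nondegenerate_vanish[OF B K])
    fix b v assume b: "b \<in> B" "v \<in> K"
    have "(R o\<^sub>L tensor_right (b v)) (id_on H x) = 0"
      by (rule nondegenerate_vanish[OF A H]) (use R z b in simp_all)
    then show "(R o\<^sub>L tensor_left (id_on H x)) (b v) = 0" by simp
  qed (use R in simp)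
  then show ?thesis by simp
qed

subsection \<open>Extension of morphisms to multipliers\<close>

lemma blinfun_compose_assoc: "(R o\<^sub>L S) o\<^sub>L T = R o\<^sub>L (S o\<^sub>L T)"
  by (rule blinfun_eqI) simp

lemma blinfun_compose_reassoc: "S o\<^sub>L T = R \<Longrightarrow> S o\<^sub>L (T o\<^sub>L X) = R o\<^sub>L X"
  by (metis blinfun_compose_assoc)

lemma blinfun_compose_id [simp]: "id_blinfun o\<^sub>L T = T" "T o\<^sub>L id_blinfun = T"
  by (auto intro: blinfun_eqI)

lemma tensor_alg_subspace: "subspace (A \<otimes>\<^sub>a B)"
  by (simp add: tensor_alg_def subspace_closure)

lemma tensor_alg_base: "a \<in> A \<Longrightarrow> b \<in> B \<Longrightarrow> a \<otimes>\<^sub>o b \<in> A \<otimes>\<^sub>a B"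
  unfolding tensor_alg_def by (rule subsetD[OF closure_subset]) (auto intro: span_base)

lemma tensor_alg_induct:
  assumes t: "t \<in> A \<otimes>\<^sub>a B" and "subspace M" "closed M"
    and "\<And>a b. a \<in> A \<Longrightarrow> b \<in> B \<Longrightarrow> a \<otimes>\<^sub>o b \<in> M"
  shows "t \<in> M"
  using assms(2-) by (intro closure_span_induct[OF t[unfolded tensor_alg_def]]) auto

lemma cblinear_tensor_alg:
  assumes t: "t \<in> A \<otimes>\<^sub>a B" and A: "\<And>a. a \<in> A \<Longrightarrow> cblinear a" and B: "\<And>b. b \<in> B \<Longrightarrow> cblinear b"
  shows "cblinear t"
proof -
  have "t \<in> {t. cblinear t}"
    by (rule tensor_alg_induct[OF t _ closed_cblinear])
      (auto simp: subspace_def cblinear_def blinfun.add_left blinfun.scaleR_left scaleC_add_right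
        scaleC_of_real[symmetric] scaleC_scaleC mult.commute tensor_op_eq
        cblinearD[OF cblinear_tensor_map2, OF A B])
  then show ?thesis by simp
qed

text \<open>Generators span densely, so any continuous linear formula that is right on them computes
  \<open>tensor_map\<close>. The restriction appears because the description asks for an extensional
  function.\<close>

lemma tensor_map_eq:
  fixes A :: "'a::chilbert bop set" and B :: "'b::chilbert bop set"
  assumes cont: "continuous_on (A \<otimes>\<^sub>a B) \<Phi>"
    and add: "\<And>s t. s \<in> A \<otimes>\<^sub>a B \<Longrightarrow> t \<in> A \<otimes>\<^sub>a B \<Longrightarrow> \<Phi> (s + t) = \<Phi> s + \<Phi> t"
    and scale: "\<And>r t. t \<in> A \<otimes>\<^sub>a B \<Longrightarrow> \<Phi> (r *\<^sub>R t) = r *\<^sub>R \<Phi> t"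
    and base: "\<And>a b. a \<in> A \<Longrightarrow> b \<in> B \<Longrightarrow> \<Phi> (a \<otimes>\<^sub>o b) = f a \<otimes>\<^sub>o g b"
  shows "tensor_map A B f g = restrict \<Phi> (A \<otimes>\<^sub>a B)"
  unfolding tensor_map_def
proof (rule the_equality)
  let ?M = "A \<otimes>\<^sub>a B"
  have cl: "closed ?M" by (simp add: tensor_alg_def)
  show "restrict \<Phi> ?M \<in> extensional ?M \<and> continuous_on ?M (restrict \<Phi> ?M) \<and>
        (\<forall>s\<in>?M. \<forall>t\<in>?M. restrict \<Phi> ?M (s + t) = restrict \<Phi> ?M s + restrict \<Phi> ?M t) \<and>
        (\<forall>r. \<forall>t\<in>?M. restrict \<Phi> ?M (r *\<^sub>R t) = r *\<^sub>R restrict \<Phi> ?M t) \<and>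
        (\<forall>a\<in>A. \<forall>b\<in>B. restrict \<Phi> ?M (a \<otimes>\<^sub>o b) = f a \<otimes>\<^sub>o g b)"
    using cont add scale base tensor_alg_base[of _ A _ B]
      subspace_add[OF tensor_alg_subspace[of A B]] subspace_scale[OF tensor_alg_subspace[of A B]]
    by (auto cong: continuous_on_cong)
  fix F assume F: "F \<in> extensional ?M \<and> continuous_on ?M F \<and>
        (\<forall>s\<in>?M. \<forall>t\<in>?M. F (s + t) = F s + F t) \<and>
        (\<forall>r. \<forall>t\<in>?M. F (r *\<^sub>R t) = r *\<^sub>R F t) \<and>
        (\<forall>a\<in>A. \<forall>b\<in>B. F (a \<otimes>\<^sub>o b) = f a \<otimes>\<^sub>o g b)"
  have "F t = \<Phi> t" if t: "t \<in> ?M" for t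
  proof -
    have "t \<in> {t\<in>?M. F t = \<Phi> t}"
    proof (rule tensor_alg_induct[OF t])
      have "F 0 = \<Phi> 0"
        using F scale[of 0 0] subspace_0[OF tensor_alg_subspace[of A B]] by (metis scaleR_zero_left)
      then show "subspace {t\<in>?M. F t = \<Phi> t}"
        using F add scale tensor_alg_subspace[of A B] by (auto simp: subspace_def)
      \<comment> \<open>\<open>F\<close> is continuous on \<open>?M\<close> only, so the agreement
        set is closed as a preimage relative to the closed set \<open>?M\<close>.\<close>
      have "{t\<in>?M. F t = \<Phi> t} = ?M \<inter> (\<lambda>t. F t - \<Phi> t) -` {0}" by auto
      then show "closed {t\<in>?M. F t = \<Phi> t}"
        using F cont cl by (auto intro!: continuous_closed_preimage continuous_on_diff)
    qed (use F base tensor_alg_base in auto)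
    then show ?thesis by simp
  qed
  then show "F = restrict \<Phi> ?M"
    using F by (intro extensionalityI[of F ?M]) auto
qed

lemma scaleC_diff_right: "c *\<^sub>C (x - y) = c *\<^sub>C x - c *\<^sub>C (y::'a::chilbert)"
  using scaleC_add_right[of c "x - y" y] by (simp add: algebra_simps)

text \<open>
  Theta stands for an amplification by a trivial leg, U for a unitary that implements the
  comultiplication.  Conjugation by U is then defined on all operators, so the extension to
  multipliers can be read off.
\<close>

lemma extend_conjugation:
  fixes A :: "'a::chilbert bop set" and B :: "'b::chilbert bop set"
    and \<Theta> :: "('a, 'b) htensor bop \<Rightarrow> 'x::chilbert bop"
    and U :: "'x \<Rightarrow>\<^sub>L ('c::chilbert, 'd::chilbert) htensor" and U' :: "('c, 'd) htensor \<Rightarrow>\<^sub>L 'x"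
  assumes A: "\<And>a. a \<in> A \<Longrightarrow> cblinear a" and B: "\<And>b. b \<in> B \<Longrightarrow> cblinear b"
    and V: "V \<in> multipliers H (A \<otimes>\<^sub>a B)" and H: "hilbert_space H" and K: "hilbert_space K"
    and add: "\<And>s t. cblinear s \<Longrightarrow> cblinear t \<Longrightarrow> \<Theta> (s + t) = \<Theta> s + \<Theta> t"
    and scale: "\<And>r t. cblinear t \<Longrightarrow> \<Theta> (r *\<^sub>R t) = r *\<^sub>R \<Theta> t"
    and mult: "\<And>s t. cblinear s \<Longrightarrow> cblinear t \<Longrightarrow> \<Theta> (s o\<^sub>L t) = \<Theta> s o\<^sub>L \<Theta> t"
    and cb: "\<And>t. cblinear t \<Longrightarrow> cblinear (\<Theta> t)"
    and bd: "\<And>t. cblinear t \<Longrightarrow> norm (\<Theta> t) \<le> c * norm t"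
    and U: "cblinear U" "cblinear U'"
    and U'U: "\<Theta> (id_on H) o\<^sub>L U' o\<^sub>L U = \<Theta> (id_on H)" "U' o\<^sub>L U o\<^sub>L \<Theta> (id_on H) = \<Theta> (id_on H)"
    and UU': "U o\<^sub>L \<Theta> (id_on H) o\<^sub>L U' = id_on K"
    and base: "\<And>a b. a \<in> A \<Longrightarrow> b \<in> B \<Longrightarrow> U o\<^sub>L \<Theta> (a \<otimes>\<^sub>o b) o\<^sub>L U' = f a \<otimes>\<^sub>o g b"
    and nondeg: "\<And>R :: 'x \<Rightarrow>\<^sub>L ('c, 'd) htensor. \<lbrakk>cblinear R;
        \<And>a b. a \<in> A \<Longrightarrow> b \<in> B \<Longrightarrow> R o\<^sub>L \<Theta> (a \<otimes>\<^sub>o b) o\<^sub>L \<Theta> (id_on H) = 0\<rbrakk>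
        \<Longrightarrow> R o\<^sub>L \<Theta> (id_on H) = 0"
  shows "extend K (A \<otimes>\<^sub>a B) (tensor_map A B f g) V = U o\<^sub>L \<Theta> V o\<^sub>L U'"
proof -
  let ?M = "A \<otimes>\<^sub>a B" and ?E = "\<Theta> (id_on H)"
  let ?\<Phi> = "\<lambda>t. U o\<^sub>L \<Theta> t o\<^sub>L U'"
  have cM: "cblinear t" if "t \<in> ?M" for t using cblinear_tensor_alg[OF that A B] .
  have "V \<in> bounded_ops H" using V by (simp add: multipliers_def)
  then have V1: "cblinear V" "id_on H o\<^sub>L V = V" "V o\<^sub>L id_on H = V" using bounded_ops_iff[OF H] by auto
  then have \<Theta>V: "?E o\<^sub>L \<Theta> V = \<Theta> V" "\<Theta> V o\<^sub>L ?E = \<Theta> V"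
    using H by (simp_all add: mult[symmetric])
  have cT: "cblinear (?\<Phi> V)" using U V1 cb by simp
  have VM: "V o\<^sub>L t \<in> ?M" if "t \<in> ?M" for t using V that by (simp add: multipliers_def)
  have ts: "cblinear (s - t)" if "cblinear s" "cblinear t" for s t :: "('a, 'b) htensor bop"
    using that by (simp add: cblinear_def blinfun.diff_left scaleC_diff_right)
  have diff: "\<Theta> s - \<Theta> t = \<Theta> (s - t)" if "cblinear s" "cblinear t" for s t
    using add[OF ts[OF that] that(2)] by simp
  \<comment> \<open>Linearity and the bound for \<Theta> hold among complex-linear operators only,
    so continuity comes from a Lipschitz estimate on \<open>?M\<close>. The absolute value makes the
    constant nonnegative.\<close>
  have "\<bar>c\<bar>-lipschitz_on ?M \<Theta>"
  proof (rule lipschitz_onI)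
    fix s t assume "s \<in> ?M" "t \<in> ?M"
    then have c: "cblinear s" "cblinear t" using cM by auto
    have "norm (\<Theta> s - \<Theta> t) \<le> c * norm (s - t)" using bd[OF ts[OF c]] diff[OF c] by simp
    also have "\<dots> \<le> \<bar>c\<bar> * norm (s - t)" by (intro mult_right_mono) auto
    finally show "dist (\<Theta> s) (\<Theta> t) \<le> \<bar>c\<bar> * dist s t" by (simp add: dist_norm)
  qed simp
  then have "continuous_on ?M \<Theta>" by (rule lipschitz_on_continuous_on)
  then have cont: "continuous_on ?M ?\<Phi>"
    by (intro bounded_bilinear.continuous_on[OF bounded_bilinear_blinfun_compose] continuous_on_const)
  have tm: "tensor_map A B f g = restrict ?\<Phi> ?M"
  proof (rule tensor_map_eq[OF cont])
    show "?\<Phi> (s + t) = ?\<Phi> s + ?\<Phi> t" if "s \<in> ?M" "t \<in> ?M" for s t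
      using that cM by (simp add: add bounded_bilinear.add_left[OF bounded_bilinear_blinfun_compose]
          bounded_bilinear.add_right[OF bounded_bilinear_blinfun_compose])
    show "?\<Phi> (r *\<^sub>R t) = r *\<^sub>R ?\<Phi> t" if "t \<in> ?M" for r t
      using that cM by (simp add: scale bounded_bilinear.scaleR_left[OF bounded_bilinear_blinfun_compose]
          bounded_bilinear.scaleR_right[OF bounded_bilinear_blinfun_compose])
  qed (rule base)
  \<comment> \<open>\<Theta> V ends in \<open>?E\<close>, and \<open>?E\<close> absorbs the inner
    product of \<open>U'\<close> and \<open>U\<close>; this makes the conjugation
    multiplicative.\<close>
  have T\<Phi>: "?\<Phi> V o\<^sub>L ?\<Phi> t = ?\<Phi> (V o\<^sub>L t)" if "t \<in> ?M" for t
  proof -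
    have "?\<Phi> V o\<^sub>L ?\<Phi> t = U o\<^sub>L \<Theta> V o\<^sub>L (?E o\<^sub>L U' o\<^sub>L U) o\<^sub>L \<Theta> t o\<^sub>L U'"
      by (subst \<Theta>V(2)[symmetric]) (simp add: blinfun_compose_assoc)
    also have "\<dots> = U o\<^sub>L (\<Theta> V o\<^sub>L ?E) o\<^sub>L \<Theta> t o\<^sub>L U'"
      by (simp only: U'U) (simp add: blinfun_compose_assoc)
    also have "\<dots> = ?\<Phi> (V o\<^sub>L t)"
      using that cM V1 by (simp add: \<Theta>V mult blinfun_compose_assoc)
    finally show ?thesis .
  qed
  have "id_on K o\<^sub>L ?\<Phi> V = U o\<^sub>L (?E o\<^sub>L U' o\<^sub>L U) o\<^sub>L \<Theta> V o\<^sub>L U'"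
    by (simp only: UU'[symmetric] blinfun_compose_assoc)
  also have "\<dots> = U o\<^sub>L (?E o\<^sub>L \<Theta> V) o\<^sub>L U'"
    by (simp only: U'U) (simp add: blinfun_compose_assoc)
  finally have TK1: "id_on K o\<^sub>L ?\<Phi> V = ?\<Phi> V" by (simp only: \<Theta>V)
  have "?\<Phi> V o\<^sub>L id_on K = U o\<^sub>L \<Theta> V o\<^sub>L (U' o\<^sub>L U o\<^sub>L ?E) o\<^sub>L U'"
    by (simp only: UU'[symmetric] blinfun_compose_assoc)
  also have "\<dots> = U o\<^sub>L (\<Theta> V o\<^sub>L ?E) o\<^sub>L U'"
    by (simp only: U'U) (simp add: blinfun_compose_assoc)
  finally have TK2: "?\<Phi> V o\<^sub>L id_on K = ?\<Phi> V" by (simp only: \<Theta>V)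
  have TK: "?\<Phi> V \<in> bounded_ops K" using bounded_ops_iff[OF K] cT TK1 TK2 by blast
  show ?thesis
    unfolding extend_def tm
  proof (rule the_equality)
    show "?\<Phi> V \<in> bounded_ops K \<and> (\<forall>a\<in>?M. ?\<Phi> V o\<^sub>L restrict ?\<Phi> ?M a = restrict ?\<Phi> ?M (V o\<^sub>L a))"
      using TK T\<Phi> VM by simp
    fix T assume T: "T \<in> bounded_ops K \<and> (\<forall>a\<in>?M. T o\<^sub>L restrict ?\<Phi> ?M a = restrict ?\<Phi> ?M (V o\<^sub>L a))"
    \<comment> \<open>\<open>S\<close> annihilates every conjugated algebra element. Composing with
      \<open>U\<close> exposes \<Theta> (a \<otimes> b), which \<open>nondeg\<close> removes;
      composing with \<open>U'\<close> then leaves \<open>S\<close> times the unit on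
      \<open>K\<close>.\<close>
    define S where "S = T - ?\<Phi> V"
    have cS: "cblinear S"
      using T cT cblinear_bounded_ops[of T K]
      by (simp add: S_def cblinear_def blinfun.diff_left scaleC_diff_right)
    have S0: "S o\<^sub>L ?\<Phi> t = 0" if "t \<in> ?M" for t
      using that T T\<Phi> VM by (simp add: S_def bounded_bilinear.diff_left[OF bounded_bilinear_blinfun_compose])
    have "S o\<^sub>L U o\<^sub>L ?E = 0"
    proof (rule nondeg)
      fix a b assume "a \<in> A" "b \<in> B"
      then have "S o\<^sub>L ?\<Phi> (a \<otimes>\<^sub>o b) o\<^sub>L U o\<^sub>L ?E = 0" by (simp add: S0 tensor_alg_base)
      then have "S o\<^sub>L U o\<^sub>L \<Theta> (a \<otimes>\<^sub>o b) o\<^sub>L (U' o\<^sub>L U o\<^sub>L ?E) = 0" by (simp only: blinfun_compose_assoc)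
      then show "S o\<^sub>L U o\<^sub>L \<Theta> (a \<otimes>\<^sub>o b) o\<^sub>L ?E = 0" by (simp only: U'U)
    qed (use cS U in simp)
    then have "S o\<^sub>L (U o\<^sub>L ?E o\<^sub>L U') = 0" by (simp add: blinfun_compose_assoc[symmetric])
    then have "S o\<^sub>L id_on K = 0" by (simp only: UU')
    moreover have "S o\<^sub>L id_on K = S"
      using T TK bounded_ops_iff[OF K]
      by (simp add: S_def bounded_bilinear.diff_left[OF bounded_bilinear_blinfun_compose])
    ultimately show "T = ?\<Phi> V" by (simp add: S_def)
  qed
qed

subsection \<open>Legs as homomorphisms\<close>

lemma tensor_map2_add:
  assumes "cblinear S" "cblinear T" "cblinear T'"
  shows "S \<otimes>\<^sub>l (T + T') = S \<otimes>\<^sub>l T + S \<otimes>\<^sub>l T'" "(T + T') \<otimes>\<^sub>l S = T \<otimes>\<^sub>l S + T' \<otimes>\<^sub>l S"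
proof -
  have c: "cblinear (T + T')"
    using assms by (simp add: cblinear_def blinfun.add_left scaleC_add_right)
  show "S \<otimes>\<^sub>l (T + T') = S \<otimes>\<^sub>l T + S \<otimes>\<^sub>l T'"
    by (rule tensor_blinfun_eqI) (simp add: assms c blinfun.add_left tensor_add_right)
  show "(T + T') \<otimes>\<^sub>l S = T \<otimes>\<^sub>l S + T' \<otimes>\<^sub>l S"
    by (rule tensor_blinfun_eqI) (simp add: assms c blinfun.add_left tensor_add_left)
qed

lemma tensor_map2_scaleR:
  assumes "cblinear S" "cblinear T"
  shows "S \<otimes>\<^sub>l (r *\<^sub>R T) = r *\<^sub>R (S \<otimes>\<^sub>l T)" "(r *\<^sub>R T) \<otimes>\<^sub>l S = r *\<^sub>R (T \<otimes>\<^sub>l S)"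
proof -
  have c: "cblinear (r *\<^sub>R T)"
    using assms by (simp add: cblinear_def blinfun.scaleR_left scaleC_of_real[symmetric] scaleC_scaleC mult.commute)
  show "S \<otimes>\<^sub>l (r *\<^sub>R T) = r *\<^sub>R (S \<otimes>\<^sub>l T)"
    by (rule tensor_blinfun_eqI)
      (simp add: assms c blinfun.scaleR_left bounded_bilinear.scaleR_right[OF bounded_bilinear_tensor])
  show "(r *\<^sub>R T) \<otimes>\<^sub>l S = r *\<^sub>R (T \<otimes>\<^sub>l S)"
    by (rule tensor_blinfun_eqI)
      (simp add: assms c blinfun.scaleR_left bounded_bilinear.scaleR_left[OF bounded_bilinear_tensor])
qed

lemma cblinear_leg12 [simp]: "cblinear X \<Longrightarrow> hilbert_space L \<Longrightarrow> cblinear (leg12 X L)"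
  by (simp add: leg12_eq)

lemma cblinear_leg13 [simp]: "cblinear X \<Longrightarrow> hilbert_space L \<Longrightarrow> cblinear (leg13 L X)"
  by (simp add: leg13_eq)

lemma cblinear_leg23 [simp]: "cblinear X \<Longrightarrow> hilbert_space L \<Longrightarrow> cblinear (leg23 L X)"
  by (simp add: leg23_eq)

lemma leg12_compose:
  "\<lbrakk>cblinear S; cblinear T; hilbert_space L\<rbrakk> \<Longrightarrow> leg12 S L o\<^sub>L leg12 T L = leg12 (S o\<^sub>L T) L"
  by (simp add: leg12_eq tensor_map2_compose id_on_idem)

lemma leg13_compose:
  assumes "cblinear S" "cblinear T" "hilbert_space L"
  shows "leg13 L S o\<^sub>L leg13 L T = leg13 L (S o\<^sub>L T)"
proof -
  have "leg13 L S o\<^sub>L leg13 L T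
      = swap23 o\<^sub>L ((S \<otimes>\<^sub>l id_on L) o\<^sub>L (T \<otimes>\<^sub>l id_on L)) o\<^sub>L swap23"
    using assms by (simp add: leg13_eq blinfun_compose_assoc blinfun_compose_reassoc[OF swap23_swap23])
  then show ?thesis using assms by (simp add: leg13_eq tensor_map2_compose id_on_idem)
qed

lemma leg23_compose:
  assumes "cblinear S" "cblinear T" "hilbert_space L"
  shows "leg23 L S o\<^sub>L leg23 L T = leg23 L (S o\<^sub>L T)"
proof -
  have "leg23 L S o\<^sub>L leg23 L T
      = assoc_inv o\<^sub>L ((id_on L \<otimes>\<^sub>l S) o\<^sub>L (id_on L \<otimes>\<^sub>l T)) o\<^sub>L assoc"
    using assms
    by (simp add: leg23_eq blinfun_compose_assoc blinfun_compose_reassoc[OF assoc_compose(1)])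
  then show ?thesis using assms by (simp add: leg23_eq tensor_map2_compose id_on_idem)
qed

lemma leg_id_on:
  assumes "hilbert_space H" "hilbert_space K" "hilbert_space L"
  shows "leg12 (id_on H \<otimes>\<^sub>l id_on K) L = (id_on H \<otimes>\<^sub>l id_on K) \<otimes>\<^sub>l id_on L"
    and "leg13 K (id_on H \<otimes>\<^sub>l id_on L) = (id_on H \<otimes>\<^sub>l id_on K) \<otimes>\<^sub>l id_on L"
    and "leg23 H (id_on K \<otimes>\<^sub>l id_on L) = (id_on H \<otimes>\<^sub>l id_on K) \<otimes>\<^sub>l id_on L"
  by (auto intro!: tensor3_blinfun_eqI simp: leg12_eq leg13_eq leg23_eq assms)

text \<open>A unitary meeting its adjoint leaves a projection. These rules, with the two variants
  below, absorb it into neighbouring legs.\<close>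

lemma leg12_supported:
  assumes "X \<in> bounded_ops (H \<otimes>\<^sub>s K)" "hilbert_space H" "hilbert_space K" "hilbert_space L"
  shows "((id_on H \<otimes>\<^sub>l id_on K) \<otimes>\<^sub>l id_on L) o\<^sub>L leg12 X L = leg12 X L"
    and "leg12 X L o\<^sub>L ((id_on H \<otimes>\<^sub>l id_on K) \<otimes>\<^sub>l id_on L) = leg12 X L"
  using assms bounded_ops_iff[OF hilbert_space_tensor[of H K], of X]
  by (simp_all add: leg_id_on(1)[symmetric] leg12_compose)

lemma leg13_supported:
  assumes "X \<in> bounded_ops (H \<otimes>\<^sub>s L)" "hilbert_space H" "hilbert_space K" "hilbert_space L"
  shows "((id_on H \<otimes>\<^sub>l id_on K) \<otimes>\<^sub>l id_on L) o\<^sub>L leg13 K X = leg13 K X"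
    and "leg13 K X o\<^sub>L ((id_on H \<otimes>\<^sub>l id_on K) \<otimes>\<^sub>l id_on L) = leg13 K X"
  using assms bounded_ops_iff[OF hilbert_space_tensor[of H L], of X]
  by (simp_all add: leg_id_on(2)[symmetric] leg13_compose)

lemma leg23_supported:
  assumes "X \<in> bounded_ops (K \<otimes>\<^sub>s L)" "hilbert_space H" "hilbert_space K" "hilbert_space L"
  shows "((id_on H \<otimes>\<^sub>l id_on K) \<otimes>\<^sub>l id_on L) o\<^sub>L leg23 H X = leg23 H X"
    and "leg23 H X o\<^sub>L ((id_on H \<otimes>\<^sub>l id_on K) \<otimes>\<^sub>l id_on L) = leg23 H X"
  using assms bounded_ops_iff[OF hilbert_space_tensor[of K L], of X]
  by (simp_all add: leg_id_on(3)[symmetric] leg23_compose)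

lemma unitary_onD:
  assumes "unitary_on (H \<otimes>\<^sub>s K) W" and H: "hilbert_space H" and K: "hilbert_space K"
  shows "W \<in> bounded_ops (H \<otimes>\<^sub>s K)" "adj W \<in> bounded_ops (H \<otimes>\<^sub>s K)" "cblinear W" "cblinear (adj W)"
    and "adj W o\<^sub>L W = id_on H \<otimes>\<^sub>l id_on K" "W o\<^sub>L adj W = id_on H \<otimes>\<^sub>l id_on K"
    and "(id_on H \<otimes>\<^sub>l id_on K) o\<^sub>L W = W" "W o\<^sub>L (id_on H \<otimes>\<^sub>l id_on K) = W"
    and "(id_on H \<otimes>\<^sub>l id_on K) o\<^sub>L adj W = adj W" "adj W o\<^sub>L (id_on H \<otimes>\<^sub>l id_on K) = adj W"
proof -
  show "W \<in> bounded_ops (H \<otimes>\<^sub>s K)" "adj W o\<^sub>L W = id_on H \<otimes>\<^sub>l id_on K" "W o\<^sub>L adj W = id_on H \<otimes>\<^sub>l id_on K"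
    using assms by (simp_all add: unitary_on_def)
  moreover then show "adj W \<in> bounded_ops (H \<otimes>\<^sub>s K)" by (intro adj_bounded_ops) auto
  ultimately show "cblinear W" "cblinear (adj W)"
    "(id_on H \<otimes>\<^sub>l id_on K) o\<^sub>L W = W" "W o\<^sub>L (id_on H \<otimes>\<^sub>l id_on K) = W"
    "(id_on H \<otimes>\<^sub>l id_on K) o\<^sub>L adj W = adj W" "adj W o\<^sub>L (id_on H \<otimes>\<^sub>l id_on K) = adj W"
    using bounded_ops_iff[OF hilbert_space_tensor[of H K]] H K by simp_all
qed

lemma flip_compose [simp]: "flip o\<^sub>L flip = id_blinfun"
  by (rule blinfun_eqI) simp

subsection \<open>The comultiplications on multipliers\<close>

text \<open>The dual comultiplication conjugates 1 \<otimes> y by \<open>W\<close> and the flip, so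
  \<open>extend_conjugation\<close> applies with \<Theta> = \<open>leg23 H\<close> and with a
  \<open>U\<close> that is the identity on the third leg.\<close>

lemma comult_id_eq:
  fixes H :: "'h::chilbert set"
  assumes H: "hilbert_space H" "H \<noteq> {0}" and W: "unitary_on (H \<otimes>\<^sub>s H) W"
    and K: "hilbert_space (hspace A)"
    and A: "\<And>a. a \<in> alg A \<Longrightarrow> cblinear a" "nondegenerate (hspace A) (alg A)"
    and V: "V \<in> multipliers (H \<otimes>\<^sub>s hspace A) (alg (dual_qgroup_of H W) \<otimes>\<^sub>a alg A)"
  shows "comult_id (dual_qgroup_of H W) A V =
    ((flip o\<^sub>L adj W) \<otimes>\<^sub>l id_blinfun) o\<^sub>L leg23 H V o\<^sub>L ((W o\<^sub>L flip) \<otimes>\<^sub>l id_blinfun)"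
proof -
  let ?G = "dual_qgroup_of H W" and ?K = "hspace A" and ?P = "id_on H"
  let ?U = "((flip o\<^sub>L adj W) \<otimes>\<^sub>l (id_blinfun :: 'h bop))"
  let ?U' = "((W o\<^sub>L flip) \<otimes>\<^sub>l (id_blinfun :: 'h bop))"
  note Wf = unitary_onD[OF W H(1) H(1)]
  note WfR = Wf(5-10)[THEN blinfun_compose_reassoc] flip_compose[THEN blinfun_compose_reassoc]
  have PP: "(?P \<otimes>\<^sub>l ?P) o\<^sub>L (?P \<otimes>\<^sub>l ?P) = ?P \<otimes>\<^sub>l ?P" using H by (simp add: tensor_map2_compose id_on_idem)
  have E: "leg23 H (id_on (H \<otimes>\<^sub>s ?K)) = (?P \<otimes>\<^sub>l ?P) \<otimes>\<^sub>l id_on ?K"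
    using H K by (simp add: leg_id_on)
  have leg: "leg23 H (a \<otimes>\<^sub>o b) = (?P \<otimes>\<^sub>l a) \<otimes>\<^sub>l b" if "cblinear a" "cblinear b" for a b :: "'h bop"
    by (rule tensor3_blinfun_eqI) (simp add: leg23_eq tensor_op_eq that H)
  have sG: "hspace ?G = H" by (simp add: dual_qgroup_of_def Let_def)
  have aG: "cblinear a" if "a \<in> alg ?G" for a using cblinear_dual_qgroup_of[OF Wf(3) that] .
  have cG: "comult ?G a = flip o\<^sub>L adj W o\<^sub>L (?P \<otimes>\<^sub>l a) o\<^sub>L W o\<^sub>L flip" if "a \<in> alg ?G" for a
    using that by (simp add: dual_qgroup_of_def Let_def tensor_op_eq)
  have fPf: "flip o\<^sub>L ((?P \<otimes>\<^sub>l ?P) o\<^sub>L flip) = ?P \<otimes>\<^sub>l ?P"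
    by (rule tensor_blinfun_eqI) (simp add: H)
  \<comment> \<open>The constant c collects the norms of the two rebracketings, of the unit on the
    first leg and of the flips in \<open>norm_tensor_map2\<close>.\<close>
  show ?thesis
    unfolding comult_id_def sG
  proof (rule extend_conjugation[OF aG A(1) V, where c =
        "norm (assoc_inv :: ('h, ('h, 'h) htensor) htensor \<Rightarrow>\<^sub>L _) *
          (norm (flip :: (('h, 'h) htensor, 'h) htensor \<Rightarrow>\<^sub>L _) * norm ?P
          * norm (flip :: ('h, ('h, 'h) htensor) htensor \<Rightarrow>\<^sub>L _))
          * norm (assoc :: (('h, 'h) htensor, 'h) htensor \<Rightarrow>\<^sub>L _)"])
    fix s t :: "('h, 'h) htensor bop" and r :: real
    assume t: "cblinear t"
    show "leg23 H (r *\<^sub>R t) = r *\<^sub>R leg23 H t"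
      using t H by (simp add: leg23_eq tensor_map2_scaleR
          bounded_bilinear.scaleR_left[OF bounded_bilinear_blinfun_compose]
          bounded_bilinear.scaleR_right[OF bounded_bilinear_blinfun_compose])
    show "cblinear (leg23 H t)" using t H by simp
    show "norm (leg23 H t) \<le> norm (assoc_inv :: ('h, ('h, 'h) htensor) htensor \<Rightarrow>\<^sub>L _) *
          (norm (flip :: (('h, 'h) htensor, 'h) htensor \<Rightarrow>\<^sub>L _) * norm ?P
          * norm (flip :: ('h, ('h, 'h) htensor) htensor \<Rightarrow>\<^sub>L _))
          * norm (assoc :: (('h, 'h) htensor, 'h) htensor \<Rightarrow>\<^sub>L _) * norm t"
    proof -
      have "norm (leg23 H t) \<le> norm (assoc_inv :: ('h, ('h, 'h) htensor) htensor \<Rightarrow>\<^sub>L _) *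
          norm (?P \<otimes>\<^sub>l t) * norm (assoc :: (('h, 'h) htensor, 'h) htensor \<Rightarrow>\<^sub>L _)"
        unfolding leg23_eq
        by (intro order_trans[OF norm_blinfun_compose] mult_right_mono norm_blinfun_compose norm_ge_zero)
      also have "\<dots> \<le> norm (assoc_inv :: ('h, ('h, 'h) htensor) htensor \<Rightarrow>\<^sub>L _) *
          (norm (flip :: (('h, 'h) htensor, 'h) htensor \<Rightarrow>\<^sub>L _) * norm ?P
          * norm (flip :: ('h, ('h, 'h) htensor) htensor \<Rightarrow>\<^sub>L _) * norm t)
          * norm (assoc :: (('h, 'h) htensor, 'h) htensor \<Rightarrow>\<^sub>L _)"
        using t H by (intro mult_right_mono mult_left_mono norm_tensor_map2 norm_ge_zero) auto
      finally show ?thesis by (simp add: mult_ac)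
    qed
    assume s: "cblinear s"
    show "leg23 H (s + t) = leg23 H s + leg23 H t"
      using s t H by (simp add: leg23_eq tensor_map2_add
          bounded_bilinear.add_left[OF bounded_bilinear_blinfun_compose]
          bounded_bilinear.add_right[OF bounded_bilinear_blinfun_compose])
    show "leg23 H (s o\<^sub>L t) = leg23 H s o\<^sub>L leg23 H t" using s t H by (simp add: leg23_compose)
  next
    show "leg23 H (id_on (H \<otimes>\<^sub>s ?K)) o\<^sub>L ?U' o\<^sub>L ?U = leg23 H (id_on (H \<otimes>\<^sub>s ?K))"
      "?U' o\<^sub>L ?U o\<^sub>L leg23 H (id_on (H \<otimes>\<^sub>s ?K)) = leg23 H (id_on (H \<otimes>\<^sub>s ?K))"
      "?U o\<^sub>L leg23 H (id_on (H \<otimes>\<^sub>s ?K)) o\<^sub>L ?U' = id_on ((H \<otimes>\<^sub>s H) \<otimes>\<^sub>s ?K)"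
      unfolding E using H K Wf
      by (simp_all add: tensor_map2_compose blinfun_compose_assoc WfR PP fPf)
    show "?U o\<^sub>L leg23 H (a \<otimes>\<^sub>o b) o\<^sub>L ?U' = comult ?G a \<otimes>\<^sub>o b" if "a \<in> alg ?G" "b \<in> alg A" for a b
      using H Wf aG[OF that(1)] A(1)[OF that(2)]
      by (simp add: leg[unfolded tensor_op_eq] cG[OF that(1)] tensor_op_eq tensor_map2_compose blinfun_compose_assoc)
    fix R :: "(('h, 'h) htensor, 'h) htensor bop"
    assume R: "cblinear R"
      and R0: "\<And>a b. \<lbrakk>a \<in> alg ?G; b \<in> alg A\<rbrakk> \<Longrightarrow>
        R o\<^sub>L leg23 H (a \<otimes>\<^sub>o b) o\<^sub>L leg23 H (id_on (H \<otimes>\<^sub>s ?K)) = 0"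
    show "R o\<^sub>L leg23 H (id_on (H \<otimes>\<^sub>s ?K)) = 0"
    proof (rule tensor3_blinfun_eqI)
      fix x y z
      \<comment> \<open>The first leg is a spectator. Once its projected vector is fixed, the
        hypothesis concerns legs 2 and 3, where both algebras are nondegenerate.\<close>
      have "(R o\<^sub>L assoc_inv o\<^sub>L tensor_left (?P x)) (?P y \<otimes>\<^sub>v id_on ?K z) = 0"
      proof (rule nondegenerate_tensor_vanish[OF nondegenerate_dual_qgroup_of[OF H W] A(2) H(1) K])
        fix a b u v assume ab: "a \<in> alg ?G" "b \<in> alg A" "u \<in> H" "v \<in> ?K"
        have "(R o\<^sub>L leg23 H (a \<otimes>\<^sub>o b) o\<^sub>L leg23 H (id_on (H \<otimes>\<^sub>s ?K))) ((x \<otimes>\<^sub>v u) \<otimes>\<^sub>v v) = 0"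
          using R0[OF ab(1,2)] by simp
        then show "(R o\<^sub>L assoc_inv o\<^sub>L tensor_left (?P x)) (a u \<otimes>\<^sub>v b v) = 0"
          unfolding E using ab H K aG[OF ab(1)] A(1)[OF ab(2)]
          by (simp add: leg id_on_apply id_on_mem)
      qed (use R in simp)
      then show "(R o\<^sub>L leg23 H (id_on (H \<otimes>\<^sub>s ?K))) ((x \<otimes>\<^sub>v y) \<otimes>\<^sub>v z) = blinfun_apply 0 ((x \<otimes>\<^sub>v y) \<otimes>\<^sub>v z)"
        unfolding E using H K by simp
    qed
  qed (use H K Wf in simp_all)
qed

text \<open>The comultiplication conjugates b \<otimes> 1 by \<open>W\<close> on the last two legs.
  Hence \<Theta> amplifies by \<open>leg12\<close>, and \<open>U\<close> rebrackets to the right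
  before applying \<open>W\<close>; the outer associators of \<open>id_comult\<close> restore the
  left bracketing.\<close>

lemma id_comult_eq:
  fixes K :: "'h::chilbert set"
  assumes K: "hilbert_space K" "K \<noteq> {0}" and W: "unitary_on (K \<otimes>\<^sub>s K) W"
    and H: "hilbert_space (hspace G)"
    and G: "\<And>a. a \<in> alg G \<Longrightarrow> cblinear a" "nondegenerate (hspace G) (alg G)"
    and V: "V \<in> multipliers (hspace G \<otimes>\<^sub>s K) (alg G \<otimes>\<^sub>a alg (qgroup_of K W))"
  shows "id_comult G (qgroup_of K W) V =
    assoc_inv o\<^sub>L ((id_blinfun \<otimes>\<^sub>l W) o\<^sub>L assoc o\<^sub>L leg12 V K o\<^sub>L (assoc_inv o\<^sub>L (id_blinfun \<otimes>\<^sub>l adj W))) o\<^sub>L assoc"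
proof -
  let ?A = "qgroup_of K W" and ?H = "hspace G" and ?P = "id_on K" and ?Q = "id_on (hspace G)"
  let ?U = "((id_blinfun :: 'h bop) \<otimes>\<^sub>l W) o\<^sub>L assoc"
  let ?U' = "assoc_inv o\<^sub>L ((id_blinfun :: 'h bop) \<otimes>\<^sub>l adj W)"
  note Wf = unitary_onD[OF W K(1) K(1)]
  have PP: "(?P \<otimes>\<^sub>l ?P) o\<^sub>L (?P \<otimes>\<^sub>l ?P) = ?P \<otimes>\<^sub>l ?P" using K by (simp add: tensor_map2_compose id_on_idem)
  have E: "leg12 (id_on (?H \<otimes>\<^sub>s K)) K = (?Q \<otimes>\<^sub>l ?P) \<otimes>\<^sub>l ?P"
    using H K by (simp add: leg_id_on)
  have leg: "assoc o\<^sub>L leg12 (a \<otimes>\<^sub>o b) K o\<^sub>L assoc_inv = a \<otimes>\<^sub>l (b \<otimes>\<^sub>l ?P)"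
    if "cblinear a" "cblinear b" for a b :: "'h bop"
    by (rule tensor3'_blinfun_eqI) (simp add: leg12_eq tensor_op_eq that K)
  have EE: "(?Q \<otimes>\<^sub>l ?P) \<otimes>\<^sub>l ?P = assoc_inv o\<^sub>L (?Q \<otimes>\<^sub>l (?P \<otimes>\<^sub>l ?P)) o\<^sub>L assoc"
    by (rule tensor3_blinfun_eqI) (simp add: H K)
  have EE': "assoc o\<^sub>L (((?Q \<otimes>\<^sub>l ?P) \<otimes>\<^sub>l ?P) o\<^sub>L assoc_inv) = ?Q \<otimes>\<^sub>l (?P \<otimes>\<^sub>l ?P)"
    by (rule tensor3'_blinfun_eqI) (simp add: H K)
  have sA: "hspace ?A = K" by (simp add: qgroup_of_def Let_def)
  have aA: "cblinear a" if "a \<in> alg ?A" for a using cblinear_qgroup_of[OF Wf(3) that] .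
  have cA: "comult ?A a = W o\<^sub>L (a \<otimes>\<^sub>l ?P) o\<^sub>L adj W" if "a \<in> alg ?A" for a
    using that by (simp add: qgroup_of_def Let_def tensor_op_eq)
  have U'U: "?U' o\<^sub>L ?U = assoc_inv o\<^sub>L (id_blinfun \<otimes>\<^sub>l (?P \<otimes>\<^sub>l ?P)) o\<^sub>L assoc"
    by (simp add: blinfun_compose_assoc Wf
        tensor_map2_compose[of "id_blinfun :: 'h bop" "adj W" "id_blinfun :: 'h bop" W,
          THEN blinfun_compose_reassoc])
  have idem: "?P (?P x) = ?P x" for x using id_on_idem[OF K(1)] by (metis blinfun_apply_blinfun_compose)
  have "extend (?H \<otimes>\<^sub>s (K \<otimes>\<^sub>s K)) (alg G \<otimes>\<^sub>a alg ?A) (tensor_map (alg G) (alg ?A) (\<lambda>a. a) (comult ?A)) V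
      = ?U o\<^sub>L leg12 V K o\<^sub>L ?U'"
  proof (rule extend_conjugation[OF G(1) aA V, where c =
        "norm (flip :: ('h, ('h, 'h) htensor) htensor \<Rightarrow>\<^sub>L _)
          * norm (flip :: (('h, 'h) htensor, 'h) htensor \<Rightarrow>\<^sub>L _) * norm ?P"])
    fix s t :: "('h, 'h) htensor bop" and r :: real
    assume t: "cblinear t"
    show "leg12 (r *\<^sub>R t) K = r *\<^sub>R leg12 t K" using t K by (simp add: leg12_eq tensor_map2_scaleR)
    show "cblinear (leg12 t K)" using t K by simp
    show "norm (leg12 t K) \<le> norm (flip :: ('h, ('h, 'h) htensor) htensor \<Rightarrow>\<^sub>L _)
          * norm (flip :: (('h, 'h) htensor, 'h) htensor \<Rightarrow>\<^sub>L _) * norm ?P * norm t"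
      using norm_tensor_map2[OF t cblinear_id_on[OF K(1)]] by (simp add: leg12_eq mult_ac)
    assume s: "cblinear s"
    show "leg12 (s + t) K = leg12 s K + leg12 t K" using s t K by (simp add: leg12_eq tensor_map2_add)
    show "leg12 (s o\<^sub>L t) K = leg12 s K o\<^sub>L leg12 t K" using s t K by (simp add: leg12_compose)
  next
    show "leg12 (id_on (?H \<otimes>\<^sub>s K)) K o\<^sub>L ?U' o\<^sub>L ?U = leg12 (id_on (?H \<otimes>\<^sub>s K)) K"
      unfolding E blinfun_compose_assoc[of _ ?U' ?U] U'U
      by (rule tensor3_blinfun_eqI) (simp add: H K idem)
    show "?U' o\<^sub>L ?U o\<^sub>L leg12 (id_on (?H \<otimes>\<^sub>s K)) K = leg12 (id_on (?H \<otimes>\<^sub>s K)) K"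
      unfolding E U'U
      by (rule tensor3_blinfun_eqI) (simp add: H K idem)
    have "?U o\<^sub>L leg12 (id_on (?H \<otimes>\<^sub>s K)) K o\<^sub>L ?U'
        = (id_blinfun \<otimes>\<^sub>l W) o\<^sub>L (assoc o\<^sub>L (((?Q \<otimes>\<^sub>l ?P) \<otimes>\<^sub>l ?P) o\<^sub>L assoc_inv)) o\<^sub>L (id_blinfun \<otimes>\<^sub>l adj W)"
      unfolding E by (simp only: blinfun_compose_assoc)
    also have "\<dots> = id_on (?H \<otimes>\<^sub>s (K \<otimes>\<^sub>s K))"
      unfolding EE' using H K Wf by (simp add: tensor_map2_compose)
    finally show "?U o\<^sub>L leg12 (id_on (?H \<otimes>\<^sub>s K)) K o\<^sub>L ?U' = id_on (?H \<otimes>\<^sub>s (K \<otimes>\<^sub>s K))" .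
    show "?U o\<^sub>L leg12 (a \<otimes>\<^sub>o b) K o\<^sub>L ?U' = a \<otimes>\<^sub>o comult ?A b" if "a \<in> alg G" "b \<in> alg ?A" for a b
    proof -
      have "?U o\<^sub>L leg12 (a \<otimes>\<^sub>o b) K o\<^sub>L ?U'
          = (id_blinfun \<otimes>\<^sub>l W) o\<^sub>L (assoc o\<^sub>L leg12 (a \<otimes>\<^sub>o b) K o\<^sub>L assoc_inv) o\<^sub>L (id_blinfun \<otimes>\<^sub>l adj W)"
        by (simp only: blinfun_compose_assoc)
      also have "\<dots> = a \<otimes>\<^sub>o comult ?A b"
        unfolding leg[OF G(1)[OF that(1)] aA[OF that(2)]]
        using K Wf G(1)[OF that(1)] aA[OF that(2)]
        by (simp add: cA[OF that(2)] tensor_op_eq tensor_map2_compose)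
      finally show ?thesis .
    qed
    fix R :: "(('h, 'h) htensor, 'h) htensor \<Rightarrow>\<^sub>L ('h, ('h, 'h) htensor) htensor"
    assume R: "cblinear R"
      and R0: "\<And>a b. \<lbrakk>a \<in> alg G; b \<in> alg ?A\<rbrakk> \<Longrightarrow>
        R o\<^sub>L leg12 (a \<otimes>\<^sub>o b) K o\<^sub>L leg12 (id_on (?H \<otimes>\<^sub>s K)) K = 0"
    show "R o\<^sub>L leg12 (id_on (?H \<otimes>\<^sub>s K)) K = 0"
    proof (rule tensor3_blinfun_eqI)
      fix x y z
      have "(R o\<^sub>L tensor_right (?P z)) (?Q x \<otimes>\<^sub>v ?P y) = 0"
      proof (rule nondegenerate_tensor_vanish[OF G(2) nondegenerate_qgroup_of[OF K W] H K(1)])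
        fix a b u v assume ab: "a \<in> alg G" "b \<in> alg ?A" "u \<in> ?H" "v \<in> K"
        have "(R o\<^sub>L leg12 (a \<otimes>\<^sub>o b) K o\<^sub>L leg12 (id_on (?H \<otimes>\<^sub>s K)) K) ((u \<otimes>\<^sub>v v) \<otimes>\<^sub>v z) = 0"
          using R0[OF ab(1,2)] by simp
        then show "(R o\<^sub>L tensor_right (?P z)) (a u \<otimes>\<^sub>v b v) = 0"
          unfolding E using ab H K G(1)[OF ab(1)] aA[OF ab(2)]
          by (simp add: leg12_eq tensor_op_eq id_on_apply id_on_mem)
      qed (use R in simp)
      then show "(R o\<^sub>L leg12 (id_on (?H \<otimes>\<^sub>s K)) K) ((x \<otimes>\<^sub>v y) \<otimes>\<^sub>v z) = blinfun_apply 0 ((x \<otimes>\<^sub>v y) \<otimes>\<^sub>v z)"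
        unfolding E using H K by simp
    qed
  qed (use H K Wf in simp_all)
  then show ?thesis by (simp only: id_comult_def sA)
qed

subsection \<open>Bicharacters as relations between unitaries\<close>

lemma flip_leg23:
  fixes X :: "('a::chilbert, 'b::chilbert) htensor bop" and H :: "'c::chilbert set"
  assumes X: "cblinear X" and H: "hilbert_space H"
  shows "(flip \<otimes>\<^sub>l id_blinfun) o\<^sub>L leg23 H X o\<^sub>L (flip \<otimes>\<^sub>l id_blinfun) = leg13 H X"
proof (rule tensor3_blinfun_eqI)
  fix x y z
  \<comment> \<open>\<open>X\<close> may send a simple tensor to a vector that is not simple, so the
    rearrangement is proved for a general s by density.\<close>
  have "(flip \<otimes>\<^sub>l id_blinfun) (assoc_inv (q \<otimes>\<^sub>v s)) = swap23 (s \<otimes>\<^sub>v q)" for q :: 'c and s :: "('a, 'b) htensor"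
    by (rule tensor_eqI[where t=s]) (intro tensor_bounded_linear | simp)+
  then show "((flip \<otimes>\<^sub>l id_blinfun) o\<^sub>L leg23 H X o\<^sub>L (flip \<otimes>\<^sub>l id_blinfun)) ((x \<otimes>\<^sub>v y) \<otimes>\<^sub>v z)
      = leg13 H X ((x \<otimes>\<^sub>v y) \<otimes>\<^sub>v z)"
    by (simp add: leg23_eq leg13_eq X H)
qed

text \<open>Conjugation by the involution \<open>F\<close> exchanges \<open>x\<close> and
  \<open>y\<close>, so the left equation says w' x w = y x; multiplying by \<open>w\<close> gives
  the right one. \<open>E\<close> is the unit that the products of \<open>w\<close> and
  \<open>w'\<close> leave behind.\<close>

lemma flip_conjugate_iff:
  fixes F w w' x y E :: "'a::chilbert bop"
  assumes F: "F o\<^sub>L F = id_blinfun" and y: "F o\<^sub>L x o\<^sub>L F = y"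
    and w: "w o\<^sub>L w' = E" "w' o\<^sub>L w = E" and E: "E o\<^sub>L x = x" "E o\<^sub>L y = y"
  shows "F o\<^sub>L w' o\<^sub>L x o\<^sub>L w o\<^sub>L F = x o\<^sub>L y \<longleftrightarrow> x o\<^sub>L w = w o\<^sub>L y o\<^sub>L x"
proof
  note R = blinfun_compose_assoc F F[THEN blinfun_compose_reassoc] w[THEN blinfun_compose_reassoc]
    E E[THEN blinfun_compose_reassoc]
  assume "F o\<^sub>L w' o\<^sub>L x o\<^sub>L w o\<^sub>L F = x o\<^sub>L y"
  then have "w o\<^sub>L (F o\<^sub>L (F o\<^sub>L w' o\<^sub>L x o\<^sub>L w o\<^sub>L F) o\<^sub>L F) = w o\<^sub>L (F o\<^sub>L (x o\<^sub>L y) o\<^sub>L F)" by simp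
  then have "x o\<^sub>L w = w o\<^sub>L (F o\<^sub>L (x o\<^sub>L y) o\<^sub>L F)" by (simp add: R)
  also have "\<dots> = w o\<^sub>L y o\<^sub>L x" unfolding y[symmetric] by (simp add: R)
  finally show "x o\<^sub>L w = w o\<^sub>L y o\<^sub>L x" .
next
  note R = blinfun_compose_assoc F F[THEN blinfun_compose_reassoc] w[THEN blinfun_compose_reassoc]
    E E[THEN blinfun_compose_reassoc]
  assume "x o\<^sub>L w = w o\<^sub>L y o\<^sub>L x"
  then have "F o\<^sub>L w' o\<^sub>L x o\<^sub>L w o\<^sub>L F = F o\<^sub>L w' o\<^sub>L (w o\<^sub>L y o\<^sub>L x) o\<^sub>L F"
    by (simp add: blinfun_compose_assoc)
  also have "\<dots> = F o\<^sub>L y o\<^sub>L x o\<^sub>L F" by (simp add: R)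
  also have "\<dots> = x o\<^sub>L y" unfolding y[symmetric] by (simp add: R)
  finally show "F o\<^sub>L w' o\<^sub>L x o\<^sub>L w o\<^sub>L F = x o\<^sub>L y" .
qed

text \<open>This is \<open>flip_conjugate_iff\<close> with x = V23, y = V13, w = W12 and the flip of
  the first two legs.\<close>

lemma comult_id_iff:
  fixes H :: "'h::chilbert set"
  assumes H: "hilbert_space H" "H \<noteq> {0}" and W: "unitary_on (H \<otimes>\<^sub>s H) W"
    and K: "hilbert_space (hspace A)"
    and A: "\<And>a. a \<in> alg A \<Longrightarrow> cblinear a" "nondegenerate (hspace A) (alg A)"
    and V: "V \<in> multipliers (H \<otimes>\<^sub>s hspace A) (alg (dual_qgroup_of H W) \<otimes>\<^sub>a alg A)"
  shows "comult_id (dual_qgroup_of H W) A V = leg23 H V o\<^sub>L leg13 H V \<longleftrightarrow>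
    leg23 H V o\<^sub>L leg12 W (hspace A) = leg12 W (hspace A) o\<^sub>L leg13 H V o\<^sub>L leg23 H V"
proof -
  let ?K = "hspace A" and ?P = "id_on H"
  let ?F = "flip \<otimes>\<^sub>l (id_blinfun :: 'h bop)" and ?E = "(?P \<otimes>\<^sub>l ?P) \<otimes>\<^sub>l id_on ?K"
  let ?x = "leg23 H V" and ?w = "leg12 W ?K" and ?w' = "leg12 (adj W) ?K"
  note Wf = unitary_onD[OF W H(1) H(1)]
  have V1: "V \<in> bounded_ops (H \<otimes>\<^sub>s ?K)" using V by (simp add: multipliers_def)
  then have Vc: "cblinear V" by (rule cblinear_bounded_ops)
  note sup = leg23_supported[OF V1 H(1) H(1) K]
  have 1: "((flip o\<^sub>L adj W) \<otimes>\<^sub>l id_blinfun) o\<^sub>L ?E = ?F o\<^sub>L ?w'"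
    using H K Wf by (simp add: leg12_eq tensor_map2_compose blinfun_compose_assoc)
  have 2: "?E o\<^sub>L ((W o\<^sub>L flip) \<otimes>\<^sub>l id_blinfun) = ?w o\<^sub>L ?F"
    using H K Wf by (simp add: leg12_eq tensor_map2_compose blinfun_compose_assoc[symmetric])
  have 0: "comult_id (dual_qgroup_of H W) A V =
      ((flip o\<^sub>L adj W) \<otimes>\<^sub>l id_blinfun) o\<^sub>L ?x o\<^sub>L ((W o\<^sub>L flip) \<otimes>\<^sub>l id_blinfun)"
    by (rule comult_id_eq[OF H W K _ A(2) V]) (rule A(1))
  \<comment> \<open>V23 absorbs \<open>?E\<close> on both sides, so \<open>?E\<close> can be
    inserted. It replaces the identity on the third leg by \<open>id_on ?K\<close>, and the outer
    factors become legs of \<open>W\<close> and \<open>adj W\<close>.\<close>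
  have "comult_id (dual_qgroup_of H W) A V =
      ((flip o\<^sub>L adj W) \<otimes>\<^sub>l id_blinfun) o\<^sub>L (?E o\<^sub>L ?x o\<^sub>L ?E) o\<^sub>L ((W o\<^sub>L flip) \<otimes>\<^sub>l id_blinfun)"
    unfolding 0 sup by (simp only: blinfun_compose_assoc)
  also have "\<dots> = (((flip o\<^sub>L adj W) \<otimes>\<^sub>l id_blinfun) o\<^sub>L ?E) o\<^sub>L ?x
      o\<^sub>L (?E o\<^sub>L ((W o\<^sub>L flip) \<otimes>\<^sub>l id_blinfun))"
    by (simp only: blinfun_compose_assoc)
  also have "\<dots> = ?F o\<^sub>L ?w' o\<^sub>L ?x o\<^sub>L ?w o\<^sub>L ?F"
    unfolding 1 2 by (simp only: blinfun_compose_assoc)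
  finally have eq: "comult_id (dual_qgroup_of H W) A V = ?F o\<^sub>L ?w' o\<^sub>L ?x o\<^sub>L ?w o\<^sub>L ?F" .
  show ?thesis
    unfolding eq
  proof (rule flip_conjugate_iff)
    show "?F o\<^sub>L ?F = id_blinfun" by (rule tensor3_blinfun_eqI) simp
    show "?F o\<^sub>L ?x o\<^sub>L ?F = leg13 H V" by (rule flip_leg23[OF Vc H(1)])
    show "?w o\<^sub>L ?w' = ?E" "?w' o\<^sub>L ?w = ?E"
      using H K Wf by (simp_all add: leg12_compose leg_id_on)
    show "?E o\<^sub>L ?x = ?x" "?E o\<^sub>L leg13 H V = leg13 H V"
      using sup leg13_supported[OF V1 H(1) H(1) K] by auto
  qed
qed

text \<open>No flip occurs here: \<open>id_comult\<close> is conjugation of V12 by W23, and the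
  relation arises on multiplying by W23 from the right, the converse on multiplying by its
  adjoint.\<close>

lemma id_comult_iff:
  fixes K :: "'h::chilbert set"
  assumes K: "hilbert_space K" "K \<noteq> {0}" and W: "unitary_on (K \<otimes>\<^sub>s K) W"
    and H: "hilbert_space (hspace G)"
    and G: "\<And>a. a \<in> alg G \<Longrightarrow> cblinear a" "nondegenerate (hspace G) (alg G)"
    and V: "V \<in> multipliers (hspace G \<otimes>\<^sub>s K) (alg G \<otimes>\<^sub>a alg (qgroup_of K W))"
  shows "id_comult G (qgroup_of K W) V = leg12 V K o\<^sub>L leg13 K V \<longleftrightarrow>
    leg23 (hspace G) W o\<^sub>L leg12 V K = leg12 V K o\<^sub>L leg13 K V o\<^sub>L leg23 (hspace G) W"
proof -
  let ?H = "hspace G" and ?P = "id_on K" and ?Q = "id_on (hspace G)"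
  let ?E = "(?Q \<otimes>\<^sub>l ?P) \<otimes>\<^sub>l ?P"
  let ?v = "leg12 V K" and ?u = "leg23 ?H W" and ?u' = "leg23 ?H (adj W)" and ?y = "leg13 K V"
  note Wf = unitary_onD[OF W K(1) K(1)]
  have V1: "V \<in> bounded_ops (?H \<otimes>\<^sub>s K)" using V by (simp add: multipliers_def)
  note sup = leg12_supported[OF V1 H K(1) K(1)] leg13_supported[OF V1 H K(1) K(1)]
  have E: "?E = assoc_inv o\<^sub>L (?Q \<otimes>\<^sub>l (?P \<otimes>\<^sub>l ?P)) o\<^sub>L assoc"
    by (rule tensor3_blinfun_eqI) (simp add: H K)
  have 1: "assoc_inv o\<^sub>L (id_blinfun \<otimes>\<^sub>l W) o\<^sub>L assoc o\<^sub>L ?E = ?u"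
  proof -
    have "assoc_inv o\<^sub>L (id_blinfun \<otimes>\<^sub>l W) o\<^sub>L assoc o\<^sub>L ?E
        = assoc_inv o\<^sub>L ((id_blinfun \<otimes>\<^sub>l W) o\<^sub>L (?Q \<otimes>\<^sub>l (?P \<otimes>\<^sub>l ?P))) o\<^sub>L assoc"
      unfolding E by (simp add: blinfun_compose_assoc blinfun_compose_reassoc[OF assoc_compose(1)])
    then show ?thesis using H K Wf by (simp add: leg23_eq tensor_map2_compose)
  qed
  have 2: "?E o\<^sub>L assoc_inv o\<^sub>L (id_blinfun \<otimes>\<^sub>l adj W) o\<^sub>L assoc = ?u'"
  proof -
    have "?E o\<^sub>L assoc_inv o\<^sub>L (id_blinfun \<otimes>\<^sub>l adj W) o\<^sub>L assoc
        = assoc_inv o\<^sub>L ((?Q \<otimes>\<^sub>l (?P \<otimes>\<^sub>l ?P)) o\<^sub>L (id_blinfun \<otimes>\<^sub>l adj W)) o\<^sub>L assoc"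
      unfolding E by (simp add: blinfun_compose_assoc blinfun_compose_reassoc[OF assoc_compose(1)])
    then show ?thesis using H K Wf by (simp add: leg23_eq tensor_map2_compose)
  qed
  have uu: "?u o\<^sub>L ?u' = ?E" "?u' o\<^sub>L ?u = ?E"
    using H K Wf by (simp_all add: leg23_compose leg_id_on)
  have 0: "id_comult G (qgroup_of K W) V =
      assoc_inv o\<^sub>L ((id_blinfun \<otimes>\<^sub>l W) o\<^sub>L assoc o\<^sub>L ?v
        o\<^sub>L (assoc_inv o\<^sub>L (id_blinfun \<otimes>\<^sub>l adj W))) o\<^sub>L assoc"
    by (rule id_comult_eq[OF K W H _ G(2) V]) (rule G(1))
  have "id_comult G (qgroup_of K W) V =
      assoc_inv o\<^sub>L ((id_blinfun \<otimes>\<^sub>l W) o\<^sub>L assoc o\<^sub>L (?E o\<^sub>L ?v o\<^sub>L ?E)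
        o\<^sub>L (assoc_inv o\<^sub>L (id_blinfun \<otimes>\<^sub>l adj W))) o\<^sub>L assoc"
    unfolding 0 sup by (rule refl)
  also have "\<dots> = (assoc_inv o\<^sub>L (id_blinfun \<otimes>\<^sub>l W) o\<^sub>L assoc o\<^sub>L ?E) o\<^sub>L ?v
      o\<^sub>L (?E o\<^sub>L assoc_inv o\<^sub>L (id_blinfun \<otimes>\<^sub>l adj W) o\<^sub>L assoc)"
    by (simp only: blinfun_compose_assoc)
  finally have eq: "id_comult G (qgroup_of K W) V = ?u o\<^sub>L ?v o\<^sub>L ?u'" by (simp only: 1 2)
  show ?thesis
    unfolding eq
  proof
    assume "?u o\<^sub>L ?v o\<^sub>L ?u' = ?v o\<^sub>L ?y"
    then have "?u o\<^sub>L ?v o\<^sub>L ?u' o\<^sub>L ?u = ?v o\<^sub>L ?y o\<^sub>L ?u" by simp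
    moreover have "?u o\<^sub>L ?v o\<^sub>L ?u' o\<^sub>L ?u = ?u o\<^sub>L ?v"
      by (simp add: blinfun_compose_assoc uu sup)
    ultimately show "?u o\<^sub>L ?v = ?v o\<^sub>L ?y o\<^sub>L ?u" by simp
  next
    assume "?u o\<^sub>L ?v = ?v o\<^sub>L ?y o\<^sub>L ?u"
    then show "?u o\<^sub>L ?v o\<^sub>L ?u' = ?v o\<^sub>L ?y" by (simp add: blinfun_compose_assoc uu sup)
  qed
qed

section \<open>Specialisation to generating unitaries of quantum groups\<close>

lemma quantum_groupD:
  assumes gen: "generating_choice \<W>" and C: "quantum_group C"
  shows "hilbert_space (hspace C)" "hspace C \<noteq> {0}"
    and "multiplicative_unitary (hspace C) (\<W> C)"
    and "unitary_on (hspace C \<otimes>\<^sub>s hspace C) (\<W> C)"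
    and "C = qgroup_of (hspace C) (\<W> C)"
  using assms unfolding generating_choice_def generates_def modular_multiplicative_unitary_def
    multiplicative_unitary_def by auto

lemma bicharacters_iff:
  fixes \<W> :: "'h::chilbert mu_choice"
  assumes gen: "generating_choice \<W>" and C: "quantum_group C" and A: "quantum_group A"
  shows "V \<in> bicharacters \<W> C A \<longleftrightarrow>
    V \<in> unitary_multipliers (hspace C \<otimes>\<^sub>s hspace A) (alg (dual \<W> C) \<otimes>\<^sub>a alg A) \<and>
    leg23 (hspace C) V o\<^sub>L leg12 (\<W> C) (hspace A)
      = leg12 (\<W> C) (hspace A) o\<^sub>L leg13 (hspace C) V o\<^sub>L leg23 (hspace C) V \<and>
    leg23 (hspace C) (\<W> A) o\<^sub>L leg12 V (hspace A)
      = leg12 V (hspace A) o\<^sub>L leg13 (hspace A) V o\<^sub>L leg23 (hspace C) (\<W> A)"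
proof -
  let ?H = "hspace C" and ?K = "hspace A" and ?G = "dual_qgroup_of (hspace C) (\<W> C)"
  note CD = quantum_groupD[OF gen C] and AD = quantum_groupD[OF gen A]
  have sG: "hspace ?G = ?H" by (simp add: dual_qgroup_of_def Let_def)
  have cA: "cblinear a" if "a \<in> alg A" for a
    using cblinear_qgroup_of[of "\<W> A" a ?K] that AD(5) unitary_onD(3)[OF AD(4,1,1)] by simp
  have cG: "cblinear a" if "a \<in> alg ?G" for a
    using cblinear_dual_qgroup_of[OF unitary_onD(3)[OF CD(4,1,1)] that] .
  have nA: "nondegenerate ?K (alg A)" using nondegenerate_qgroup_of[OF AD(1,2,4)] AD(5) by simp
  have nG: "nondegenerate (hspace ?G) (alg ?G)" using nondegenerate_dual_qgroup_of[OF CD(1,2,4)] sG by simp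
  have 1: "comult_id ?G A V = leg23 ?H V o\<^sub>L leg13 ?H V \<longleftrightarrow>
      leg23 ?H V o\<^sub>L leg12 (\<W> C) ?K = leg12 (\<W> C) ?K o\<^sub>L leg13 ?H V o\<^sub>L leg23 ?H V"
    if "V \<in> multipliers (?H \<otimes>\<^sub>s ?K) (alg ?G \<otimes>\<^sub>a alg A)"
    by (rule comult_id_iff[OF CD(1,2,4) AD(1) cA nA that])
  have 2: "id_comult ?G A V = leg12 V ?K o\<^sub>L leg13 ?K V \<longleftrightarrow>
      leg23 ?H (\<W> A) o\<^sub>L leg12 V ?K = leg12 V ?K o\<^sub>L leg13 ?K V o\<^sub>L leg23 ?H (\<W> A)"
    if "V \<in> multipliers (?H \<otimes>\<^sub>s ?K) (alg ?G \<otimes>\<^sub>a alg A)"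
  proof -
    have "hilbert_space (hspace ?G)" using CD(1) sG by simp
    moreover have "V \<in> multipliers (hspace ?G \<otimes>\<^sub>s ?K) (alg ?G \<otimes>\<^sub>a alg (qgroup_of ?K (\<W> A)))"
      using that sG AD(5) by simp
    ultimately show ?thesis
      using id_comult_iff[OF AD(1,2,4) _ cG nG, of V] sG AD(5) by simp
  qed
  show ?thesis
    using 1 2 by (auto simp: bicharacters_def dual_def unitary_multipliers_def)
qed

subsection \<open>Associativity\<close>

lemma tensor_map2_id [simp]: "id_blinfun \<otimes>\<^sub>l id_blinfun = id_blinfun"
  by (rule tensor_blinfun_eqI) simp

text \<open>
  The proof takes place on the fourfold tensor product, bracketed to the left.  J2, J4 and J5 permute
  or rebracket the legs, so that each threefold relation, or each pair of commuting operators, sits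
  on adjacent legs.
\<close>

lemma composition_relation_assoc:
  fixes V :: "('a::chilbert, 'b::chilbert) htensor bop" and U :: "('b, 'c::chilbert) htensor bop"
    and T :: "('c, 'd::chilbert) htensor bop" and X :: "('a, 'c) htensor bop"
    and Y :: "('b, 'd) htensor bop" and Z :: "('a, 'd) htensor bop"
  assumes a: "hilbert_space Ha" and b: "hilbert_space Hb" "Hb \<noteq> {0}"
    and c: "hilbert_space Hc" and d: "hilbert_space Hd"
    and V: "unitary_on (Ha \<otimes>\<^sub>s Hb) V" and U: "unitary_on (Hb \<otimes>\<^sub>s Hc) U"
    and X: "X \<in> bounded_ops (Ha \<otimes>\<^sub>s Hc)" and T: "T \<in> bounded_ops (Hc \<otimes>\<^sub>s Hd)"
    and Y: "Y \<in> bounded_ops (Hb \<otimes>\<^sub>s Hd)" and Z: "Z \<in> bounded_ops (Ha \<otimes>\<^sub>s Hd)"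
    and UV: "leg23 Ha U o\<^sub>L leg12 V Hc = leg12 V Hc o\<^sub>L leg13 Hb X o\<^sub>L leg23 Ha U"
    and TU: "leg23 Hb T o\<^sub>L leg12 U Hd = leg12 U Hd o\<^sub>L leg13 Hc Y o\<^sub>L leg23 Hb T"
    and YV: "leg23 Ha Y o\<^sub>L leg12 V Hd = leg12 V Hd o\<^sub>L leg13 Hb Z o\<^sub>L leg23 Ha Y"
  shows "leg23 Ha T o\<^sub>L leg12 X Hd = leg12 X Hd o\<^sub>L leg13 Hc Z o\<^sub>L leg23 Ha T"
proof -
  let ?a = "id_on Ha" and ?b = "id_on Hb" and ?c = "id_on Hc" and ?d = "id_on Hd"
  define J2 :: "('a, (('b, 'c) htensor, 'd) htensor) htensor \<Rightarrow>\<^sub>L ((('a, 'b) htensor, 'c) htensor, 'd) htensor"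
    where "J2 = (assoc_inv \<otimes>\<^sub>l id_blinfun) o\<^sub>L assoc_inv"
  define J2' :: "((('a, 'b) htensor, 'c) htensor, 'd) htensor \<Rightarrow>\<^sub>L ('a, (('b, 'c) htensor, 'd) htensor) htensor"
    where "J2' = assoc o\<^sub>L (assoc \<otimes>\<^sub>l id_blinfun)"
  define J4 :: "((('a, 'c) htensor, 'd) htensor, 'b) htensor \<Rightarrow>\<^sub>L ((('a, 'b) htensor, 'c) htensor, 'd) htensor"
    where "J4 = (swap23 \<otimes>\<^sub>l id_blinfun) o\<^sub>L swap23"
  define J4' :: "((('a, 'b) htensor, 'c) htensor, 'd) htensor \<Rightarrow>\<^sub>L ((('a, 'c) htensor, 'd) htensor, 'b) htensor"
    where "J4' = swap23 o\<^sub>L (swap23 \<otimes>\<^sub>l id_blinfun)"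
  define J5 :: "(('a, 'd) htensor, ('b, 'c) htensor) htensor \<Rightarrow>\<^sub>L ((('a, 'b) htensor, 'c) htensor, 'd) htensor"
    where "J5 = swap23 o\<^sub>L (swap23 \<otimes>\<^sub>l id_blinfun) o\<^sub>L assoc_inv"
  define J5' :: "((('a, 'b) htensor, 'c) htensor, 'd) htensor \<Rightarrow>\<^sub>L (('a, 'd) htensor, ('b, 'c) htensor) htensor"
    where "J5' = assoc o\<^sub>L (swap23 \<otimes>\<^sub>l id_blinfun) o\<^sub>L swap23"
  note J_defs = J2_def J2'_def J4_def J4'_def J5_def J5'_def
  note ca = a b(1) c d and Vf = unitary_onD[OF V a b(1)] and Uf = unitary_onD[OF U b(1) c]
  have cX: "cblinear X" and cT: "cblinear T" and cY: "cblinear Y" and cZ: "cblinear Z"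
    using X T Y Z cblinear_bounded_ops by blast+
  note cs = cX cT cY cZ Vf(3,4) Uf(3,4) ca
  note inv = assoc_compose swap23_swap23
  note RJ = blinfun_compose_assoc tensor_map2_compose
    tensor_map2_compose[THEN blinfun_compose_reassoc] inv inv[THEN blinfun_compose_reassoc]
  have J: "J2' o\<^sub>L J2 = id_blinfun" "J4' o\<^sub>L J4 = id_blinfun" "J4 o\<^sub>L J4' = id_blinfun" "J5' o\<^sub>L J5 = id_blinfun"
    unfolding J_defs by (simp_all add: RJ)
  note id = ca[THEN id_on_idem]

  \<comment> \<open>The four maps amplify threefold operators to four legs: \<open>\<Phi>1\<close>
    acts on legs 123, \<open>\<Phi>2\<close> on 234, \<open>\<Phi>3\<close> on 124 and
    \<open>\<Phi>4\<close> on 134. All are multiplicative on complex-linear operators, so they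
    transport the relations.\<close>
  define \<Phi>1 where "\<Phi>1 R = R \<otimes>\<^sub>l ?d" for R :: "(('a, 'b) htensor, 'c) htensor bop"
  define \<Phi>2 where "\<Phi>2 R = J2 o\<^sub>L (?a \<otimes>\<^sub>l R) o\<^sub>L J2'" for R :: "(('b, 'c) htensor, 'd) htensor bop"
  define \<Phi>3 where "\<Phi>3 R = swap23 o\<^sub>L (R \<otimes>\<^sub>l ?c) o\<^sub>L swap23" for R :: "(('a, 'b) htensor, 'd) htensor bop"
  define \<Phi>4 where "\<Phi>4 R = J4 o\<^sub>L (R \<otimes>\<^sub>l ?b) o\<^sub>L J4'" for R :: "(('a, 'c) htensor, 'd) htensor bop"
  have \<Phi>1: "\<Phi>1 R o\<^sub>L \<Phi>1 S = \<Phi>1 (R o\<^sub>L S)" if "cblinear R" "cblinear S" for R S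
    using that ca by (simp add: \<Phi>1_def tensor_map2_compose id)
  have \<Phi>2: "\<Phi>2 R o\<^sub>L \<Phi>2 S = \<Phi>2 (R o\<^sub>L S)" if "cblinear R" "cblinear S" for R S
    using that ca by (simp add: \<Phi>2_def RJ J(1)[THEN blinfun_compose_reassoc] id)
  have \<Phi>3: "\<Phi>3 R o\<^sub>L \<Phi>3 S = \<Phi>3 (R o\<^sub>L S)" if "cblinear R" "cblinear S" for R S
    using that ca by (simp add: \<Phi>3_def RJ id)
  have \<Phi>4: "\<Phi>4 R o\<^sub>L \<Phi>4 S = \<Phi>4 (R o\<^sub>L S)" if "cblinear R" "cblinear S" for R S
    using that ca by (simp add: \<Phi>4_def RJ J(2)[THEN blinfun_compose_reassoc] id)

  \<comment> \<open>The letters stand for V12, U23, X13, Y24, Z14 and T34. The first two keep an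
    argument so that they can also be used for \<open>adj V\<close> and
    \<open>adj U\<close>.\<close>
  define v where "v R = \<Phi>1 (leg12 R Hc)" for R
  define u where "u R = \<Phi>1 (leg23 Ha R)" for R
  define x where "x = \<Phi>1 (leg13 Hb X)"
  define y where "y = \<Phi>2 (leg13 Hc Y)"
  define z where "z = \<Phi>3 (leg13 Hb Z)"
  define t where "t = \<Phi>2 (leg23 Hb T)"
  note legs = leg12_eq leg13_eq leg23_eq \<Phi>1_def \<Phi>2_def \<Phi>3_def \<Phi>4_def J_defs
    v_def u_def x_def y_def z_def t_def
  \<comment> \<open>Each pair of legs lies in two of the triples. These identities let an operator
    defined through one triple take part in the relation of another.\<close>
  have v3: "v R = \<Phi>3 (leg12 R Hd)" if "cblinear R" for R
    by (rule tensor4_blinfun_eqI) (simp add: legs cs that)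
  have u2: "u R = \<Phi>2 (leg12 R Hd)" if "cblinear R" for R
    by (rule tensor4_blinfun_eqI) (simp add: legs cs that)
  have x4: "x = \<Phi>4 (leg12 X Hd)"
    by (rule tensor4_blinfun_eqI) (simp add: legs cs)
  have y3: "y = \<Phi>3 (leg23 Ha Y)"
  proof (rule tensor4_blinfun_eqI)
    \<comment> \<open>Y applied to a simple tensor is a general vector s of legs 2 and 4, so the
      comparison of rebracketings is needed for all s. The same device recurs below.\<close>
    have "(assoc_inv \<otimes>\<^sub>l id_blinfun) (assoc_inv (x \<otimes>\<^sub>v swap23 (s \<otimes>\<^sub>v z)))
        = swap23 (assoc_inv (x \<otimes>\<^sub>v s) \<otimes>\<^sub>v z)" for x :: 'a and s :: "('b, 'd) htensor" and z :: 'c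
      by (rule tensor_eqI[where t=s]) (intro tensor_bounded_linear | simp)+
    then show "y (((p \<otimes>\<^sub>v q) \<otimes>\<^sub>v r) \<otimes>\<^sub>v s) = \<Phi>3 (leg23 Ha Y) (((p \<otimes>\<^sub>v q) \<otimes>\<^sub>v r) \<otimes>\<^sub>v s)" for p q r s
      by (simp add: legs cs)
  qed
  have t4: "t = \<Phi>4 (leg23 Ha T)"
  proof (rule tensor4_blinfun_eqI)
    have "(assoc_inv \<otimes>\<^sub>l id_blinfun) (assoc_inv (x \<otimes>\<^sub>v assoc_inv (y \<otimes>\<^sub>v s)))
        = (swap23 \<otimes>\<^sub>l id_blinfun) (swap23 (assoc_inv (x \<otimes>\<^sub>v s) \<otimes>\<^sub>v y))"
      for x :: 'a and y :: 'b and s :: "('c, 'd) htensor"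
      by (rule tensor_eqI[where t=s]) (intro tensor_bounded_linear | simp)+
    then show "t (((p \<otimes>\<^sub>v q) \<otimes>\<^sub>v r) \<otimes>\<^sub>v s) = \<Phi>4 (leg23 Ha T) (((p \<otimes>\<^sub>v q) \<otimes>\<^sub>v r) \<otimes>\<^sub>v s)" for p q r s
      by (simp add: legs cs)
  qed
  have z4: "z = \<Phi>4 (leg13 Hc Z)"
  proof (rule tensor4_blinfun_eqI)
    have "swap23 (swap23 (s \<otimes>\<^sub>v y) \<otimes>\<^sub>v z) = (swap23 \<otimes>\<^sub>l id_blinfun) (swap23 (swap23 (s \<otimes>\<^sub>v z) \<otimes>\<^sub>v y))"
      for s :: "('a, 'd) htensor" and y :: 'b and z :: 'c
      by (rule tensor_eqI[where t=s]) (intro tensor_bounded_linear | simp)+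
    then show "z (((p \<otimes>\<^sub>v q) \<otimes>\<^sub>v r) \<otimes>\<^sub>v s) = \<Phi>4 (leg13 Hc Z) (((p \<otimes>\<^sub>v q) \<otimes>\<^sub>v r) \<otimes>\<^sub>v s)" for p q r s
      by (simp add: legs cs)
  qed

  \<comment> \<open>Bracketed as (12)(34), T34 and the operators on legs 12 act on different
    factors, hence commute once their units are absorbed.\<close>
  have t': "t = assoc_inv o\<^sub>L ((?a \<otimes>\<^sub>l ?b) \<otimes>\<^sub>l T) o\<^sub>L assoc"
  proof (rule tensor4_blinfun_eqI)
    have "(assoc_inv \<otimes>\<^sub>l id_blinfun) (assoc_inv (x \<otimes>\<^sub>v assoc_inv (y \<otimes>\<^sub>v s))) = assoc_inv ((x \<otimes>\<^sub>v y) \<otimes>\<^sub>v s)"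
      for x :: 'a and y :: 'b and s :: "('c, 'd) htensor"
      by (rule tensor_eqI[where t=s]) (intro tensor_bounded_linear | simp)+
    then show "t (((p \<otimes>\<^sub>v q) \<otimes>\<^sub>v r) \<otimes>\<^sub>v s)
        = (assoc_inv o\<^sub>L ((?a \<otimes>\<^sub>l ?b) \<otimes>\<^sub>l T) o\<^sub>L assoc) (((p \<otimes>\<^sub>v q) \<otimes>\<^sub>v r) \<otimes>\<^sub>v s)" for p q r s
      by (simp add: legs cs)
  qed
  have v': "v R = assoc_inv o\<^sub>L (R \<otimes>\<^sub>l (?c \<otimes>\<^sub>l ?d)) o\<^sub>L assoc" if "cblinear R" for R
    by (rule tensor4_blinfun_eqI) (simp add: legs cs that)
  have tv: "t o\<^sub>L v R = v R o\<^sub>L t" if "R \<in> bounded_ops (Ha \<otimes>\<^sub>s Hb)" for R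
  proof -
    have R: "cblinear R" "(?a \<otimes>\<^sub>l ?b) o\<^sub>L R = R" "R o\<^sub>L (?a \<otimes>\<^sub>l ?b) = R"
      using that bounded_ops_iff[OF hilbert_space_tensor[of Ha Hb], of R] ca by simp_all
    have "(?c \<otimes>\<^sub>l ?d) o\<^sub>L T = T" "T o\<^sub>L (?c \<otimes>\<^sub>l ?d) = T"
      using T bounded_ops_iff[OF hilbert_space_tensor[of Hc Hd], of T] ca by simp_all
    then show ?thesis using R cs by (simp add: t' v' RJ)
  qed
  \<comment> \<open>The same for the splitting (14)(23), which \<open>J5\<close> reaches.\<close>
  have z': "z = J5 o\<^sub>L (Z \<otimes>\<^sub>l (?b \<otimes>\<^sub>l ?c)) o\<^sub>L J5'"
    by (rule tensor4_blinfun_eqI) (simp add: legs cs)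
  have u': "u R = J5 o\<^sub>L ((?a \<otimes>\<^sub>l ?d) \<otimes>\<^sub>l R) o\<^sub>L J5'" if "cblinear R" for R
  proof (rule tensor4_blinfun_eqI)
    have "swap23 ((swap23 \<otimes>\<^sub>l id_blinfun) (assoc_inv ((x \<otimes>\<^sub>v w) \<otimes>\<^sub>v s))) = assoc_inv (x \<otimes>\<^sub>v s) \<otimes>\<^sub>v w"
      for x :: 'a and w :: 'd and s :: "('b, 'c) htensor"
      by (rule tensor_eqI[where t=s]) (intro tensor_bounded_linear | simp)+
    then show "u R (((p \<otimes>\<^sub>v q) \<otimes>\<^sub>v r) \<otimes>\<^sub>v s)
        = (J5 o\<^sub>L ((?a \<otimes>\<^sub>l ?d) \<otimes>\<^sub>l R) o\<^sub>L J5') (((p \<otimes>\<^sub>v q) \<otimes>\<^sub>v r) \<otimes>\<^sub>v s)" for p q r s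
      by (simp add: legs cs that)
  qed
  have zu: "z o\<^sub>L u R = u R o\<^sub>L z" if "R \<in> bounded_ops (Hb \<otimes>\<^sub>s Hc)" for R
  proof -
    have R: "cblinear R" "(?b \<otimes>\<^sub>l ?c) o\<^sub>L R = R" "R o\<^sub>L (?b \<otimes>\<^sub>l ?c) = R"
      using that bounded_ops_iff[OF hilbert_space_tensor[of Hb Hc], of R] ca by simp_all
    have "(?a \<otimes>\<^sub>l ?d) o\<^sub>L Z = Z" "Z o\<^sub>L (?a \<otimes>\<^sub>l ?d) = Z"
      using Z bounded_ops_iff[OF hilbert_space_tensor[of Ha Hd], of Z] ca by simp_all
    then show ?thesis
      using R cs by (simp add: z' u' RJ J(4)[THEN blinfun_compose_reassoc])
  qed

  define E where "E = ((?a \<otimes>\<^sub>l ?b) \<otimes>\<^sub>l ?c) \<otimes>\<^sub>l ?d"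
  have E1: "E = \<Phi>1 ((?a \<otimes>\<^sub>l ?b) \<otimes>\<^sub>l ?c)" by (simp add: E_def \<Phi>1_def)
  have E2: "E = \<Phi>2 ((?b \<otimes>\<^sub>l ?c) \<otimes>\<^sub>l ?d)"
    by (rule tensor4_blinfun_eqI) (simp add: legs E_def cs)
  have vv: "v (adj V) o\<^sub>L v V = E" and uu: "u (adj U) o\<^sub>L u U = E" "u U o\<^sub>L u (adj U) = E"
    using Vf Uf cs by (simp_all add: v_def u_def E1 \<Phi>1 leg12_compose leg23_compose leg_id_on)
  have Ex: "E o\<^sub>L x = x" "x o\<^sub>L E = x"
    using cs leg13_supported[OF X a b(1) c] by (simp_all add: x_def E1 \<Phi>1)
  have Ey: "E o\<^sub>L y = y"
    using cs leg13_supported[OF Y b(1) c d] by (simp add: y_def E2 \<Phi>2)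
  have Et: "t o\<^sub>L E = t"
    using cs leg23_supported[OF T b(1) c d] by (simp add: t_def E2 \<Phi>2)
  have r1: "u U o\<^sub>L v V = v V o\<^sub>L x o\<^sub>L u U"
    using cs by (simp add: u_def v_def x_def \<Phi>1 UV)
  have r2: "t o\<^sub>L u U = u U o\<^sub>L y o\<^sub>L t"
    using cs by (simp add: u2 t_def y_def \<Phi>2 TU)
  have r3: "y o\<^sub>L v V = v V o\<^sub>L z o\<^sub>L y"
    using cs by (simp add: v3 z_def y3 \<Phi>3 YV)

  have x_eq: "x = v (adj V) o\<^sub>L u U o\<^sub>L v V o\<^sub>L u (adj U)"
  proof -
    have "v (adj V) o\<^sub>L (u U o\<^sub>L v V) o\<^sub>L u (adj U) = (v (adj V) o\<^sub>L v V) o\<^sub>L x o\<^sub>L (u U o\<^sub>L u (adj U))"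
      unfolding r1 by (simp only: blinfun_compose_assoc)
    then show ?thesis by (simp only: vv uu Ex blinfun_compose_assoc)
  qed
  \<comment> \<open>The relation for T and U is solved for moving T34 past the adjoint of U23; Y24
    disappears in the process.\<close>
  have yt: "y o\<^sub>L t o\<^sub>L u (adj U) = u (adj U) o\<^sub>L t"
  proof -
    have "u (adj U) o\<^sub>L (t o\<^sub>L u U) o\<^sub>L u (adj U) = (u (adj U) o\<^sub>L u U) o\<^sub>L y o\<^sub>L t o\<^sub>L u (adj U)"
      unfolding r2 by (simp only: blinfun_compose_assoc)
    moreover have "u (adj U) o\<^sub>L (t o\<^sub>L u U) o\<^sub>L u (adj U) = u (adj U) o\<^sub>L t"
      by (simp only: blinfun_compose_assoc uu Et)
    ultimately show ?thesis by (simp only: uu Ey)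
  qed
  \<comment> \<open>T34 travels through the formula for X13: freely past V12 and its adjoint, past
    U23 at the cost of Y24. Y24 then passes V12 at the cost of Z14 and is removed by
    \<open>yt\<close>.\<close>
  have "t o\<^sub>L x = (t o\<^sub>L v (adj V)) o\<^sub>L u U o\<^sub>L v V o\<^sub>L u (adj U)"
    by (subst x_eq) (simp only: blinfun_compose_assoc)
  also have "\<dots> = v (adj V) o\<^sub>L (t o\<^sub>L u U) o\<^sub>L v V o\<^sub>L u (adj U)"
    by (simp only: tv[OF Vf(2)] blinfun_compose_assoc)
  also have "\<dots> = v (adj V) o\<^sub>L u U o\<^sub>L y o\<^sub>L (t o\<^sub>L v V) o\<^sub>L u (adj U)"
    by (simp only: r2 blinfun_compose_assoc)
  also have "\<dots> = v (adj V) o\<^sub>L u U o\<^sub>L (y o\<^sub>L v V) o\<^sub>L t o\<^sub>L u (adj U)"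
    by (simp only: tv[OF Vf(1)] blinfun_compose_assoc)
  also have "\<dots> = v (adj V) o\<^sub>L u U o\<^sub>L v V o\<^sub>L z o\<^sub>L (y o\<^sub>L t o\<^sub>L u (adj U))"
    by (simp only: r3 blinfun_compose_assoc)
  also have "\<dots> = v (adj V) o\<^sub>L u U o\<^sub>L v V o\<^sub>L (z o\<^sub>L u (adj U)) o\<^sub>L t"
    by (simp only: yt[unfolded blinfun_compose_assoc] blinfun_compose_assoc)
  also have "\<dots> = (v (adj V) o\<^sub>L u U o\<^sub>L v V o\<^sub>L u (adj U)) o\<^sub>L z o\<^sub>L t"
    by (simp only: zu[OF Uf(2)] blinfun_compose_assoc)
  finally have "t o\<^sub>L x = x o\<^sub>L z o\<^sub>L t" by (simp only: x_eq[symmetric])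
  then have "\<Phi>4 (leg23 Ha T o\<^sub>L leg12 X Hd) = \<Phi>4 (leg12 X Hd o\<^sub>L leg13 Hc Z o\<^sub>L leg23 Ha T)"
    using cs by (simp add: x4 z4 t4 \<Phi>4)
  \<comment> \<open>\<open>J4\<close> and \<open>J4'\<close> are mutually inverse, so undoing them
    leaves a plain tensor product with the unit on the second Hilbert space.\<close>
  then have "J4' o\<^sub>L \<Phi>4 (leg23 Ha T o\<^sub>L leg12 X Hd) o\<^sub>L J4
      = J4' o\<^sub>L \<Phi>4 (leg12 X Hd o\<^sub>L leg13 Hc Z o\<^sub>L leg23 Ha T) o\<^sub>L J4" by simp
  then have eq: "(leg23 Ha T o\<^sub>L leg12 X Hd) \<otimes>\<^sub>l ?b = (leg12 X Hd o\<^sub>L leg13 Hc Z o\<^sub>L leg23 Ha T) \<otimes>\<^sub>l ?b"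
    by (simp add: \<Phi>4_def blinfun_compose_assoc J J[THEN blinfun_compose_reassoc])
  obtain b0 where b0: "b0 \<in> Hb" "b0 \<noteq> 0" using exists_nonzero b by blast
  show ?thesis
  proof (rule blinfun_eqI)
    fix s
    have "(leg23 Ha T o\<^sub>L leg12 X Hd) s \<otimes>\<^sub>v b0 = (leg12 X Hd o\<^sub>L leg13 Hc Z o\<^sub>L leg23 Ha T) s \<otimes>\<^sub>v b0"
      using arg_cong[OF eq, of "\<lambda>R. blinfun_apply R (s \<otimes>\<^sub>v b0)"] cs b0 by (simp add: id_on_apply)
    then have "((leg23 Ha T o\<^sub>L leg12 X Hd) s - (leg12 X Hd o\<^sub>L leg13 Hc Z o\<^sub>L leg23 Ha T) s) \<otimes>\<^sub>v b0 = 0"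
      by (simp only: bounded_bilinear.diff_left[OF bounded_bilinear_tensor] right_minus_eq)
    then show "(leg23 Ha T o\<^sub>L leg12 X Hd) s = (leg12 X Hd o\<^sub>L leg13 Hc Z o\<^sub>L leg23 Ha T) s"
      using tensor_eq_0D b0 by fastforce
  qed
qed

theorem proposition3p13:
  fixes \<W> w :: "'h::chilbert mu_choice" and cmp :: "'h composition_op"
  assumes "generating_choice \<W>"
    and "\<forall>C. quantum_group C \<longrightarrow> reduced_bicharacter \<W> C (w C)"
    and "bicharacter_composition \<W> cmp"
  shows "(\<forall>C A B D. quantum_group C \<longrightarrow> quantum_group A \<longrightarrow> quantum_group B \<longrightarrow> quantum_group D \<longrightarrow>
      (\<forall>V\<in>bicharacters \<W> C A. \<forall>U\<in>bicharacters \<W> A B. \<forall>T\<in>bicharacters \<W> B D.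
         cmp C B D T (cmp C A B U V) = cmp C A D (cmp A B D T U) V))
    \<and> (\<forall>C A. quantum_group C \<longrightarrow> quantum_group A \<longrightarrow>
         w C \<in> bicharacters \<W> C C \<and>
         (\<forall>V\<in>bicharacters \<W> C A. cmp C C A V (w C) = V) \<and>
         (\<forall>V\<in>bicharacters \<W> A C. cmp A C C (w C) V = V))
    \<and> category {C. quantum_group C} (bicharacters \<W>) cmp w"
proof -
  note gen = assms(1)
  have comp: "cmp C A B U V \<in> bicharacters \<W> C B"
      "leg23 (hspace C) U o\<^sub>L leg12 V (hspace B) =
        leg12 V (hspace B) o\<^sub>L leg13 (hspace A) (cmp C A B U V) o\<^sub>L leg23 (hspace C) U"
      "\<And>Y. \<lbrakk>Y \<in> bicharacters \<W> C B; leg23 (hspace C) U o\<^sub>L leg12 V (hspace B) =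
        leg12 V (hspace B) o\<^sub>L leg13 (hspace A) Y o\<^sub>L leg23 (hspace C) U\<rbrakk> \<Longrightarrow> cmp C A B U V = Y"
    if "quantum_group C" "quantum_group A" "quantum_group B"
      "V \<in> bicharacters \<W> C A" "U \<in> bicharacters \<W> A B" for C A B U V
  proof -
    have "is_composition \<W> C A B U V (cmp C A B U V)"
      using assms(3) that unfolding bicharacter_composition_def by blast
    then show "cmp C A B U V \<in> bicharacters \<W> C B"
      "leg23 (hspace C) U o\<^sub>L leg12 V (hspace B) =
        leg12 V (hspace B) o\<^sub>L leg13 (hspace A) (cmp C A B U V) o\<^sub>L leg23 (hspace C) U"
      "\<And>Y. \<lbrakk>Y \<in> bicharacters \<W> C B; leg23 (hspace C) U o\<^sub>L leg12 V (hspace B) =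
        leg12 V (hspace B) o\<^sub>L leg13 (hspace A) Y o\<^sub>L leg23 (hspace C) U\<rbrakk> \<Longrightarrow> cmp C A B U V = Y"
      unfolding is_composition_def Let_def by metis+
  qed
  have uni: "unitary_on (hspace C \<otimes>\<^sub>s hspace A) V" "V \<in> bounded_ops (hspace C \<otimes>\<^sub>s hspace A)"
    if "V \<in> bicharacters \<W> C A" for C A V
    using that by (simp_all add: bicharacters_def unitary_multipliers_def unitary_on_def)
  have assoc: "cmp C B D T (cmp C A B U V) = cmp C A D (cmp A B D T U) V"
    if q: "quantum_group C" "quantum_group A" "quantum_group B" "quantum_group D"
      and V: "V \<in> bicharacters \<W> C A" and U: "U \<in> bicharacters \<W> A B" and T: "T \<in> bicharacters \<W> B D"
    for C A B D V U T
  proof -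
    note UV = comp[OF q(1,2,3) V U] and TU = comp[OF q(2,3,4) U T]
    note TUV = comp[OF q(1,2,4) V TU(1)]
    note h = q[THEN quantum_groupD(1)[OF gen]]
    \<comment> \<open>The right-hand side is already a bicharacter, so uniqueness of the composition
      on the left reduces the claim to the defining relation alone.\<close>
    show ?thesis
      by (rule comp(3)[OF q(1,3,4) UV(1) T TUV(1)],
          rule composition_relation_assoc[OF h(1,2) quantum_groupD(2)[OF gen q(2)] h(3,4)
            uni(1)[OF V] uni(1)[OF U] uni(2)[OF UV(1)] uni(2)[OF T] uni(2)[OF TU(1)] uni(2)[OF TUV(1)]
            UV(2) TU(2) TUV(2)])
  qed
  have w: "w C = \<W> C" and wb: "w C \<in> bicharacters \<W> C C" if C: "quantum_group C" for C
  proof -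
    show w: "w C = \<W> C" using assms(2) C by (simp add: reduced_bicharacter_def)
    have "w C \<in> unitary_multipliers (hspace C \<otimes>\<^sub>s hspace C) (alg (dual \<W> C) \<otimes>\<^sub>a alg C)"
      using assms(2) C unfolding reduced_bicharacter_def by blast
    then show "w C \<in> bicharacters \<W> C C"
      using quantum_groupD(3)[OF gen C]
      by (simp add: bicharacters_iff[OF gen C C] w multiplicative_unitary_def)
  qed
  have left: "cmp C C A V (w C) = V" if "quantum_group C" "quantum_group A" "V \<in> bicharacters \<W> C A" for C A V
    using that bicharacters_iff[OF gen, of C A V]
    by (intro comp(3)[OF that(1,1,2) wb[OF that(1)]]) (auto simp: w)
  have right: "cmp A C C (w C) V = V" if "quantum_group C" "quantum_group A" "V \<in> bicharacters \<W> A C" for C A V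
    using that bicharacters_iff[OF gen, of A C V]
    by (intro comp(3)[OF that(2,1,1) that(3) wb[OF that(1)]]) (auto simp: w)
  have "category {C. quantum_group C} (bicharacters \<W>) cmp w"
    unfolding category_def using comp(1) assoc left right wb by simp
  then show ?thesis
    by (intro conjI allI impI ballI) (assumption | rule assoc left right wb)+
qed

end
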